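(* Let $X_t=g(\varepsilon_t,\varepsilon_{t-1},\ldots)$, $t\in\mathbb Z$, be a real-valued Bernoulli shift, where $\{\varepsilon_t\}_{t\in\mathbb Z}$ is a sequence of iid random elements of a measurable space $S$ and $g:S^\infty\to\mathbb R$ is measurable. Assume that $\operatorname E X_0=0$, $\operatorname E|X_0|^4<\infty$, and $$\Theta_4=\sum_{t=0}^\infty\|X_t-X_{t,\{0\}}\|_4<\infty .$$ Let $f(0)>0$, where $f$ is the spectral density of $\{X_t\}$, and let $m=m_n$ be a sequence of positive integers with $m\to\infty$ and $m=o(n)$ as $n\to\infty$. Then $$\frac{\sqrt m}{f(0)}\,(Q_n-\operatorname E Q_n)\xrightarrow{d}\mathcal N(0,1)\quad\text{as }n\to\infty .$$
   Context: $\|X\|_p=(\operatorname E|X|^p)^{1/p}$. Let $\{\varepsilon_t'\}_{t\in\mathbb Z}$ be an independent copy of $\{\varepsilon_t\}_{t\in\mathbb Z}$; $X_{t,\{0\}}=g(\varepsilon_t,\ldots,\varepsilon_1,\varepsilon_0',\varepsilon_{-1},\ldots)$ is obtained from $X_t$ by replacing $\varepsilon_0$ by $\varepsilon_0'$. The autocovariances are $\gamma(h)=\operatorname{Cov}(X_h,X_0)$, and the spectral density is $f(\omega)=\frac1{2\pi}\sum_{h=-\infty}^\infty\gamma(h)e^{-ih\omega}$, $\omega\in[-\pi,\pi]$ (the autocovariances are absolutely summable under the stated assumptions). The Fourier frequencies are $\omega_j=2\pi j/n$, the periodogram of $X_1,\ldots,X_n$ is $I_n(\omega_j)=\bigl|\frac1{\sqrt{2\pi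 n}}\sum_{t=1}^nX_te^{-it\omega_j}\bigr|^2$, and $Q_n=\frac1m\sum_{j=1}^mI_n(\omega_j)$. $\xrightarrow{d}$ denotes convergence in distribution. *)

theory Defs
  imports "HOL-Probability.Probability" "HOL-Library.Landau_Symbols"
begin

definition iid_sequence ::
    "'a measure \<Rightarrow> 's measure \<Rightarrow> (int \<Rightarrow> 'a \<Rightarrow> 's) \<Rightarrow> bool" where
  "iid_sequence M S \<epsilon> \<longleftrightarrow>
     prob_space.indep_vars M (\<lambda>_. S) \<epsilon> UNIV \<and>
     (\<forall>s t. distr M S (\<epsilon> s) = distr M S (\<epsilon> t))"

text \<open>Both conditions concern the whole sequences, regarded as random elements of the product space.\<close>
definition independent_copy ::
    "'a measure \<Rightarrow> 's measure \<Rightarrow> (int \<Rightarrow> 'a \<Rightarrow> 's) \<Rightarrow> (int \<Rightarrow> 'a \<Rightarrow> 's) \<Rightarrow> bool" where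
  "independent_copy M S \<epsilon>' \<epsilon> \<longleftrightarrow>
     prob_space.indep_var M
       (PiM UNIV (\<lambda>_. S)) (\<lambda>\<omega> t. \<epsilon> t \<omega>) (PiM UNIV (\<lambda>_. S)) (\<lambda>\<omega> t. \<epsilon>' t \<omega>) \<and>
     distr M (PiM UNIV (\<lambda>_. S)) (\<lambda>\<omega> t. \<epsilon>' t \<omega>) =
     distr M (PiM UNIV (\<lambda>_. S)) (\<lambda>\<omega> t. \<epsilon> t \<omega>)"

definition bernoulli_shift ::
    "((nat \<Rightarrow> 's) \<Rightarrow> real) \<Rightarrow> (int \<Rightarrow> 'a \<Rightarrow> 's) \<Rightarrow> int \<Rightarrow> 'a \<Rightarrow> real" where
  "bernoulli_shift g \<epsilon> t \<omega> = g (\<lambda>k. \<epsilon> (t - int k) \<omega>)"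

definition coupled_shift ::
    "((nat \<Rightarrow> 's) \<Rightarrow> real) \<Rightarrow> (int \<Rightarrow> 'a \<Rightarrow> 's) \<Rightarrow> (int \<Rightarrow> 'a \<Rightarrow> 's) \<Rightarrow> int \<Rightarrow> 'a \<Rightarrow> real" where
  "coupled_shift g \<epsilon> \<epsilon>' = bernoulli_shift g (\<epsilon>(0 := \<epsilon>' 0))"

text \<open>Meaningful only for random variables with a finite absolute moment of order \<open>p\<close>:
  the Bochner integral of a non-integrable function is 0.\<close>
definition Lp_norm :: "'a measure \<Rightarrow> real \<Rightarrow> ('a \<Rightarrow> real) \<Rightarrow> real" where
  "Lp_norm M p X = (LINT \<omega>|M. \<bar>X \<omega>\<bar> powr p) powr (1 / p)"

definition covariance :: "'a measure \<Rightarrow> ('a \<Rightarrow> real) \<Rightarrow> ('a \<Rightarrow> real) \<Rightarrow> real" where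
  "covariance M X Y =
     (LINT \<omega>|M. (X \<omega> - (LINT \<omega>'|M. X \<omega>')) * (Y \<omega> - (LINT \<omega>'|M. Y \<omega>')))"

definition autocovariance :: "'a measure \<Rightarrow> (int \<Rightarrow> 'a \<Rightarrow> real) \<Rightarrow> int \<Rightarrow> real" where
  "autocovariance M X h = covariance M (X h) (X 0)"

text \<open>For a stationary process the autocovariances are even in the lag, so that the sum is real;
  \<open>Re\<close> only changes its type.\<close>
definition spectral_density :: "'a measure \<Rightarrow> (int \<Rightarrow> 'a \<Rightarrow> real) \<Rightarrow> real \<Rightarrow> real" where
  "spectral_density M X w =
     Re (1 / (2 * of_real pi) *
         (\<Sum>\<^sub>\<infinity>h\<in>UNIV. of_real (autocovariance M X h) * exp (- \<i> * of_int h * of_real w)))"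

definition fourier_frequency :: "nat \<Rightarrow> nat \<Rightarrow> real" where
  "fourier_frequency n j = 2 * pi * real j / real n"

definition periodogram :: "(int \<Rightarrow> 'a \<Rightarrow> real) \<Rightarrow> nat \<Rightarrow> real \<Rightarrow> 'a \<Rightarrow> real" where
  "periodogram X n w \<omega> =
     (cmod (1 / of_real (sqrt (2 * pi * real n)) *
            (\<Sum>t=1..n. of_real (X (int t) \<omega>) * exp (- \<i> * of_nat t * of_real w))))\<^sup>2"

definition averaged_periodogram :: "(int \<Rightarrow> 'a \<Rightarrow> real) \<Rightarrow> nat \<Rightarrow> nat \<Rightarrow> 'a \<Rightarrow> real" where
  "averaged_periodogram X m n \<omega> =
     1 / real m * (\<Sum>j=1..m. periodogram X n (fourier_frequency n j) \<omega>)"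

end

(* Write sqrt m * Q_n as a quadratic form: the sum over s, t of a(s - t) X_s X_t, where a is a
   normalised sum of the cosines of the first m Fourier frequencies. Resampling one innovation at a
   time (Efron-Stein for p = 2 and its analogue for p = 4) shows that a centered quadratic form has
   L^2 norm at most a constant times Theta_4(X) Theta_4(Y) times the Frobenius norm of its kernel.
   Hence all modifications that are small in Theta_4 or in Frobenius norm are harmless: X is replaced
   by a bounded process Y that depends on finitely many innovations, and, since the frequencies
   2 pi j / n, j <= m, tend to 0, the kernel by one that is constant on long blocks. This turns the
   form into an off-diagonal quadratic form in iid bounded block sums, with matrix c. For such a form
   T, Stein's method in the form of Tikhomirov gives phi' + v u phi -> 0 for the characteristic
   function phi of T, as soon as the operator norm of c tends to 0 and its Frobenius norm converges.
   Both follow from orthogonality of the cosines: the matrix a(s - t) is a multiple of a projection. *)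

theory Submission
  imports Defs
begin

section \<open>\<open>L\<^sup>p\<close> norms\<close>

text \<open>Only the summability of the coupling distances is available, neither densities nor
  cumulants, so every estimate has to come from resampling. Influences are summed without squares
  because the matrix indexed by time and innovation then has row and column sums at most \<Theta>_4,
  and Schur's test turns this into operator bounds. Fourth moments enter because products of two
  linear forms must lie in L^2. The proof lives on the law \<open>P\<close> of the innovation
  sequence, where conditional expectations are integrals over resampled coordinates and independence
  is Fubini's theorem. The error in Stein's method grows with the block length and with the bound on
  the block sums, but carries the operator norm as a factor; hence both are fixed before n tends to
  infinity. The limiting variance is 2 sigma^2 times the squared Frobenius norm, with sigma the sum
  of the autocovariances: 2 sigma^2 / (8 pi^2) = (sigma / (2 pi))^2 = f(0)^2.\<close>

text \<open>Only even exponents \<open>p\<close> are used, so that no absolute value is needed.\<close>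

definition in_Lp :: "'a measure \<Rightarrow> nat \<Rightarrow> ('a \<Rightarrow> real) \<Rightarrow> bool" where
  "in_Lp M p F \<longleftrightarrow> F \<in> borel_measurable M \<and> integrable M (\<lambda>x. F x ^ p)"

definition norm_Lp :: "'a measure \<Rightarrow> nat \<Rightarrow> ('a \<Rightarrow> real) \<Rightarrow> real" where
  "norm_Lp M p F = root p (LINT x|M. F x ^ p)"

lemma in_LpD [measurable_dest]: "in_Lp M p F \<Longrightarrow> F \<in> borel_measurable M"
  by (simp add: in_Lp_def)

lemma in_Lp_integrable: "in_Lp M p F \<Longrightarrow> integrable M (\<lambda>x. F x ^ p)"
  by (simp add: in_Lp_def)

lemma norm_Lp_nonneg [simp]: "even p \<Longrightarrow> 0 \<le> norm_Lp M p F"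
  unfolding norm_Lp_def by (cases "p = 0") (auto intro!: real_root_ge_zero integral_nonneg_AE simp: zero_le_even_power)

lemma norm_Lp_power: "even p \<Longrightarrow> 0 < p \<Longrightarrow> norm_Lp M p F ^ p = (LINT x|M. F x ^ p)"
  unfolding norm_Lp_def
  by (rule real_root_pow_pos2) (auto intro!: integral_nonneg_AE simp: zero_le_even_power)

lemma norm_Lp_leI:
  assumes "even p" "0 < p" "0 \<le> c" "(LINT x|M. F x ^ p) \<le> c ^ p"
  shows "norm_Lp M p F \<le> c"
  using assms by (metis norm_Lp_power power_le_imp_le_base power_mono_iff norm_Lp_nonneg)

lemma norm_Lp_leD:
  assumes "even p" "0 < p" "norm_Lp M p F \<le> c"
  shows "(LINT x|M. F x ^ p) \<le> c ^ p"
  using assms by (metis norm_Lp_power power_mono norm_Lp_nonneg)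

lemma even_power_mono_abs: "even p \<Longrightarrow> \<bar>x\<bar> \<le> \<bar>y\<bar> \<Longrightarrow> x ^ p \<le> (y::real) ^ p"
  by (metis power_even_abs power_mono abs_ge_zero)

lemma in_Lp_mono:
  assumes "even p" "in_Lp M p G" "F \<in> borel_measurable M" "AE x in M. \<bar>F x\<bar> \<le> \<bar>G x\<bar>"
  shows "in_Lp M p F"
  unfolding in_Lp_def
proof
  show "integrable M (\<lambda>x. F x ^ p)"
    by (rule Bochner_Integration.integrable_bound[OF in_Lp_integrable[OF assms(2)]])
       (use assms in \<open>auto elim!: eventually_mono simp: power_abs intro!: power_mono\<close>)
qed (use assms in auto)

lemma norm_Lp_mono:
  assumes "even p" "0 < p" "in_Lp M p G" "F \<in> borel_measurable M" "AE x in M. \<bar>F x\<bar> \<le> \<bar>G x\<bar>"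
  shows "norm_Lp M p F \<le> norm_Lp M p G"
  unfolding norm_Lp_def using assms
  by (auto intro!: integral_mono_AE in_Lp_integrable intro: in_Lp_mono elim!: eventually_mono
           simp: even_power_mono_abs)

lemma norm_Lp_cong_AE:
  assumes "F \<in> borel_measurable M" "G \<in> borel_measurable M" "AE x in M. F x = G x"
  shows "norm_Lp M p F = norm_Lp M p G"
  unfolding norm_Lp_def using assms by (auto intro!: arg_cong[of _ _ "root p"] integral_cong_AE)

lemma real_root_power_even: "even p \<Longrightarrow> 0 < p \<Longrightarrow> root p (x ^ p) = \<bar>x\<bar>"
  by (metis power_even_abs real_root_power_cancel abs_ge_zero)

lemma in_Lp_add:
  assumes "even p" "in_Lp M p F" "in_Lp M p G"
  shows "in_Lp M p (\<lambda>x. F x + G x)"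
  unfolding in_Lp_def
proof
  note [measurable] = in_LpD[OF assms(2)] in_LpD[OF assms(3)]
  show "(\<lambda>x. F x + G x) \<in> borel_measurable M" by measurable
  have *: "(u + v) ^ p \<le> 2 ^ p * (u ^ p + v ^ p)" for u v :: real
  proof -
    have "\<bar>u + v\<bar> \<le> \<bar>2 * max \<bar>u\<bar> \<bar>v\<bar>\<bar>" by auto
    then have "(u + v) ^ p \<le> (2 * max \<bar>u\<bar> \<bar>v\<bar>) ^ p" by (rule even_power_mono_abs[OF assms(1)])
    also have "\<dots> = 2 ^ p * (max \<bar>u\<bar> \<bar>v\<bar>) ^ p" by (simp add: power_mult_distrib)
    also have "(max \<bar>u\<bar> \<bar>v\<bar>) ^ p \<le> u ^ p + v ^ p"
      using assms(1) by (auto simp: max_def power_even_abs zero_le_even_power)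
    finally show ?thesis by simp
  qed
  have "integrable M (\<lambda>x. 2 ^ p * (F x ^ p + G x ^ p))"
    using assms by (auto simp: in_Lp_def)
  then show "integrable M (\<lambda>x. (F x + G x) ^ p)"
  proof (rule Bochner_Integration.integrable_bound)
    show "AE x in M. norm ((F x + G x) ^ p) \<le> norm (2 ^ p * (F x ^ p + G x ^ p))"
      using *  assms(1) by (auto simp: zero_le_even_power intro: order.trans[OF _ abs_ge_self])
  qed measurable
qed

lemma in_Lp_cmult:
  assumes "in_Lp M p F" shows "in_Lp M p (\<lambda>x. c * F x)"
  using assms by (auto simp: in_Lp_def power_mult_distrib)

lemma norm_Lp_cmult:
  assumes "even p" "0 < p" shows "norm_Lp M p (\<lambda>x. c * F x) = \<bar>c\<bar> * norm_Lp M p F"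
  using assms by (simp add: norm_Lp_def power_mult_distrib real_root_mult real_root_power_even)

lemma in_Lp_uminus:
  assumes "in_Lp M p F" shows "in_Lp M p (\<lambda>x. - F x)"
  using in_Lp_cmult[OF assms, of "-1"] by simp

lemma norm_Lp_uminus:
  assumes "even p" "0 < p" shows "norm_Lp M p (\<lambda>x. - F x) = norm_Lp M p F"
  using norm_Lp_cmult[OF assms, of M "-1" F] by simp

lemma in_Lp_diff:
  assumes "even p" "in_Lp M p F" "in_Lp M p G"
  shows "in_Lp M p (\<lambda>x. F x - G x)"
  using in_Lp_add[OF assms(1,2) in_Lp_uminus[OF assms(3)]] by simp

lemma in_Lp_zero [simp]: "0 < p \<Longrightarrow> in_Lp M p (\<lambda>x. 0)"
  by (simp add: in_Lp_def power_0_left)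

lemma norm_Lp_zero [simp]: "0 < p \<Longrightarrow> norm_Lp M p (\<lambda>x. 0) = 0"
  by (simp add: norm_Lp_def power_0_left)

lemma in_Lp_sum:
  assumes "even p" "0 < p" "\<And>i. i \<in> I \<Longrightarrow> in_Lp M p (F i)"
  shows "in_Lp M p (\<lambda>x. \<Sum>i\<in>I. F i x)"
  using assms(3)
  by (induction I rule: infinite_finite_induct) (auto intro!: in_Lp_add in_Lp_zero assms(1,2))

text \<open>Minkowski's inequality from convexity of the even power:
  \<open>(F + G) / (a + b)\<close> is the convex combination of \<open>F / a\<close> and
  \<open>G / b\<close> with weights \<open>a / (a + b)\<close> and \<open>b / (a + b)\<close>. The
  \<open>e\<close> keeps \<open>a\<close> and \<open>b\<close> positive when a norm
  vanishes.\<close>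

lemma norm_Lp_triangle:
  assumes p: "even p" "0 < p" and F: "in_Lp M p F" and G: "in_Lp M p G"
  shows "norm_Lp M p (\<lambda>x. F x + G x) \<le> norm_Lp M p F + norm_Lp M p G"
proof (rule field_le_epsilon)
  fix e :: real assume e: "0 < e"
  define a b where "a = norm_Lp M p F + e / 2" and "b = norm_Lp M p G + e / 2"
  have ab: "a > 0" "b > 0" using e p by (auto simp: a_def b_def intro!: add_nonneg_pos)
  have pw: "(F x + G x) ^ p \<le> (a + b) ^ p * (a / (a + b) * (F x / a) ^ p + b / (a + b) * (G x / b) ^ p)" for x
  proof -
    have "((1 - b / (a + b)) *\<^sub>R (F x / a) + (b / (a + b)) *\<^sub>R (G x / b)) ^ p
        \<le> (1 - b / (a + b)) * (F x / a) ^ p + b / (a + b) * (G x / b) ^ p"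
      using ab by (intro convex_onD[OF convex_power_even[OF p(1)]]) auto
    moreover have "1 - b / (a + b) = a / (a + b)" using ab by (simp add: field_simps)
    moreover have "(a / (a + b)) *\<^sub>R (F x / a) + (b / (a + b)) *\<^sub>R (G x / b) = (F x + G x) / (a + b)"
      using ab by (simp add: add_divide_distrib)
    ultimately have "((F x + G x) / (a + b)) ^ p \<le> a / (a + b) * (F x / a) ^ p + b / (a + b) * (G x / b) ^ p"
      by simp
    then have "(a + b) ^ p * ((F x + G x) / (a + b)) ^ p \<le> (a + b) ^ p * (a / (a + b) * (F x / a) ^ p + b / (a + b) * (G x / b) ^ p)"
      using ab by (intro mult_left_mono) auto
    then show ?thesis using ab by (simp add: power_divide)
  qed
  have iF: "integrable M (\<lambda>x. F x ^ p)" and iG: "integrable M (\<lambda>x. G x ^ p)"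
    using F G by (auto simp: in_Lp_def)
  have "(LINT x|M. (F x + G x) ^ p) \<le>
      (LINT x|M. (a + b) ^ p * (a / (a + b) * (F x / a) ^ p + b / (a + b) * (G x / b) ^ p))"
    using in_Lp_integrable[OF in_Lp_add[OF p(1) F G]] iF iG
    by (intro integral_mono pw) (auto simp: power_divide)
  also have "\<dots> = (a + b) ^ p * (a / (a + b) * ((LINT x|M. F x ^ p) / a ^ p) + b / (a + b) * ((LINT x|M. G x ^ p) / b ^ p))"
    using iF iG by (simp add: power_divide)
  also have "\<dots> \<le> (a + b) ^ p * (a / (a + b) * 1 + b / (a + b) * 1)"
  proof -
    have "(LINT x|M. F x ^ p) \<le> a ^ p" "(LINT x|M. G x ^ p) \<le> b ^ p"
      using e by (auto intro!: norm_Lp_leD p simp: a_def b_def)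
    then show ?thesis using ab by (intro mult_left_mono add_mono) (auto simp: divide_le_eq)
  qed
  also have "a / (a + b) * 1 + b / (a + b) * 1 = 1" using ab by (simp add: add_divide_distrib[symmetric])
  finally have "norm_Lp M p (\<lambda>x. F x + G x) \<le> a + b"
    using ab by (intro norm_Lp_leI p) auto
  then show "norm_Lp M p (\<lambda>x. F x + G x) \<le> norm_Lp M p F + norm_Lp M p G + e"
    by (simp add: a_def b_def)
qed

lemma norm_Lp_triangle_diff:
  assumes p: "even p" "0 < p" and F: "in_Lp M p F" and G: "in_Lp M p G"
  shows "norm_Lp M p (\<lambda>x. F x - G x) \<le> norm_Lp M p F + norm_Lp M p G"
  using norm_Lp_triangle[OF p F in_Lp_uminus[OF G]] by (simp add: norm_Lp_uminus p)

lemma norm_Lp_sum: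
  assumes "even p" "0 < p" "\<And>i. i \<in> I \<Longrightarrow> in_Lp M p (F i)"
  shows "norm_Lp M p (\<lambda>x. \<Sum>i\<in>I. F i x) \<le> (\<Sum>i\<in>I. norm_Lp M p (F i))"
  using assms(3)
proof (induction I rule: infinite_finite_induct)
  case (insert i I)
  have "norm_Lp M p (\<lambda>x. F i x + (\<Sum>i\<in>I. F i x)) \<le> norm_Lp M p (F i) + norm_Lp M p (\<lambda>x. \<Sum>i\<in>I. F i x)"
    using insert assms by (intro norm_Lp_triangle in_Lp_sum) auto
  with insert show ?case by force
qed (use assms in auto)

lemma in_Lp_distr:
  assumes "T \<in> measurable M N" "F \<in> borel_measurable N"
  shows "in_Lp (distr M N T) p F \<longleftrightarrow> in_Lp M p (\<lambda>x. F (T x))"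
  using assms by (auto simp: in_Lp_def integrable_distr_eq)

lemma norm_Lp_distr:
  assumes "T \<in> measurable M N" "F \<in> borel_measurable N"
  shows "norm_Lp (distr M N T) p F = norm_Lp M p (\<lambda>x. F (T x))"
  using assms by (auto simp: norm_Lp_def integral_distr)

text \<open>Cauchy-Schwarz for the squares, by the arithmetic-geometric inequality with weights
  balanced by the two norms. The norms are enlarged by \<open>e\<close>, so that one may divide by
  them, and \<open>e\<close> tends to 0 at the end.\<close>

lemma norm_Lp_2_mult:
  assumes F: "in_Lp M 4 F" and G: "in_Lp M 4 G"
  shows "in_Lp M 2 (\<lambda>x. F x * G x)" "norm_Lp M 2 (\<lambda>x. F x * G x) \<le> norm_Lp M 4 F * norm_Lp M 4 G"
proof -
  note [measurable] = in_LpD[OF F] in_LpD[OF G]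
  have iF: "integrable M (\<lambda>x. F x ^ 4)" and iG: "integrable M (\<lambda>x. G x ^ 4)"
    using F G by (auto simp: in_Lp_def)
  have amgm: "(F x * G x)\<^sup>2 \<le> (b / a)\<^sup>2 / 2 * F x ^ 4 + (a / b)\<^sup>2 / 2 * G x ^ 4" if "a > 0" "b > 0" for x and a b :: real
  proof -
    have "0 \<le> (b / a * (F x)\<^sup>2 - a / b * (G x)\<^sup>2)\<^sup>2" by simp
    also have "\<dots> = (b / a)\<^sup>2 * F x ^ 4 + (a / b)\<^sup>2 * G x ^ 4 - 2 * (F x * G x)\<^sup>2"
      using that by (simp add: power2_eq_square power4_eq_xxxx field_simps)
    finally show ?thesis by simp
  qed
  show *: "in_Lp M 2 (\<lambda>x. F x * G x)"
    unfolding in_Lp_def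
  proof
    have "integrable M (\<lambda>x. (1 / 1)\<^sup>2 / 2 * F x ^ 4 + (1 / 1)\<^sup>2 / 2 * G x ^ 4)" using iF iG by simp
    then show "integrable M (\<lambda>x. (F x * G x)\<^sup>2)"
      by (rule Bochner_Integration.integrable_bound)
         (use amgm[of 1 1] in \<open>auto intro: order.trans[OF _ abs_ge_self]\<close>)
  qed measurable
  show "norm_Lp M 2 (\<lambda>x. F x * G x) \<le> norm_Lp M 4 F * norm_Lp M 4 G"
  proof (rule tendsto_lowerbound)
    let ?f = "norm_Lp M 4 F" and ?g = "norm_Lp M 4 G"
    have "((\<lambda>e. (?f + e) * (?g + e)) \<longlongrightarrow> (?f + 0) * (?g + 0)) (at_right 0)" by (intro tendsto_intros)
    then show "((\<lambda>e. (?f + e) * (?g + e)) \<longlongrightarrow> ?f * ?g) (at_right 0)" by simp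
    have "norm_Lp M 2 (\<lambda>x. F x * G x) \<le> (?f + e) * (?g + e)" if e: "0 < e" for e
    proof (rule norm_Lp_leI)
      define a b where "a = ?f + e" and "b = ?g + e"
      have ab: "a > 0" "b > 0" using e by (auto simp: a_def b_def intro!: add_nonneg_pos)
      have le: "(LINT x|M. F x ^ 4) \<le> a ^ 4" "(LINT x|M. G x ^ 4) \<le> b ^ 4"
        using e by (auto intro!: norm_Lp_leD simp: a_def b_def)
      have "(LINT x|M. (F x * G x)\<^sup>2) \<le> (LINT x|M. (b / a)\<^sup>2 / 2 * F x ^ 4 + (a / b)\<^sup>2 / 2 * G x ^ 4)"
        using iF iG in_Lp_integrable[OF *] by (intro integral_mono amgm ab) auto
      also have "\<dots> = (b / a)\<^sup>2 / 2 * (LINT x|M. F x ^ 4) + (a / b)\<^sup>2 / 2 * (LINT x|M. G x ^ 4)"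
        using iF iG by simp
      also have "\<dots> \<le> (b / a)\<^sup>2 / 2 * a ^ 4 + (a / b)\<^sup>2 / 2 * b ^ 4"
        by (intro add_mono mult_left_mono le) auto
      also have "\<dots> = (a * b)\<^sup>2" using ab by (simp add: power2_eq_square power4_eq_xxxx field_simps)
      finally show "(LINT x|M. (F x * G x)\<^sup>2) \<le> ((?f + e) * (?g + e))\<^sup>2" by (simp add: a_def b_def)
    qed (use e in auto)
    then show "\<forall>\<^sub>F e in at_right 0. norm_Lp M 2 (\<lambda>x. F x * G x) \<le> (?f + e) * (?g + e)"
      by (auto simp: eventually_at_right_less eventually_at_filter)
  qed simp
qed

lemma (in prob_space) integrable_Lp:
  assumes "even p" "0 < p" "in_Lp M p F" shows "integrable M F"
proof (rule Bochner_Integration.integrable_bound)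
  show "integrable M (\<lambda>x. 1 + F x ^ p)" using in_Lp_integrable[OF assms(3)] by simp
  have "\<bar>u\<bar> \<le> \<bar>1 + u ^ p\<bar>" for u :: real
  proof (cases "\<bar>u\<bar> \<le> 1")
    case True
    then show ?thesis using assms(1) zero_le_even_power[of p u] by linarith
  next
    case False
    then have "\<bar>u\<bar> \<le> \<bar>u\<bar> ^ p" using assms(2) by (intro self_le_power) auto
    then show ?thesis using assms(1) by (simp add: power_even_abs)
  qed
  then show "AE x in M. norm (F x) \<le> norm (1 + F x ^ p)" by simp
qed (use in_LpD[OF assms(3)] in measurable)

lemma (in prob_space) expectation_power_le:
  assumes "even p" "0 < p" "in_Lp M p F" shows "(LINT x|M. F x) ^ p \<le> (LINT x|M. F x ^ p)"
  by (rule jensens_inequality[of F UNIV, where q = "\<lambda>x. x ^ p"])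
     (use assms in \<open>auto simp: integrable_Lp in_Lp_integrable convex_power_even\<close>)

lemma (in prob_space) abs_expectation_le_norm_Lp:
  assumes "even p" "0 < p" "in_Lp M p F" shows "\<bar>LINT x|M. F x\<bar> \<le> norm_Lp M p F"
  by (rule power_le_imp_le_base[of _ "p - 1"])
     (use assms in \<open>auto simp: power_even_abs norm_Lp_power expectation_power_le\<close>)

lemma (in prob_space) in_Lp_const: "in_Lp M p (\<lambda>x. c)"
  by (simp add: in_Lp_def)

lemma (in prob_space) norm_Lp_const: "even p \<Longrightarrow> 0 < p \<Longrightarrow> norm_Lp M p (\<lambda>x. c) = \<bar>c\<bar>"
  by (simp add: norm_Lp_def prob_space real_root_power_even)

lemma (in prob_space) in_Lp_2:
  assumes "in_Lp M 4 F" shows "in_Lp M 2 F"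
  using norm_Lp_2_mult(1)[OF assms in_Lp_const[of 4 1]] by simp

lemma (in prob_space) norm_Lp_2_le:
  assumes "in_Lp M 4 F" shows "norm_Lp M 2 F \<le> norm_Lp M 4 F"
  using norm_Lp_2_mult(2)[OF assms in_Lp_const[of 4 1]] by (simp add: norm_Lp_const)

lemma (in prob_space) in_Lp_bounded:
  assumes "F \<in> borel_measurable M" "\<And>x. \<bar>F x\<bar> \<le> B"
  shows "in_Lp M p F"
  unfolding in_Lp_def
proof
  show "integrable M (\<lambda>x. F x ^ p)"
    by (rule integrable_const_bound[of _ "B ^ p"])
       (use assms in \<open>auto simp: power_abs intro!: power_mono\<close>)
qed (use assms in auto)

text \<open>Jensen's inequality on each section, then Fubini: averaging out an independent factor is
  a contraction. Sections are integrable only almost everywhere, which the third conclusion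
  records.\<close>

lemma integral_fst_Lp:
  assumes "prob_space A" "prob_space B" and p: "even p" "0 < p" and F: "in_Lp (A \<Otimes>\<^sub>M B) p F"
  shows "in_Lp A p (\<lambda>x. LINT y|B. F (x, y))"
    and "norm_Lp A p (\<lambda>x. LINT y|B. F (x, y)) \<le> norm_Lp (A \<Otimes>\<^sub>M B) p F"
    and "AE x in A. integrable B (\<lambda>y. F (x, y))"
proof -
  interpret A: prob_space A by fact
  interpret B: prob_space B by fact
  interpret AB: pair_prob_space A B ..
  note [measurable] = in_LpD[OF F]
  have iF: "integrable (A \<Otimes>\<^sub>M B) (\<lambda>z. F z ^ p)" using F by (simp add: in_Lp_def)
  have "AE x in A. integrable B (\<lambda>y. F (x, y) ^ p)" using AB.AE_integrable_fst'[OF iF] by simp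
  then have ae: "AE x in A. in_Lp B p (\<lambda>y. F (x, y))"
    unfolding in_Lp_def using AE_space by eventually_elim auto
  show "AE x in A. integrable B (\<lambda>y. F (x, y))" using ae by eventually_elim (rule B.integrable_Lp[OF p])
  have le: "AE x in A. (LINT y|B. F (x, y)) ^ p \<le> (LINT y|B. F (x, y) ^ p)"
    using ae by eventually_elim (rule B.expectation_power_le[OF p])
  have i2: "integrable A (\<lambda>x. LINT y|B. F (x, y) ^ p)" using AB.integrable_fst'[OF iF] by simp
  show in1: "in_Lp A p (\<lambda>x. LINT y|B. F (x, y))"
    unfolding in_Lp_def
  proof
    show "integrable A (\<lambda>x. (LINT y|B. F (x, y)) ^ p)"
      by (rule Bochner_Integration.integrable_bound[OF i2])
         (use le p in \<open>auto simp: zero_le_even_power intro: order.trans[OF _ abs_ge_self] elim!: eventually_mono\<close>)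
  qed measurable
  have "(LINT x|A. (LINT y|B. F (x, y)) ^ p) \<le> (LINT x|A. LINT y|B. F (x, y) ^ p)"
    by (rule integral_mono_AE[OF in_Lp_integrable[OF in1] i2 le])
  also have "\<dots> = (LINT z|(A \<Otimes>\<^sub>M B). F z ^ p)" using AB.integral_fst'[OF iF] by simp
  finally show "norm_Lp A p (\<lambda>x. LINT y|B. F (x, y)) \<le> norm_Lp (A \<Otimes>\<^sub>M B) p F"
    using p by (intro norm_Lp_leI) (auto simp: norm_Lp_power)
qed

section \<open>Resampling coordinates of a product space\<close>

definition mrg :: "'i set \<Rightarrow> ('i \<Rightarrow> 's) \<Rightarrow> ('i \<Rightarrow> 's) \<Rightarrow> ('i \<Rightarrow> 's)" where
  "mrg A y x = (\<lambda>i. if i \<in> A then y i else x i)"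

text \<open>A pointwise condition in place of measurability with respect to a sub-sigma-algebra:
  resampling outside \<open>J\<close> then changes \<open>F\<close> nowhere, without exceptional
  null sets.\<close>

definition dep_on :: "'i set \<Rightarrow> (('i \<Rightarrow> 's) \<Rightarrow> 'b) \<Rightarrow> bool" where
  "dep_on J F \<longleftrightarrow> (\<forall>x y. (\<forall>i\<in>J. x i = y i) \<longrightarrow> F x = F y)"

lemma dep_onD: "dep_on J F \<Longrightarrow> (\<And>i. i \<in> J \<Longrightarrow> x i = y i) \<Longrightarrow> F x = F y"
  by (auto simp: dep_on_def)

lemma dep_on_mono: "dep_on J F \<Longrightarrow> J \<subseteq> K \<Longrightarrow> dep_on K F"
  unfolding dep_on_def by blast

lemma dep_on_comp: "dep_on J F \<Longrightarrow> dep_on J (\<lambda>x. h (F x))"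
  unfolding dep_on_def by metis

lemma dep_on_comp2: "dep_on J F \<Longrightarrow> dep_on J G \<Longrightarrow> dep_on J (\<lambda>x. h (F x) (G x))"
  unfolding dep_on_def by metis

lemma dep_on_sum: "(\<And>i. i \<in> I \<Longrightarrow> dep_on J (F i)) \<Longrightarrow> dep_on J (\<lambda>x. \<Sum>i\<in>I. F i x)"
  unfolding dep_on_def by (auto intro!: sum.cong)

lemma dep_on_const: "dep_on J (\<lambda>x. c)"
  by (simp add: dep_on_def)

lemma dep_on_mrg_outside: "dep_on J F \<Longrightarrow> J \<inter> A = {} \<Longrightarrow> F (mrg A y x) = F x"
  by (rule dep_onD) (auto simp: mrg_def)

lemma dep_on_mrg_inside: "dep_on J F \<Longrightarrow> J \<subseteq> A \<Longrightarrow> F (mrg A y x) = F y"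
  by (rule dep_onD) (auto simp: mrg_def)

lemma mrg_mrg_commute: "A \<inter> B = {} \<Longrightarrow> mrg A z (mrg B y x) = mrg B y (mrg A z x)"
  by (auto simp: mrg_def fun_eq_iff)

section \<open>The canonical space of the innovations\<close>

locale iid_space = prob_space \<mu> for \<mu> :: "'s measure"
begin

definition P :: "(int \<Rightarrow> 's) measure" where
  "P = PiM UNIV (\<lambda>_. \<mu>)"

sublocale prod: product_prob_space "\<lambda>_::int. \<mu>" UNIV
  by unfold_locales

sublocale P: prob_space P
  unfolding P_def by (rule prod.prob_space_axioms)

sublocale PP: pair_prob_space P P
  by unfold_locales

lemma measurable_P_component [measurable]: "(\<lambda>x. x i) \<in> measurable P \<mu>"
  unfolding P_def by simp

lemma measurable_mrg: "(\<lambda>z. mrg A (snd z) (fst z)) \<in> measurable (P \<Otimes>\<^sub>M P) P"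
proof -
  have "(\<lambda>z i. mrg A (snd z) (fst z) i) \<in> measurable (P \<Otimes>\<^sub>M P) (PiM UNIV (\<lambda>_. \<mu>))"
  proof (rule measurable_PiM_single')
    fix i :: int
    show "(\<lambda>z. mrg A (snd z) (fst z) i) \<in> measurable (P \<Otimes>\<^sub>M P) \<mu>"
      by (cases "i \<in> A") (simp_all add: mrg_def)
  qed (auto simp: P_def space_pair_measure space_PiM mrg_def PiE_iff)
  then show ?thesis by (simp add: P_def)
qed

lemma measurable_mrg_app [measurable (raw)]:
  assumes "f \<in> measurable N P" "g \<in> measurable N P"
  shows "(\<lambda>w. mrg A (f w) (g w)) \<in> measurable N P"
  using measurable_compose[OF measurable_Pair[OF assms(2,1)] measurable_mrg] by simp

text \<open>Compared on finite cylinders: the constraints outside \<open>A\<close> fall on the first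
  factor and those inside \<open>A\<close> on the second, so the probability is the same product.
  All resampling arguments rest on this invariance.\<close>

lemma distr_mrg: "distr (P \<Otimes>\<^sub>M P) P (\<lambda>z. mrg A (snd z) (fst z)) = P"
proof -
  have "P = distr (P \<Otimes>\<^sub>M P) P (\<lambda>z. mrg A (snd z) (fst z))"
    unfolding P_def
  proof (rule measure_eqI_PiM_infinite)
    show "finite_measure (PiM (UNIV::int set) (\<lambda>_. \<mu>))" by unfold_locales
  next
    fix E and J :: "int set" assume J: "finite J" and E: "\<And>i. i \<in> J \<Longrightarrow> E i \<in> sets \<mu>"
    let ?X = "\<lambda>K. prod_emb UNIV (\<lambda>_::int. \<mu>) K (Pi\<^sub>E K E)"
    have X: "emeasure P (?X K) = (\<Prod>i\<in>K. emeasure \<mu> (E i))" "?X K \<in> sets P" if "K \<subseteq> J" for K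
      using that J E finite_subset[OF that J] unfolding P_def
      by (auto intro!: prod.emeasure_PiM_emb sets_PiM_I)
    have eq: "(\<lambda>z. mrg A (snd z) (fst z)) -` ?X J \<inter> space (P \<Otimes>\<^sub>M P) = ?X (J - A) \<times> ?X (J \<inter> A)"
      by (auto simp: prod_emb_def P_def space_pair_measure space_PiM PiE_iff mrg_def split: if_splits)
    have "emeasure (distr (P \<Otimes>\<^sub>M P) P (\<lambda>z. mrg A (snd z) (fst z))) (?X J)
        = emeasure (P \<Otimes>\<^sub>M P) (?X (J - A) \<times> ?X (J \<inter> A))"
      using X(2)[of J] by (subst emeasure_distr) (auto simp: eq)
    also have "\<dots> = emeasure P (?X (J - A)) * emeasure P (?X (J \<inter> A))"
      using X(2) by (intro P.emeasure_pair_measure_Times) auto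
    also have "\<dots> = (\<Prod>i\<in>J. emeasure \<mu> (E i))"
      using J by (simp add: X(1) prod.subset_diff[of "J \<inter> A" J "\<lambda>i. emeasure \<mu> (E i)"] Diff_Int)
    also have "\<dots> = emeasure P (?X J)" by (simp add: X(1))
    finally show "emeasure (PiM UNIV (\<lambda>_. \<mu>)) (?X J) =
      emeasure (distr (PiM UNIV (\<lambda>_. \<mu>) \<Otimes>\<^sub>M PiM UNIV (\<lambda>_. \<mu>)) (PiM UNIV (\<lambda>_. \<mu>)) (\<lambda>z. mrg A (snd z) (fst z))) (?X J)"
      by (simp add: P_def)
  qed auto
  then show ?thesis by simp
qed

text \<open>Serves \<open>influence_cnd_le\<close>, where three copies occur: the base point, the
  copy that resamples \<open>k\<close>, and the copy that is averaged over \<open>A\<close>. Merging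
  the third into the first leaves it independent of the second.\<close>

lemma distr_mrg_pair:
  "distr ((P \<Otimes>\<^sub>M P) \<Otimes>\<^sub>M P) (P \<Otimes>\<^sub>M P) (\<lambda>w. (mrg A (snd w) (fst (fst w)), snd (fst w))) = P \<Otimes>\<^sub>M P"
proof -
  let ?h = "\<lambda>w. (mrg A (snd w) (fst (fst w)), snd (fst w))"
  have m [measurable]: "?h \<in> measurable ((P \<Otimes>\<^sub>M P) \<Otimes>\<^sub>M P) (P \<Otimes>\<^sub>M P)" by measurable
  interpret PPP: pair_prob_space "P \<Otimes>\<^sub>M P" P ..
  have "P \<Otimes>\<^sub>M P = distr ((P \<Otimes>\<^sub>M P) \<Otimes>\<^sub>M P) (P \<Otimes>\<^sub>M P) ?h"
  proof (rule pair_measure_eqI)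
    fix C D assume [measurable]: "C \<in> sets P" "D \<in> sets P"
    have "emeasure (distr ((P \<Otimes>\<^sub>M P) \<Otimes>\<^sub>M P) (P \<Otimes>\<^sub>M P) ?h) (C \<times> D)
       = (\<integral>\<^sup>+ w. indicator (C \<times> D) w \<partial>distr ((P \<Otimes>\<^sub>M P) \<Otimes>\<^sub>M P) (P \<Otimes>\<^sub>M P) ?h)"
      by simp
    also have "\<dots> = (\<integral>\<^sup>+ w. indicator C (mrg A (snd w) (fst (fst w))) * indicator D (snd (fst w)) \<partial>((P \<Otimes>\<^sub>M P) \<Otimes>\<^sub>M P))"
      by (subst nn_integral_distr) (auto simp: indicator_def intro!: nn_integral_cong)
    also have "\<dots> = (\<integral>\<^sup>+ v. \<integral>\<^sup>+ z. indicator C (mrg A z (fst v)) * indicator D (snd v) \<partial>P \<partial>(P \<Otimes>\<^sub>M P))"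
      by (subst P.nn_integral_fst[symmetric]) auto
    also have "\<dots> = (\<integral>\<^sup>+ x. \<integral>\<^sup>+ y. \<integral>\<^sup>+ z. indicator C (mrg A z x) * indicator D y \<partial>P \<partial>P \<partial>P)"
      by (subst P.nn_integral_fst[symmetric]) auto
    also have "\<dots> = (\<integral>\<^sup>+ x. \<integral>\<^sup>+ y. (\<integral>\<^sup>+ z. indicator C (mrg A z x) \<partial>P) * indicator D y \<partial>P \<partial>P)"
      by (intro nn_integral_cong nn_integral_multc) measurable
    also have "\<dots> = (\<integral>\<^sup>+ x. (\<integral>\<^sup>+ z. indicator C (mrg A z x) \<partial>P) * emeasure P D \<partial>P)"
      by (intro nn_integral_cong) (simp add: nn_integral_cmult)
    also have "\<dots> = (\<integral>\<^sup>+ x. \<integral>\<^sup>+ z. indicator C (mrg A z x) \<partial>P \<partial>P) * emeasure P D"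
      by (intro nn_integral_multc) measurable
    also have "(\<integral>\<^sup>+ x. \<integral>\<^sup>+ z. indicator C (mrg A z x) \<partial>P \<partial>P) = (\<integral>\<^sup>+ w. indicator C (mrg A (snd w) (fst w)) \<partial>(P \<Otimes>\<^sub>M P))"
      by (subst P.nn_integral_fst[symmetric]) auto
    also have "\<dots> = (\<integral>\<^sup>+ x. indicator C x \<partial>distr (P \<Otimes>\<^sub>M P) P (\<lambda>z. mrg A (snd z) (fst z)))"
      by (subst nn_integral_distr) auto
    also have "\<dots> = emeasure P C" by (simp add: distr_mrg)
    finally show "emeasure P C * emeasure P D = emeasure (distr ((P \<Otimes>\<^sub>M P) \<Otimes>\<^sub>M P) (P \<Otimes>\<^sub>M P) ?h) (C \<times> D)"
      by simp
  qed (auto intro: P.sigma_finite_measure_axioms)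
  then show ?thesis by simp
qed

lemma distr_fst_P: "distr (P \<Otimes>\<^sub>M P) P fst = P"
  using distr_mrg[of "{}"] by (simp add: mrg_def)

lemma Lp_mrg:
  assumes "in_Lp P p F"
  shows "in_Lp (P \<Otimes>\<^sub>M P) p (\<lambda>z. F (mrg A (snd z) (fst z)))"
    and "norm_Lp (P \<Otimes>\<^sub>M P) p (\<lambda>z. F (mrg A (snd z) (fst z))) = norm_Lp P p F"
  using assms in_Lp_distr[OF measurable_mrg[of A] in_LpD[OF assms], of p]
    norm_Lp_distr[OF measurable_mrg[of A] in_LpD[OF assms], of p] by (simp_all add: distr_mrg)

lemma Lp_fst:
  assumes "in_Lp P p F"
  shows "in_Lp (P \<Otimes>\<^sub>M P) p (\<lambda>z. F (fst z))" "norm_Lp (P \<Otimes>\<^sub>M P) p (\<lambda>z. F (fst z)) = norm_Lp P p F"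
  using Lp_mrg[OF assms, of "{}"] by (simp_all add: mrg_def)

lemma integral_mrg:
  fixes F :: "(int \<Rightarrow> 's) \<Rightarrow> 'b :: {banach, second_countable_topology}"
  assumes "F \<in> borel_measurable P"
  shows "(LINT x|P. F x) = (LINT z|(P \<Otimes>\<^sub>M P). F (mrg A (snd z) (fst z)))"
  using integral_distr[OF measurable_mrg[of A] assms] by (simp add: distr_mrg)

lemma integrable_mrg:
  fixes F :: "(int \<Rightarrow> 's) \<Rightarrow> 'b :: {banach, second_countable_topology}"
  assumes "F \<in> borel_measurable P"
  shows "integrable P F \<longleftrightarrow> integrable (P \<Otimes>\<^sub>M P) (\<lambda>z. F (mrg A (snd z) (fst z)))"
  using integrable_distr_eq[OF measurable_mrg[of A] assms] by (simp add: distr_mrg)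

text \<open>\<open>cnd A F\<close> is a version of the conditional expectation of \<open>F\<close> given the coordinates outside \<open>A\<close>,
  and \<open>influence p F k\<close> is the coupling distance \<open>\<parallel>F - F'\<parallel>\<^sub>p\<close>,
  where \<open>F'\<close> is \<open>F\<close> with coordinate \<open>k\<close> resampled.\<close>

definition cnd :: "int set \<Rightarrow> ((int \<Rightarrow> 's) \<Rightarrow> real) \<Rightarrow> (int \<Rightarrow> 's) \<Rightarrow> real" where
  "cnd A F x = (LINT y|P. F (mrg A y x))"

definition influence :: "nat \<Rightarrow> ((int \<Rightarrow> 's) \<Rightarrow> real) \<Rightarrow> int \<Rightarrow> real" where
  "influence p F k = norm_Lp (P \<Otimes>\<^sub>M P) p (\<lambda>z. F (fst z) - F (mrg {k} (snd z) (fst z)))"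

lemma cnd_measurable [measurable]:
  assumes [measurable]: "F \<in> borel_measurable P" shows "cnd A F \<in> borel_measurable P"
  unfolding cnd_def by measurable

lemma Lp_cnd:
  assumes p: "even p" "0 < p" and F: "in_Lp P p F"
  shows "in_Lp P p (cnd A F)" "norm_Lp P p (cnd A F) \<le> norm_Lp P p F"
    "AE x in P. integrable P (\<lambda>y. F (mrg A y x))"
  using integral_fst_Lp[OF P.prob_space_axioms P.prob_space_axioms p Lp_mrg(1)[OF F, of A]] Lp_mrg(2)[OF F, of A]
  by (auto simp: cnd_def[abs_def])

lemma integral_cnd:
  assumes "integrable P F" shows "(LINT x|P. cnd A F x) = (LINT x|P. F x)"
proof -
  have [measurable]: "F \<in> borel_measurable P" using assms by auto
  have "integrable (P \<Otimes>\<^sub>M P) (\<lambda>z. F (mrg A (snd z) (fst z)))" using assms integrable_mrg[of F A] by simp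
  from PP.integral_fst'[OF this] show ?thesis by (simp add: cnd_def integral_mrg[of F A])
qed

lemma cnd_diff:
  assumes p: "even p" "0 < p" and F: "in_Lp P p F" and G: "in_Lp P p G"
  shows "AE x in P. cnd A (\<lambda>x. F x - G x) x = cnd A F x - cnd A G x"
  using Lp_cnd(3)[OF p F, of A] Lp_cnd(3)[OF p G, of A]
  by eventually_elim (simp add: cnd_def)

lemma dep_on_cnd:
  assumes "dep_on J F" shows "dep_on (J - A) (cnd A F)"
  unfolding dep_on_def cnd_def
  by (auto intro!: Bochner_Integration.integral_cong dep_onD[OF assms] simp: mrg_def)

lemma cnd_dep_on_outside: "dep_on J F \<Longrightarrow> J \<inter> A = {} \<Longrightarrow> cnd A F x = F x"
  unfolding cnd_def by (simp add: dep_on_mrg_outside P.prob_space)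

lemma dep_on_UNIV: "dep_on UNIV F"
  unfolding dep_on_def by (auto simp: fun_eq_iff[symmetric])

lemma in_Lp_resample:
  assumes "even p" "in_Lp P p F"
  shows "in_Lp (P \<Otimes>\<^sub>M P) p (\<lambda>z. F (fst z) - F (mrg {k} (snd z) (fst z)))"
  using assms by (intro in_Lp_diff Lp_mrg Lp_fst)

lemma influence_nonneg [simp]: "even p \<Longrightarrow> 0 \<le> influence p F k"
  by (simp add: influence_def)

lemma influence_le_norm:
  assumes p: "even p" "0 < p" and F: "in_Lp P p F"
  shows "influence p F k \<le> 2 * norm_Lp P p F"
  using norm_Lp_triangle_diff[OF p Lp_fst(1)[OF F] Lp_mrg(1)[OF F, of "{k}"]]
  by (simp add: influence_def Lp_fst(2)[OF F] Lp_mrg(2)[OF F])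

lemma influence_dep_on:
  assumes "0 < p" "dep_on J F" "k \<notin> J" shows "influence p F k = 0"
  using assms by (simp add: influence_def dep_on_mrg_outside)

lemma influence_cmult:
  assumes "even p" "0 < p" shows "influence p (\<lambda>x. c * F x) k = \<bar>c\<bar> * influence p F k"
  unfolding influence_def using norm_Lp_cmult[OF assms, of _ c]
  by (simp add: right_diff_distrib[symmetric])

lemma influence_sum:
  assumes p: "even p" "0 < p" and F: "\<And>i. i \<in> I \<Longrightarrow> in_Lp P p (F i)"
  shows "influence p (\<lambda>x. \<Sum>i\<in>I. F i x) k \<le> (\<Sum>i\<in>I. influence p (F i) k)"
  unfolding influence_def sum_subtractf[symmetric]
  by (intro norm_Lp_sum p in_Lp_resample F)

lemma influence_diff:
  assumes p: "even p" "0 < p" and F: "in_Lp P p F" and G: "in_Lp P p G"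
  shows "influence p (\<lambda>x. F x - G x) k \<le> influence p F k + influence p G k"
  using norm_Lp_triangle_diff[OF p in_Lp_resample[OF p(1) F] in_Lp_resample[OF p(1) G], of k k]
  unfolding influence_def by (simp add: algebra_simps)

lemma influence_lipschitz:
  assumes p: "even p" "0 < p" and F: "in_Lp P p F" and [measurable]: "h \<in> borel_measurable borel"
    and h: "\<And>u v. \<bar>h u - h v\<bar> \<le> \<bar>u - v\<bar>"
  shows "influence p (\<lambda>x. h (F x)) k \<le> influence p F k"
  unfolding influence_def
  using in_LpD[OF F] by (intro norm_Lp_mono p in_Lp_resample F) (auto intro: h)

text \<open>For \<open>k\<close> outside \<open>A\<close>, averaging over \<open>A\<close> commutes
  with resampling \<open>k\<close>; the difference is thus an average over a third copy of something
  distributed like \<open>F - F'\<close>, and averaging contracts the norm. For \<open>k\<close> in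
  \<open>A\<close> the averaged function does not see coordinate \<open>k\<close>.\<close>

lemma influence_cnd_le:
  assumes p: "even p" "0 < p" and F: "in_Lp P p F"
  shows "influence p (cnd A F) k \<le> influence p F k"
proof (cases "k \<in> A")
  case True
  then have "influence p (cnd A F) k = 0"
    using influence_dep_on[OF p(2) dep_on_cnd[OF dep_on_UNIV, of A F], of k] by simp
  then show ?thesis using p by simp
next
  case False
  note [measurable] = in_LpD[OF F]
  let ?H = "\<lambda>z. F (fst z) - F (mrg {k} (snd z) (fst z))"
  let ?h = "\<lambda>w. (mrg A (snd w) (fst (fst w)), snd (fst w))"
  let ?G = "\<lambda>w. F (mrg A (snd w) (fst (fst w))) - F (mrg A (snd w) (mrg {k} (snd (fst w)) (fst (fst w))))"
  have H: "in_Lp (P \<Otimes>\<^sub>M P) p ?H" by (rule in_Lp_resample[OF p(1) F])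
  have G_eq: "?G w = ?H (?h w)" for w
    using False by (simp add: mrg_mrg_commute[of A "{k}"])
  have m: "?h \<in> measurable ((P \<Otimes>\<^sub>M P) \<Otimes>\<^sub>M P) (P \<Otimes>\<^sub>M P)" by measurable
  have G: "in_Lp ((P \<Otimes>\<^sub>M P) \<Otimes>\<^sub>M P) p ?G"
    unfolding G_eq using in_Lp_distr[OF m in_LpD[OF H], of p] H by (simp add: distr_mrg_pair)
  have G_norm: "norm_Lp ((P \<Otimes>\<^sub>M P) \<Otimes>\<^sub>M P) p ?G = influence p F k"
    unfolding G_eq influence_def using norm_Lp_distr[OF m in_LpD[OF H], of p] by (simp add: distr_mrg_pair)
  \<comment> \<open>The null set on which a section fails to be integrable has to be pulled back
    twice, to the original and to the resampled point; both maps carry the product measure to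
    \<open>P\<close>.\<close>
  have 1: "AE z in P \<Otimes>\<^sub>M P. integrable P (\<lambda>y. F (mrg A y (fst z)))"
    using Lp_cnd(3)[OF p F, of A] by (subst (asm) distr_fst_P[symmetric]) (auto dest!: AE_distrD[rotated])
  have 2: "AE z in P \<Otimes>\<^sub>M P. integrable P (\<lambda>y. F (mrg A y (mrg {k} (snd z) (fst z))))"
    using Lp_cnd(3)[OF p F, of A] by (subst (asm) distr_mrg[of "{k}", symmetric]) (auto dest!: AE_distrD[OF measurable_mrg])
  have "influence p (cnd A F) k = norm_Lp (P \<Otimes>\<^sub>M P) p (\<lambda>z. LINT y|P. ?G (z, y))"
    unfolding influence_def
  proof (rule norm_Lp_cong_AE)
    show "AE z in P \<Otimes>\<^sub>M P. cnd A F (fst z) - cnd A F (mrg {k} (snd z) (fst z)) = (LINT y|P. ?G (z, y))"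
      using 1 2 by eventually_elim (simp add: cnd_def)
  qed measurable
  also have "\<dots> \<le> influence p F k"
    using integral_fst_Lp(2)[OF PP.prob_space_axioms P.prob_space_axioms p G] G_norm by simp
  finally show ?thesis .
qed

text \<open>\<open>F - cnd {k} F\<close> is the average of \<open>F - F'\<close> over the resampled
  coordinate, so the contraction \<open>integral_fst_Lp\<close> applies.\<close>

lemma norm_diff_cnd_single:
  assumes p: "even p" "0 < p" and F: "in_Lp P p F"
  shows "norm_Lp P p (\<lambda>x. F x - cnd {k} F x) \<le> influence p F k"
proof -
  note [measurable] = in_LpD[OF F]
  let ?H = "\<lambda>z. F (fst z) - F (mrg {k} (snd z) (fst z))"
  have "norm_Lp P p (\<lambda>x. F x - cnd {k} F x) = norm_Lp P p (\<lambda>x. LINT y|P. ?H (x, y))"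
  proof (rule norm_Lp_cong_AE)
    show "AE x in P. F x - cnd {k} F x = (LINT y|P. ?H (x, y))"
      using Lp_cnd(3)[OF p F, of "{k}"] by eventually_elim (simp add: cnd_def P.prob_space)
  qed measurable
  also have "\<dots> \<le> influence p F k"
    using integral_fst_Lp(2)[OF P.prob_space_axioms P.prob_space_axioms p in_Lp_resample[OF p(1) F, of k]]
    by (simp add: influence_def)
  finally show ?thesis .
qed

text \<open>After merging two independent points along \<open>A\<close>, \<open>F\<close> depends on
  one of them and \<open>G\<close> on the other, and Fubini separates them. \<open>G\<close> is
  vector-valued because in Stein's method it contains a complex exponential.\<close>

lemma integral_indep_scaleR:
  fixes G :: "(int \<Rightarrow> 's) \<Rightarrow> 'b :: {banach, second_countable_topology}"
  assumes F: "integrable P F" "dep_on A F" and G: "integrable P G" "dep_on (- A) G"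
  shows "integrable P (\<lambda>x. F x *\<^sub>R G x)"
    and "(LINT x|P. F x *\<^sub>R G x) = (LINT x|P. F x) *\<^sub>R (LINT x|P. G x)"
proof -
  note [measurable] = borel_measurable_integrable[OF F(1)] borel_measurable_integrable[OF G(1)]
  have eq: "F (mrg A (snd z) (fst z)) *\<^sub>R G (mrg A (snd z) (fst z)) = F (snd z) *\<^sub>R G (fst z)" for z
    using F(2) G(2) by (simp add: dep_on_mrg_inside dep_on_mrg_outside)
  have i: "integrable (P \<Otimes>\<^sub>M P) (\<lambda>z. F (snd z) *\<^sub>R G (fst z))"
    by (rule PP.Fubini_integrable) (use F(1) G(1) in auto)
  show "integrable P (\<lambda>x. F x *\<^sub>R G x)"
    using i by (subst integrable_mrg[of _ A]) (auto simp: eq)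
  have "(LINT x|P. F x *\<^sub>R G x) = (LINT z|(P \<Otimes>\<^sub>M P). F (snd z) *\<^sub>R G (fst z))"
    by (subst integral_mrg[of _ A]) (auto simp: eq)
  also have "\<dots> = (LINT x|P. LINT y|P. F y *\<^sub>R G x)"
    using PP.integral_fst'[OF i] by simp
  finally show "(LINT x|P. F x *\<^sub>R G x) = (LINT x|P. F x) *\<^sub>R (LINT x|P. G x)"
    using F(1) by simp
qed

end

section \<open>Moment inequalities of Efron--Stein type\<close>

text \<open>For \<open>p = 2\<close> this is Pythagoras. For \<open>p = 4\<close> the orthogonality
  kills the term with \<open>S ^ 3 * D\<close>, and the remaining mixed term is bounded by
  Cauchy-Schwarz. Squares of norms then add up along martingale differences, with the same constant
  for both exponents.\<close>

lemma norm_Lp_martingale_step: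
  assumes p: "p = 2 \<or> p = 4" and S: "in_Lp M p S" and D: "in_Lp M p D"
    and orth: "(LINT x|M. S x ^ (p - 1) * D x) = 0"
  shows "(norm_Lp M p (\<lambda>x. S x + D x))\<^sup>2 \<le> (norm_Lp M p S)\<^sup>2 + 4 * (norm_Lp M p D)\<^sup>2"
proof -
  note [measurable] = in_LpD[OF S] in_LpD[OF D]
  let ?s = "norm_Lp M p S" and ?d = "norm_Lp M p D"
  have ep: "even p" "0 < p" using p by auto
  have iS: "integrable M (\<lambda>x. S x ^ p)" and iD: "integrable M (\<lambda>x. D x ^ p)"
    using S D by (auto simp: in_Lp_def)
  have iSD: "integrable M (\<lambda>x. (S x + D x) ^ p)"
    using in_Lp_add[OF ep(1) S D] by (simp add: in_Lp_def)
  from p show ?thesis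
  proof
    assume p2: "p = 2"
    have iX: "integrable M (\<lambda>x. S x * D x)"
    proof (rule Bochner_Integration.integrable_bound)
      show "integrable M (\<lambda>x. (S x)\<^sup>2 + (D x)\<^sup>2)" using iS iD p2 by simp
      show "AE x in M. norm (S x * D x) \<le> norm ((S x)\<^sup>2 + (D x)\<^sup>2)"
      proof (rule AE_I2)
        fix x
        have "2 * (\<bar>S x\<bar> * \<bar>D x\<bar>) \<le> (S x)\<^sup>2 + (D x)\<^sup>2"
          using sum_squares_bound[of "\<bar>S x\<bar>" "\<bar>D x\<bar>"] by (simp add: mult.assoc)
        then have "\<bar>S x\<bar> * \<bar>D x\<bar> \<le> (S x)\<^sup>2 + (D x)\<^sup>2"
          using mult_nonneg_nonneg[of "\<bar>S x\<bar>" "\<bar>D x\<bar>"] by linarith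
        then show "norm (S x * D x) \<le> norm ((S x)\<^sup>2 + (D x)\<^sup>2)" by (simp add: abs_mult)
      qed
    qed measurable
    have "(norm_Lp M p (\<lambda>x. S x + D x))\<^sup>2 = (LINT x|M. (S x + D x) ^ 2)"
      using norm_Lp_power[OF ep, of M "\<lambda>x. S x + D x"] p2 by simp
    also have "\<dots> = (LINT x|M. (S x)\<^sup>2 + (D x)\<^sup>2 + 2 * (S x * D x))"
      by (simp add: power2_sum mult.assoc)
    also have "\<dots> = (LINT x|M. (S x)\<^sup>2) + (LINT x|M. (D x)\<^sup>2)"
      using iS iD iX orth p2 by simp
    also have "\<dots> = ?s\<^sup>2 + ?d\<^sup>2"
      using norm_Lp_power[OF ep, of M S] norm_Lp_power[OF ep, of M D] p2 by simp
    finally show ?thesis by simp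
  next
    assume p4: "p = 4"
    have SDS: "in_Lp M 2 (\<lambda>x. S x * D x)" "norm_Lp M 2 (\<lambda>x. S x * D x) \<le> ?s * ?d"
      using norm_Lp_2_mult[of M S D] S D p4 by auto
    have iQ: "integrable M (\<lambda>x. (S x * D x)\<^sup>2)" using SDS(1) by (simp add: in_Lp_def)
    have Q: "(LINT x|M. (S x * D x)\<^sup>2) \<le> (?s * ?d)\<^sup>2" using SDS(2) by (intro norm_Lp_leD) auto
    have iX: "integrable M (\<lambda>x. S x ^ 3 * D x)"
    proof (rule Bochner_Integration.integrable_bound)
      show "integrable M (\<lambda>x. S x ^ 4 + (S x * D x)\<^sup>2)" using iS iQ p4 by simp
      show "AE x in M. norm (S x ^ 3 * D x) \<le> norm (S x ^ 4 + (S x * D x)\<^sup>2)"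
      proof (rule AE_I2)
        fix x
        have "2 * ((S x)\<^sup>2 * \<bar>S x * D x\<bar>) \<le> ((S x)\<^sup>2)\<^sup>2 + \<bar>S x * D x\<bar>\<^sup>2"
          using sum_squares_bound[of "(S x)\<^sup>2" "\<bar>S x * D x\<bar>"] by (simp add: mult.assoc)
        also have "((S x)\<^sup>2)\<^sup>2 + \<bar>S x * D x\<bar>\<^sup>2 = S x ^ 4 + (S x * D x)\<^sup>2" by simp
        finally have "(S x)\<^sup>2 * \<bar>S x * D x\<bar> \<le> S x ^ 4 + (S x * D x)\<^sup>2"
          using mult_nonneg_nonneg[OF zero_le_power2 abs_ge_zero, of "S x" "S x * D x"] by linarith
        then show "norm (S x ^ 3 * D x) \<le> norm (S x ^ 4 + (S x * D x)\<^sup>2)"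
          by (simp add: abs_mult power_abs power3_eq_cube power2_eq_square mult.assoc)
      qed
    qed measurable
    \<comment> \<open>The term \<open>4 * S * D ^ 3\<close> of the binomial expansion is absorbed by
      adding the square \<open>2 * (D * (S - D))\<^sup>2\<close>; this raises the coefficient 6 to 8
      and 1 to 3.\<close>
    have le: "(S x + D x) ^ 4 \<le> S x ^ 4 + 3 * D x ^ 4 + 8 * (S x * D x)\<^sup>2 + 4 * (S x ^ 3 * D x)" for x
    proof -
      have "S x ^ 4 + 3 * D x ^ 4 + 8 * (S x * D x)\<^sup>2 + 4 * (S x ^ 3 * D x) - (S x + D x) ^ 4
          = 2 * (D x * (S x - D x))\<^sup>2"
        by (simp add: power2_eq_square power4_eq_xxxx power3_eq_cube algebra_simps)
      moreover have "0 \<le> 2 * (D x * (S x - D x))\<^sup>2" by simp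
      ultimately show ?thesis by linarith
    qed
    have "((norm_Lp M p (\<lambda>x. S x + D x))\<^sup>2)\<^sup>2 = (LINT x|M. (S x + D x) ^ 4)"
      using norm_Lp_power[OF ep, of M "\<lambda>x. S x + D x"] p4 by simp
    also have "\<dots> \<le> (LINT x|M. S x ^ 4 + 3 * D x ^ 4 + 8 * (S x * D x)\<^sup>2 + 4 * (S x ^ 3 * D x))"
      using iSD iS iD iQ iX p4 by (intro integral_mono le) auto
    also have "\<dots> = (LINT x|M. S x ^ 4) + 3 * (LINT x|M. D x ^ 4) + 8 * (LINT x|M. (S x * D x)\<^sup>2)"
      using iS iD iQ iX orth p4 by simp
    also have "\<dots> \<le> ?s ^ 4 + 3 * ?d ^ 4 + 8 * (?s * ?d)\<^sup>2"
      using Q norm_Lp_power[OF ep, of M S] norm_Lp_power[OF ep, of M D] p4 by simp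
    \<comment> \<open>The extra \<open>13 * ?d ^ 4\<close> completes the square; the constant 4 is
      half of the mixed coefficient 8.\<close>
    also have "\<dots> \<le> ?s ^ 4 + 3 * ?d ^ 4 + 8 * (?s * ?d)\<^sup>2 + 13 * ?d ^ 4" by simp
    also have "\<dots> = (?s\<^sup>2 + 4 * ?d\<^sup>2)\<^sup>2"
      by (simp add: power2_eq_square power4_eq_xxxx algebra_simps)
    finally show ?thesis by (rule power2_le_imp_le) simp
  qed
qed

lemma prod_algebra_cylinder:
  assumes "X \<in> prod_algebra I M"
  shows "\<exists>J E. X = prod_emb I M J (Pi\<^sub>E J E) \<and> finite J \<and> J \<subseteq> I \<and> (\<forall>j\<in>J. E j \<in> sets (M j))"
proof (rule prod_algebraE[OF assms])
  fix J E assume "X = prod_emb I M J (Pi\<^sub>E J E)" "finite J" "J \<subseteq> I" "\<And>i. i \<in> J \<Longrightarrow> E i \<in> sets (M i)"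
  then show ?thesis by (intro exI[of _ J] exI[of _ E]) simp
qed

lemma norm_Lp_dominated:
  assumes p: "even p" "0 < p" and G: "in_Lp M p G"
    and [measurable]: "\<And>n::nat. H n \<in> borel_measurable M"
    and bound: "\<And>n. AE x in M. \<bar>H n x\<bar> \<le> \<bar>G x\<bar>" and lim: "AE x in M. (\<lambda>n. H n x) \<longlonglongrightarrow> 0"
  shows "(\<lambda>n. norm_Lp M p (H n)) \<longlonglongrightarrow> 0"
proof -
  have "(\<lambda>n. LINT x|M. H n x ^ p) \<longlonglongrightarrow> (LINT x|M. 0)"
  proof (rule integral_dominated_convergence)
    show "integrable M (\<lambda>x. G x ^ p)" using G by (simp add: in_Lp_def)
    show "AE x in M. (\<lambda>n. H n x ^ p) \<longlonglongrightarrow> 0"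
      using lim
    proof eventually_elim
      case (elim x)
      from tendsto_power[OF this, of p] show ?case using p by (simp add: power_0_left)
    qed
    show "AE x in M. norm (H n x ^ p) \<le> G x ^ p" for n
      using bound[of n]
    proof eventually_elim
      case (elim x)
      then have "\<bar>H n x\<bar> ^ p \<le> \<bar>G x\<bar> ^ p" by (intro power_mono) auto
      then show ?case using p by (simp add: power_abs power_even_abs)
    qed
  qed measurable
  from tendsto_real_root[OF this, of p] show ?thesis
    using p by (simp add: norm_Lp_def)
qed

context iid_space
begin

text \<open>Coordinates are averaged out one at a time. The part \<open>D\<close> lost with
  coordinate \<open>k\<close> has conditional mean zero and norm at most the influence of
  \<open>k\<close>, and averaging does not increase the influences of the other coordinates.\<close>

lemma norm_centered_le_finite:
  assumes p: "p = 2 \<or> p = 4" and "finite J" "in_Lp P p F" "dep_on J F"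
  shows "(norm_Lp P p (\<lambda>x. F x - (LINT x|P. F x)))\<^sup>2 \<le> 4 * (\<Sum>k\<in>J. (influence p F k)\<^sup>2)"
  using assms(2-4)
proof (induction J arbitrary: F rule: finite_induct)
  case empty
  have "F = (\<lambda>x. F undefined)" by (intro ext dep_onD[OF empty(2)]) simp
  then have F: "F = (\<lambda>x. c)" if "c = F undefined" for c using that by simp
  have "(LINT x|P. F x) = F undefined" by (subst F[OF refl]) (simp add: P.prob_space)
  then have "F x - (LINT x|P. F x) = 0" for x using fun_cong[OF F[OF refl], of x] by linarith
  then have eq: "(\<lambda>x. F x - (LINT x|P. F x)) = (\<lambda>x. 0)" by (rule ext)
  show ?case unfolding eq using p by auto
next
  case (insert k J)
  have ep: "even p" "0 < p" using p by auto
  note [measurable] = in_LpD[OF insert.prems(1)]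
  define c where "c = (LINT x|P. F x)"
  define S where "S = cnd {k} F"
  define D where "D = (\<lambda>x. F x - S x)"
  have S: "in_Lp P p S" unfolding S_def by (rule Lp_cnd(1)[OF ep insert.prems(1)])
  have Sc: "in_Lp P p (\<lambda>x. S x - c)" by (intro in_Lp_diff ep S P.in_Lp_const)
  have D: "in_Lp P p D" unfolding D_def by (intro in_Lp_diff ep S insert.prems(1))
  note [measurable] = in_LpD[OF S] in_LpD[OF D]
  have depS: "dep_on J S"
    using dep_on_cnd[OF insert.prems(2), of "{k}"] insert.hyps unfolding S_def by (rule_tac dep_on_mono) auto
  have S_mrg: "S (mrg {k} y x) = S x" for x y
    using depS insert.hyps by (intro dep_on_mrg_outside) auto
  have ES: "(LINT x|P. S x) = c"
    unfolding S_def c_def by (rule integral_cnd[OF P.integrable_Lp[OF ep insert.prems(1)]])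
  \<comment> \<open>A non-integrable function has integral 0 by convention. This settles the second
    case at once, and applied to single sections it makes the conditional mean of the product vanish
    at every point.\<close>
  have orth: "(LINT x|P. (S x - c) ^ (p - 1) * D x) = 0"
  proof (cases "integrable P (\<lambda>x. (S x - c) ^ (p - 1) * D x)")
    case True
    have *: "cnd {k} (\<lambda>x. (S x - c) ^ (p - 1) * D x) x = 0" for x
    proof -
      have "(LINT y|P. F (mrg {k} y x) - S x) = 0"
      proof (cases "integrable P (\<lambda>y. F (mrg {k} y x))")
        case True then show ?thesis by (simp add: S_def cnd_def P.prob_space)
      next
        case False
        have "\<not> integrable P (\<lambda>y. F (mrg {k} y x) - S x)"
        proof
          assume "integrable P (\<lambda>y. F (mrg {k} y x) - S x)"
          from Bochner_Integration.integrable_add[OF this P.integrable_const[of "S x"]]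
          show False using False by simp
        qed
        then show ?thesis by (rule not_integrable_integral_eq)
      qed
      then show ?thesis by (simp add: cnd_def D_def S_mrg)
    qed
    then have "cnd {k} (\<lambda>x. (S x - c) ^ (p - 1) * D x) = (\<lambda>x. 0)" by (rule ext)
    then show ?thesis using integral_cnd[OF True, of "{k}"] by simp
  qed (simp add: not_integrable_integral_eq)
  have "(norm_Lp P p (\<lambda>x. F x - c))\<^sup>2 = (norm_Lp P p (\<lambda>x. (S x - c) + D x))\<^sup>2"
    by (simp add: D_def)
  also have "\<dots> \<le> (norm_Lp P p (\<lambda>x. S x - c))\<^sup>2 + 4 * (norm_Lp P p D)\<^sup>2"
    by (rule norm_Lp_martingale_step[OF p Sc D orth])
  also have "(norm_Lp P p (\<lambda>x. S x - c))\<^sup>2 \<le> 4 * (\<Sum>k\<in>J. (influence p S k)\<^sup>2)"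
    using insert.IH[OF S depS] by (simp add: ES)
  also have "(\<Sum>k\<in>J. (influence p S k)\<^sup>2) \<le> (\<Sum>k\<in>J. (influence p F k)\<^sup>2)"
    unfolding S_def by (intro sum_mono power_mono influence_cnd_le ep insert.prems influence_nonneg)
  also have "(norm_Lp P p D)\<^sup>2 \<le> (influence p F k)\<^sup>2"
    unfolding D_def S_def by (intro power_mono norm_diff_cnd_single[OF ep insert.prems(1)]) (simp add: ep)
  finally show ?case
    using insert.hyps by (simp add: c_def algebra_simps)
qed

section \<open>Approximation by functions of finitely many coordinates\<close>

definition cylindrical :: "nat \<Rightarrow> ((int \<Rightarrow> 's) \<Rightarrow> real) \<Rightarrow> bool" where
  "cylindrical p F \<longleftrightarrow> in_Lp P p F \<and>
     (\<forall>e>0. \<exists>J G. finite J \<and> in_Lp P p G \<and> dep_on J G \<and> norm_Lp P p (\<lambda>x. F x - G x) \<le> e)"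

lemma cylindricalE:
  assumes "cylindrical p F" "e > 0"
  obtains J G where "finite J" "in_Lp P p G" "dep_on J G" "norm_Lp P p (\<lambda>x. F x - G x) \<le> e"
  using assms unfolding cylindrical_def by blast

lemma cylindrical_close:
  assumes p: "even p" "0 < p" and F: "in_Lp P p F"
    and close: "\<And>e. e > 0 \<Longrightarrow> \<exists>G. cylindrical p G \<and> norm_Lp P p (\<lambda>x. F x - G x) \<le> e"
  shows "cylindrical p F"
  unfolding cylindrical_def
proof (intro conjI allI impI F)
  fix e :: real assume e: "e > 0"
  obtain G where G: "cylindrical p G" "norm_Lp P p (\<lambda>x. F x - G x) \<le> e / 2"
    using close[of "e / 2"] e by auto
  obtain J H where H: "finite J" "in_Lp P p H" "dep_on J H" "norm_Lp P p (\<lambda>x. G x - H x) \<le> e / 2"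
    by (rule cylindricalE[OF G(1) half_gt_zero[OF e]])
  have "in_Lp P p G" using G by (simp add: cylindrical_def)
  then have "norm_Lp P p (\<lambda>x. F x - G x + (G x - H x)) \<le> norm_Lp P p (\<lambda>x. F x - G x) + norm_Lp P p (\<lambda>x. G x - H x)"
    by (intro norm_Lp_triangle in_Lp_diff p F H(2))
  also have "\<dots> \<le> e" using G(2) H(4) by linarith
  finally have "norm_Lp P p (\<lambda>x. F x - H x) \<le> e" by simp
  then show "\<exists>J G. finite J \<and> in_Lp P p G \<and> dep_on J G \<and> norm_Lp P p (\<lambda>x. F x - G x) \<le> e"
    using H by (intro exI[of _ J] exI[of _ H]) simp
qed

lemma cylindrical_dep_on: "0 < p \<Longrightarrow> in_Lp P p F \<Longrightarrow> finite J \<Longrightarrow> dep_on J F \<Longrightarrow> cylindrical p F"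
  unfolding cylindrical_def by (auto intro!: exI[of _ J] exI[of _ F])

lemma cylindrical_add:
  assumes p: "even p" "0 < p" and F: "cylindrical p F" and G: "cylindrical p G"
  shows "cylindrical p (\<lambda>x. F x + G x)"
  unfolding cylindrical_def
proof (intro conjI allI impI)
  have FG: "in_Lp P p F" "in_Lp P p G" using F G by (auto simp: cylindrical_def)
  then show "in_Lp P p (\<lambda>x. F x + G x)" by (intro in_Lp_add p)
  fix e :: real assume e: "e > 0"
  obtain J F' where F': "finite J" "in_Lp P p F'" "dep_on J F'" "norm_Lp P p (\<lambda>x. F x - F' x) \<le> e / 2"
    by (rule cylindricalE[OF F half_gt_zero[OF e]])
  obtain K G' where G': "finite K" "in_Lp P p G'" "dep_on K G'" "norm_Lp P p (\<lambda>x. G x - G' x) \<le> e / 2"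
    by (rule cylindricalE[OF G half_gt_zero[OF e]])
  have "norm_Lp P p (\<lambda>x. F x - F' x + (G x - G' x)) \<le> norm_Lp P p (\<lambda>x. F x - F' x) + norm_Lp P p (\<lambda>x. G x - G' x)"
    by (intro norm_Lp_triangle in_Lp_diff p FG F'(2) G'(2))
  also have "\<dots> \<le> e" using F'(4) G'(4) by linarith
  finally have "norm_Lp P p (\<lambda>x. F x + G x - (F' x + G' x)) \<le> e" by (simp add: algebra_simps)
  moreover have "dep_on (J \<union> K) (\<lambda>x. F' x + G' x)"
    by (rule dep_on_comp2[OF dep_on_mono[OF F'(3)] dep_on_mono[OF G'(3)]]) auto
  moreover have "in_Lp P p (\<lambda>x. F' x + G' x)" using F' G' by (intro in_Lp_add p)
  ultimately show "\<exists>J H. finite J \<and> in_Lp P p H \<and> dep_on J H \<and> norm_Lp P p (\<lambda>x. F x + G x - H x) \<le> e"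
    using F'(1) G'(1) by (intro exI[of _ "J \<union> K"] exI[of _ "\<lambda>x. F' x + G' x"]) simp
qed

lemma cylindrical_cmult:
  assumes p: "even p" "0 < p" and F: "cylindrical p F"
  shows "cylindrical p (\<lambda>x. c * F x)"
  unfolding cylindrical_def
proof (intro conjI allI impI)
  have F': "in_Lp P p F" using F by (auto simp: cylindrical_def)
  then show "in_Lp P p (\<lambda>x. c * F x)" by (rule in_Lp_cmult)
  fix e :: real assume e: "e > 0"
  define d where "d = e / (\<bar>c\<bar> + 1)"
  have d: "d > 0" using e by (simp add: d_def)
  obtain J G where G: "finite J" "in_Lp P p G" "dep_on J G" "norm_Lp P p (\<lambda>x. F x - G x) \<le> d"
    by (rule cylindricalE[OF F d])
  have "norm_Lp P p (\<lambda>x. c * (F x - G x)) \<le> \<bar>c\<bar> * d"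
    using mult_left_mono[OF G(4), of "\<bar>c\<bar>"] unfolding norm_Lp_cmult[OF p] by simp
  also have "\<dots> = e * (\<bar>c\<bar> / (\<bar>c\<bar> + 1))" by (simp add: d_def)
  also have "\<dots> \<le> e * 1" using e by (intro mult_left_mono) auto
  finally have "norm_Lp P p (\<lambda>x. c * F x - c * G x) \<le> e" by (simp only: right_diff_distrib mult_1_right)
  then show "\<exists>J H. finite J \<and> in_Lp P p H \<and> dep_on J H \<and> norm_Lp P p (\<lambda>x. c * F x - H x) \<le> e"
    using G by (intro exI[of _ J] exI[of _ "\<lambda>x. c * G x"]) (simp add: in_Lp_cmult dep_on_comp)
qed

lemma cylindrical_sum:
  assumes p: "even p" "0 < p" and F: "\<And>i. i \<in> I \<Longrightarrow> cylindrical p (F i)"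
  shows "cylindrical p (\<lambda>x. \<Sum>i\<in>I. F i x)"
  using F
proof (induction I rule: infinite_finite_induct)
  case (insert i I) then show ?case by (simp add: cylindrical_add p)
qed (use cylindrical_dep_on[OF p(2) in_Lp_zero[OF p(2)], of "{}"] in \<open>auto simp: dep_on_const\<close>)

lemma cylindrical_cong_AE:
  assumes p: "even p" "0 < p" and F: "cylindrical p F" and [measurable]: "G \<in> borel_measurable P"
    and eq: "AE x in P. F x = G x"
  shows "cylindrical p G"
proof (rule cylindrical_close[OF p])
  have F': "in_Lp P p F" using F by (auto simp: cylindrical_def)
  note [measurable] = in_LpD[OF F']
  show G: "in_Lp P p G" by (rule in_Lp_mono[OF p(1) F']) (use eq in \<open>auto elim: eventually_mono\<close>)
  fix e :: real assume "e > 0"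
  have "norm_Lp P p (\<lambda>x. G x - F x) = norm_Lp P p (\<lambda>x. 0)"
    by (rule norm_Lp_cong_AE) (use eq in auto)
  then show "\<exists>H. cylindrical p H \<and> norm_Lp P p (\<lambda>x. G x - H x) \<le> e"
    using F \<open>e > 0\<close> p by (intro exI[of _ F]) simp
qed

lemma cylindrical_limit:
  assumes p: "even p" "0 < p" and F: "\<And>n::nat. cylindrical p (F n)" and G: "in_Lp P p G"
    and [measurable]: "H \<in> borel_measurable P"
    and lim: "\<And>x. x \<in> space P \<Longrightarrow> (\<lambda>n. F n x) \<longlonglongrightarrow> H x"
    and bound: "\<And>n x. x \<in> space P \<Longrightarrow> \<bar>F n x\<bar> \<le> \<bar>G x\<bar>" "\<And>x. x \<in> space P \<Longrightarrow> \<bar>H x\<bar> \<le> \<bar>G x\<bar>"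
  shows "cylindrical p H"
proof (rule cylindrical_close[OF p])
  have F': "in_Lp P p (F n)" for n using F by (auto simp: cylindrical_def)
  note [measurable] = in_LpD[OF F']
  show H: "in_Lp P p H" by (rule in_Lp_mono[OF p(1) G]) (use bound in auto)
  have lim0: "(\<lambda>n. norm_Lp P p (\<lambda>x. H x - F n x)) \<longlonglongrightarrow> 0"
  proof (rule norm_Lp_dominated[OF p in_Lp_cmult[OF G, of 2]])
    show "AE x in P. (\<lambda>n. H x - F n x) \<longlonglongrightarrow> 0"
    proof (rule AE_I2)
      fix x assume "x \<in> space P"
      from tendsto_diff[OF tendsto_const lim[OF this], of "H x"]
      show "(\<lambda>n. H x - F n x) \<longlonglongrightarrow> 0" by simp
    qed
    show "AE x in P. \<bar>H x - F n x\<bar> \<le> \<bar>2 * G x\<bar>" for n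
    proof (rule AE_I2)
      fix x assume "x \<in> space P"
      from bound(1)[OF this, of n] bound(2)[OF this] show "\<bar>H x - F n x\<bar> \<le> \<bar>2 * G x\<bar>" by simp
    qed
  qed measurable
  fix e :: real assume "e > 0"
  from order_tendstoD(2)[OF lim0 this]
  obtain n where "norm_Lp P p (\<lambda>x. H x - F n x) < e"
    by (auto simp: eventually_sequentially)
  then show "\<exists>K. cylindrical p K \<and> norm_Lp P p (\<lambda>x. H x - K x) \<le> e"
    using F by (intro exI[of _ "F n"]) simp
qed

text \<open>Dynkin's argument with the cylinders as intersection-stable generator. Complements and
  disjoint unions become affine combinations and dominated limits, both of which preserve
  approximability.\<close>

lemma cylindrical_indicator:
  assumes p: "even p" "0 < p" and A: "A \<in> sets P"
  shows "cylindrical p (indicator A)"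
proof -
  have const: "cylindrical p (\<lambda>x. c)" for c
    by (rule cylindrical_dep_on[OF p(2) P.in_Lp_const, of "{}"]) (auto intro: dep_on_const)
  let ?\<Omega> = "\<Pi>\<^sub>E i\<in>(UNIV::int set). space \<mu>"
  have sets_P: "sets P = sigma_sets ?\<Omega> (prod_algebra UNIV (\<lambda>_::int. \<mu>))"
    unfolding P_def by (rule sets_PiM)
  have space_P: "space P = ?\<Omega>" by (simp add: P_def space_PiM)
  have "A \<in> sigma_sets ?\<Omega> (prod_algebra UNIV (\<lambda>_::int. \<mu>))" using A sets_P by simp
  then show ?thesis
  proof (induction rule: sigma_sets_induct_disjoint[OF Int_stable_prod_algebra prod_algebra_sets_into_space,
      consumes 1, case_names basic empty compl union])
    case (basic A)
    from prod_algebra_cylinder[OF basic] obtain J E where A: "A = prod_emb UNIV (\<lambda>_. \<mu>) J (Pi\<^sub>E J E)"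
      and J: "finite J" "\<forall>j\<in>J. E j \<in> sets \<mu>"
      by blast
    have A_sets: "A \<in> sets P" using basic sets_P by blast
    have E [measurable]: "j \<in> J \<Longrightarrow> E j \<in> sets \<mu>" for j using J(2) by blast
    define G :: "(int \<Rightarrow> 's) \<Rightarrow> real" where "G x = (\<Prod>j\<in>J. indicator (E j) (x j))" for x
    have "cylindrical p G"
    proof (rule cylindrical_dep_on[OF p(2) _ J(1)])
      have "\<bar>G x\<bar> \<le> 1" for x unfolding G_def abs_prod
        by (intro prod_le_1) (auto simp: indicator_def)
      then show "in_Lp P p G"
        by (intro P.in_Lp_bounded[of _ 1]) (auto simp: G_def[abs_def])
      show "dep_on J G" unfolding dep_on_def G_def by (auto intro!: prod.cong)
    qed
    moreover have "AE x in P. G x = indicator A x"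
    proof (rule AE_I2)
      fix x assume "x \<in> space P"
      then have "x \<in> A \<longleftrightarrow> (\<forall>j\<in>J. x j \<in> E j)"
        using sets.sets_into_space[OF E] by (auto simp: A prod_emb_def space_P PiE_iff)
      then show "G x = indicator A x"
        using J(1) by (auto simp: G_def indicator_def prod_zero_iff)
    qed
    ultimately show ?case
      using A_sets by (rule_tac cylindrical_cong_AE[OF p, of G]) auto
  next
    case empty
    have "(indicator {} :: (int \<Rightarrow> 's) \<Rightarrow> real) = (\<lambda>x. 0)" by (rule ext) simp
    then show ?case using const[of 0] by (simp only:)
  next
    case (compl A)
    then have A_sets: "A \<in> sets P" using sets_P by simp
    have "cylindrical p (\<lambda>x. 1 + (-1) * indicator A x)"
      by (intro cylindrical_add cylindrical_cmult p const compl)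
    then show ?case
    proof (rule cylindrical_cong_AE[OF p])
      show "indicator (?\<Omega> - A) \<in> borel_measurable P"
        using A_sets by (simp add: space_P[symmetric])
      show "AE x in P. 1 + (-1) * indicator A x = (indicator (?\<Omega> - A) x :: real)"
        by (rule AE_I2) (simp add: indicator_def space_P)
    qed
  next
    case (union A)
    then have A_sets: "A i \<in> sets P" for i using sets_P by auto
    show ?case
    proof (rule cylindrical_limit[OF p])
      show "cylindrical p (\<lambda>x. \<Sum>i<n. indicator (A i) x)" for n
        by (rule cylindrical_sum[OF p union(3)])
      show "in_Lp P p (\<lambda>x. 1)" by (rule P.in_Lp_const)
      have eq: "(\<Sum>i<n. indicator (A i) x) = (indicator (\<Union>i<n. A i) x :: real)" for n x
      proof -
        have "disjoint_family_on A {..<n}" using union(1) by (auto simp: disjoint_family_on_def)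
        then show ?thesis by (rule indicator_UN_disjoint[OF finite_lessThan, symmetric])
      qed
      show "(\<lambda>n. \<Sum>i<n. indicator (A i) x) \<longlonglongrightarrow> (indicator (\<Union>i. A i) x :: real)" for x
        unfolding eq by (rule LIMSEQ_indicator_UN)
      show "\<bar>\<Sum>i<n. indicator (A i) x\<bar> \<le> \<bar>1::real\<bar>" for n x
        unfolding eq by (simp add: indicator_def)
      show "indicator (\<Union>i. A i) \<in> borel_measurable P" using A_sets by simp
      show "\<bar>indicator (\<Union>i. A i) x\<bar> \<le> \<bar>1::real\<bar>" for x by (simp add: indicator_def)
    qed
  qed
qed

text \<open>Simple functions approximate \<open>F\<close> pointwise and stay below
  \<open>2 * F\<close> in absolute value, so dominated convergence reduces the claim to
  indicators.\<close>

lemma cylindrical_Lp: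
  assumes p: "even p" "0 < p" and F: "in_Lp P p F"
  shows "cylindrical p F"
proof -
  note [measurable] = in_LpD[OF F]
  obtain s where "\<forall>i::nat. simple_function P (s i)" "\<forall>x\<in>space P. (\<lambda>i. s i x) \<longlonglongrightarrow> F x"
      "\<forall>i. \<forall>x\<in>space P. dist (s i x) 0 \<le> 2 * dist (F x) 0"
    using borel_measurable_implies_sequence_metric[OF in_LpD[OF F], of 0] by blast
  then have s: "\<And>i. simple_function P (s i)" "\<And>x. x \<in> space P \<Longrightarrow> (\<lambda>i. s i x) \<longlonglongrightarrow> F x"
      "\<And>i x. x \<in> space P \<Longrightarrow> dist (s i x) 0 \<le> 2 * dist (F x) 0"
    by auto
  show ?thesis
  proof (rule cylindrical_limit[OF p _ in_Lp_cmult[OF F, of 2]])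
    fix n
    have fin: "finite (s n ` space P)" and meas: "\<And>y. s n -` {y} \<inter> space P \<in> sets P"
      using simple_functionD[OF s(1)[of n]] by auto
    have [measurable]: "s n \<in> borel_measurable P" using s(1) by (rule borel_measurable_simple_function)
    have "cylindrical p (\<lambda>x. \<Sum>y\<in>s n ` space P. y * indicator (s n -` {y} \<inter> space P) x)"
      by (intro cylindrical_sum cylindrical_cmult cylindrical_indicator p meas)
    then show "cylindrical p (s n)"
    proof (rule cylindrical_cong_AE[OF p])
      show "AE x in P. (\<Sum>y\<in>s n ` space P. y * indicator (s n -` {y} \<inter> space P) x) = s n x"
      proof (rule AE_I2)
        fix x assume x: "x \<in> space P"
        have "(\<Sum>y\<in>s n ` space P. y * indicator (s n -` {y} \<inter> space P) x) = (\<Sum>y\<in>s n ` space P. if y = s n x then y else 0)"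
          using x by (intro sum.cong) (auto simp: indicator_def)
        then show "(\<Sum>y\<in>s n ` space P. y * indicator (s n -` {y} \<inter> space P) x) = s n x"
          using x fin by simp
      qed
    qed measurable
  next
    show "\<bar>s n x\<bar> \<le> \<bar>2 * F x\<bar>" if "x \<in> space P" for n x
      using s(3)[OF that, of n] by (simp add: abs_mult)
  qed (use s in auto)
qed

text \<open>The averaging \<open>cnd (- K)\<close> fixes a cylindrical approximation
  \<open>G\<close> as soon as \<open>K\<close> contains its coordinates, and it contracts
  \<open>F - G\<close>; the error is at most doubled. Having the bound for all larger
  \<open>K\<close> allows a symmetric interval to be chosen later.\<close>

lemma norm_diff_cnd_small:
  assumes p: "even p" "0 < p" and F: "in_Lp P p F" and e: "e > 0"
  shows "\<exists>J. finite J \<and> (\<forall>K. J \<subseteq> K \<longrightarrow> norm_Lp P p (\<lambda>x. F x - cnd (- K) F x) \<le> e)"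
proof -
  obtain J G where G: "finite J" "in_Lp P p G" "dep_on J G" "norm_Lp P p (\<lambda>x. F x - G x) \<le> e / 2"
    by (rule cylindricalE[OF cylindrical_Lp[OF p F] half_gt_zero[OF e]])
  note [measurable] = in_LpD[OF F] in_LpD[OF G(2)]
  have FG: "in_Lp P p (\<lambda>x. F x - G x)" by (intro in_Lp_diff p F G)
  show ?thesis
  proof (intro exI conjI allI impI)
    show "finite J" by (rule G(1))
    fix K assume JK: "J \<subseteq> K"
    have "norm_Lp P p (\<lambda>x. F x - cnd (- K) F x) = norm_Lp P p (\<lambda>x. (F x - G x) - cnd (- K) (\<lambda>x. F x - G x) x)"
    proof (rule norm_Lp_cong_AE)
      have *: "cnd (- K) G x = G x" for x using JK by (intro cnd_dep_on_outside[OF G(3)]) auto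
      show "AE x in P. F x - cnd (- K) F x = (F x - G x) - cnd (- K) (\<lambda>x. F x - G x) x"
        using cnd_diff[OF p F G(2), of "- K"] by eventually_elim (simp add: *)
    qed measurable
    also have "\<dots> \<le> norm_Lp P p (\<lambda>x. F x - G x) + norm_Lp P p (cnd (- K) (\<lambda>x. F x - G x))"
      by (intro norm_Lp_triangle_diff p FG Lp_cnd)
    also have "\<dots> \<le> e / 2 + e / 2"
      using G(4) Lp_cnd(2)[OF p FG, of "- K"] by linarith
    finally show "norm_Lp P p (\<lambda>x. F x - cnd (- K) F x) \<le> e" by simp
  qed
qed

text \<open>The finite case is applied to \<open>cnd (- J) F\<close>, which has the same mean, no
  larger influences, and is close to \<open>F\<close> for large \<open>J\<close>.\<close>

lemma norm_centered_le:
  assumes p: "p = 2 \<or> p = 4" and F: "in_Lp P p F"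
    and D: "\<And>J. finite J \<Longrightarrow> (\<Sum>k\<in>J. (influence p F k)\<^sup>2) \<le> D"
  shows "(norm_Lp P p (\<lambda>x. F x - (LINT x|P. F x)))\<^sup>2 \<le> 4 * D"
proof -
  have ep: "even p" "0 < p" using p by auto
  have D0: "0 \<le> D" using D[of "{}"] by simp
  define c where "c = (LINT x|P. F x)"
  have "norm_Lp P p (\<lambda>x. F x - c) \<le> sqrt (4 * D) + e" if e: "e > 0" for e
  proof -
    obtain J where J: "finite J" "\<forall>K. J \<subseteq> K \<longrightarrow> norm_Lp P p (\<lambda>x. F x - cnd (- K) F x) \<le> e"
      using norm_diff_cnd_small[OF ep F e] by (elim exE conjE)
    let ?G = "cnd (- J) F"
    have G: "in_Lp P p ?G" by (rule Lp_cnd[OF ep F])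
    have "dep_on J ?G" using dep_on_cnd[OF dep_on_UNIV, of "- J" F] by (rule dep_on_mono) auto
    from norm_centered_le_finite[OF p J(1) G this]
    have "(norm_Lp P p (\<lambda>x. ?G x - c))\<^sup>2 \<le> 4 * (\<Sum>k\<in>J. (influence p ?G k)\<^sup>2)"
      by (simp add: integral_cnd P.integrable_Lp[OF ep F] c_def)
    also have "(\<Sum>k\<in>J. (influence p ?G k)\<^sup>2) \<le> (\<Sum>k\<in>J. (influence p F k)\<^sup>2)"
      by (intro sum_mono power_mono influence_cnd_le ep F influence_nonneg)
    also have "\<dots> \<le> D" by (rule D[OF J(1)])
    finally have 1: "norm_Lp P p (\<lambda>x. ?G x - c) \<le> sqrt (4 * D)"
      by (intro real_le_rsqrt) simp
    have "norm_Lp P p (\<lambda>x. (F x - ?G x) + (?G x - c)) \<le> norm_Lp P p (\<lambda>x. F x - ?G x) + norm_Lp P p (\<lambda>x. ?G x - c)"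
      by (intro norm_Lp_triangle in_Lp_diff ep F G P.in_Lp_const)
    then show ?thesis using 1 J(2) by auto
  qed
  then have "norm_Lp P p (\<lambda>x. F x - c) \<le> sqrt (4 * D)" by (rule field_le_epsilon)
  then have "(norm_Lp P p (\<lambda>x. F x - c))\<^sup>2 \<le> (sqrt (4 * D))\<^sup>2" by (rule power_mono) (simp add: ep)
  then show ?thesis using D0 by (simp add: c_def)
qed

end

section \<open>Schur's test and the norms of linear and quadratic forms\<close>

text \<open>Cauchy-Schwarz with \<open>d\<close> split as \<open>sqrt d * sqrt d\<close>: one factor
  is paid for by the column sum, the other by the row sum after exchanging the sums.\<close>

lemma schur_bound:
  fixes d :: "'i \<Rightarrow> 'k \<Rightarrow> real"
  assumes fin: "finite T" "finite J" and d: "\<And>t k. t \<in> T \<Longrightarrow> 0 \<le> d t k"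
    and row: "\<And>t. t \<in> T \<Longrightarrow> (\<Sum>k\<in>J. d t k) \<le> \<Theta>" and col: "\<And>k. (\<Sum>t\<in>T. d t k) \<le> \<Theta>"
  shows "(\<Sum>k\<in>J. (\<Sum>t\<in>T. d t k * b t)\<^sup>2) \<le> \<Theta>\<^sup>2 * (\<Sum>t\<in>T. (b t)\<^sup>2)"
proof -
  have \<Theta>: "0 \<le> \<Theta>"
    using col[of undefined] sum_nonneg[of T "\<lambda>t. d t undefined"] d by fastforce
  have "(\<Sum>t\<in>T. d t k * b t)\<^sup>2 \<le> \<Theta> * (\<Sum>t\<in>T. d t k * (b t)\<^sup>2)" for k
  proof -
    have "(\<Sum>t\<in>T. d t k * b t)\<^sup>2 = (\<Sum>t\<in>T. sqrt (d t k) * (sqrt (d t k) * b t))\<^sup>2"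
      using d by (intro arg_cong[of _ _ "\<lambda>x. x\<^sup>2"] sum.cong) (simp_all add: mult.assoc[symmetric])
    also have "\<dots> \<le> (\<Sum>t\<in>T. (sqrt (d t k))\<^sup>2) * (\<Sum>t\<in>T. (sqrt (d t k) * b t)\<^sup>2)"
      by (rule Cauchy_Schwarz_ineq_sum)
    also have "\<dots> = (\<Sum>t\<in>T. d t k) * (\<Sum>t\<in>T. d t k * (b t)\<^sup>2)"
      using d by (simp add: power_mult_distrib)
    also have "\<dots> \<le> \<Theta> * (\<Sum>t\<in>T. d t k * (b t)\<^sup>2)"
      using d by (intro mult_right_mono col sum_nonneg) auto
    finally show ?thesis .
  qed
  then have "(\<Sum>k\<in>J. (\<Sum>t\<in>T. d t k * b t)\<^sup>2) \<le> (\<Sum>k\<in>J. \<Theta> * (\<Sum>t\<in>T. d t k * (b t)\<^sup>2))"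
    by (rule sum_mono)
  also have "\<dots> = \<Theta> * (\<Sum>t\<in>T. (\<Sum>k\<in>J. d t k) * (b t)\<^sup>2)"
    by (simp add: sum_distrib_left sum_distrib_right sum.swap[of _ J])
  also have "\<dots> \<le> \<Theta> * (\<Sum>t\<in>T. \<Theta> * (b t)\<^sup>2)"
    using \<Theta> row by (intro mult_left_mono sum_mono mult_right_mono) auto
  also have "\<dots> = \<Theta>\<^sup>2 * (\<Sum>t\<in>T. (b t)\<^sup>2)"
    by (simp add: sum_distrib_left power2_eq_square mult.assoc)
  finally show ?thesis .
qed

context iid_space
begin

text \<open>The two bounds are the row and column sums of the matrix of influences, as Schur's test
  requires. The index set is arbitrary, so that the notion covers the process as well as its block
  sums.\<close>

definition coupling_bound :: "'i set \<Rightarrow> ('i \<Rightarrow> (int \<Rightarrow> 's) \<Rightarrow> real) \<Rightarrow> real \<Rightarrow> bool" where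
  "coupling_bound T X \<Theta> \<longleftrightarrow> finite T \<and> (\<forall>t\<in>T. in_Lp P 4 (X t) \<and> (LINT x|P. X t x) = 0) \<and>
     (\<forall>t\<in>T. \<forall>J. finite J \<longrightarrow> (\<Sum>k\<in>J. influence 4 (X t) k) \<le> \<Theta>) \<and>
     (\<forall>k. (\<Sum>t\<in>T. influence 4 (X t) k) \<le> \<Theta>)"

lemma coupling_boundD:
  assumes "coupling_bound T X \<Theta>"
  shows "finite T" "t \<in> T \<Longrightarrow> in_Lp P 4 (X t)" "t \<in> T \<Longrightarrow> (LINT x|P. X t x) = 0"
    "t \<in> T \<Longrightarrow> finite J \<Longrightarrow> (\<Sum>k\<in>J. influence 4 (X t) k) \<le> \<Theta>" "(\<Sum>t\<in>T. influence 4 (X t) k) \<le> \<Theta>"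
  using assms by (auto simp: coupling_bound_def)

lemma coupling_bound_nonneg: "coupling_bound T X \<Theta> \<Longrightarrow> 0 \<le> \<Theta>"
  using coupling_boundD(5)[of T X \<Theta> undefined] sum_nonneg[of T "\<lambda>t. influence 4 (X t) undefined"] by fastforce

lemma coupling_bound_schur:
  assumes X: "coupling_bound T X \<Theta>" and J: "finite J"
  shows "(\<Sum>k\<in>J. (\<Sum>t\<in>T. influence 4 (X t) k * b t)\<^sup>2) \<le> \<Theta>\<^sup>2 * (\<Sum>t\<in>T. (b t)\<^sup>2)"
  using coupling_boundD[OF X] J by (intro schur_bound) auto

text \<open>Influences are subadditive, so those of the form are bounded by the influence matrix
  applied to the absolute values of \<open>b\<close>; Schur's test bounds their sum of squares, and
  Efron-Stein contributes the factor 4.\<close>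

lemma norm_linear_form:
  assumes X: "coupling_bound T X \<Theta>"
  shows "(norm_Lp P 4 (\<lambda>x. \<Sum>t\<in>T. b t * X t x))\<^sup>2 \<le> 4 * (\<Theta>\<^sup>2 * (\<Sum>t\<in>T. (b t)\<^sup>2))"
proof -
  note D = coupling_boundD[OF X]
  let ?F = "\<lambda>x. \<Sum>t\<in>T. b t * X t x"
  have F: "in_Lp P 4 ?F" using D by (intro in_Lp_sum in_Lp_cmult) auto
  have EF: "(LINT x|P. ?F x) = 0"
    using D P.integrable_Lp[of 4] by (subst Bochner_Integration.integral_sum) auto
  have infl: "influence 4 ?F k \<le> (\<Sum>t\<in>T. influence 4 (X t) k * \<bar>b t\<bar>)" for k
    using influence_sum[of 4 T "\<lambda>t x. b t * X t x" k] D by (simp add: influence_cmult in_Lp_cmult mult.commute)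
  have "(\<Sum>k\<in>J. (influence 4 ?F k)\<^sup>2) \<le> \<Theta>\<^sup>2 * (\<Sum>t\<in>T. (b t)\<^sup>2)" if "finite J" for J
  proof -
    have "(\<Sum>k\<in>J. (influence 4 ?F k)\<^sup>2) \<le> (\<Sum>k\<in>J. (\<Sum>t\<in>T. influence 4 (X t) k * \<bar>b t\<bar>)\<^sup>2)"
      by (intro sum_mono power_mono infl influence_nonneg) simp
    also have "\<dots> \<le> \<Theta>\<^sup>2 * (\<Sum>t\<in>T. \<bar>b t\<bar>\<^sup>2)" by (rule coupling_bound_schur[OF X that])
    finally show ?thesis by simp
  qed
  from norm_centered_le[OF _ F this] show ?thesis by (simp add: EF)
qed

lemma norm_linear_form_le:
  assumes X: "coupling_bound T X \<Theta>"
  shows "norm_Lp P 4 (\<lambda>x. \<Sum>t\<in>T. b t * X t x) \<le> 2 * \<Theta> * sqrt (\<Sum>t\<in>T. (b t)\<^sup>2)"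
proof (rule power2_le_imp_le)
  show "(norm_Lp P 4 (\<lambda>x. \<Sum>t\<in>T. b t * X t x))\<^sup>2 \<le> (2 * \<Theta> * sqrt (\<Sum>t\<in>T. (b t)\<^sup>2))\<^sup>2"
    using norm_linear_form[OF X, of b] by (simp add: power_mult_distrib sum_nonneg mult.assoc)
  show "0 \<le> 2 * \<Theta> * sqrt (\<Sum>t\<in>T. (b t)\<^sup>2)"
    using coupling_bound_nonneg[OF X] by (simp add: sum_nonneg)
qed

text \<open>Efron--Stein: replacing \<open>\<epsilon>\<^sub>k\<close> changes one factor at a time, and the other factor is
  a linear form to which \<open>norm_linear_form\<close> applies.\<close>

lemma norm_quadratic_form:
  fixes a :: "'i \<Rightarrow> 'i \<Rightarrow> real"
  assumes X: "coupling_bound T X \<Theta>" and Y: "coupling_bound T Y \<Xi>"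
  defines "F \<equiv> \<lambda>x. \<Sum>s\<in>T. \<Sum>t\<in>T. a s t * (X s x * Y t x)"
  shows "in_Lp P 2 F"
    and "norm_Lp P 2 (\<lambda>x. F x - (LINT x|P. F x)) \<le> 8 * \<Theta> * \<Xi> * sqrt (\<Sum>s\<in>T. \<Sum>t\<in>T. (a s t)\<^sup>2)"
proof -
  note DX = coupling_boundD[OF X] and DY = coupling_boundD[OF Y]
  note \<Theta> = coupling_bound_nonneg[OF X] and \<Xi> = coupling_bound_nonneg[OF Y]
  show F: "in_Lp P 2 F"
    unfolding F_def using DX DY by (intro in_Lp_sum in_Lp_cmult norm_Lp_2_mult(1)) auto
  define U where "U s x = (\<Sum>t\<in>T. a s t * Y t x)" for s x
  define V where "V t x = (\<Sum>s\<in>T. a s t * X s x)" for t x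
  have U: "in_Lp P 4 (U s)" for s unfolding U_def[abs_def] using DY by (intro in_Lp_sum in_Lp_cmult) auto
  have V: "in_Lp P 4 (V s)" for s unfolding V_def[abs_def] using DX by (intro in_Lp_sum in_Lp_cmult) auto
  define \<alpha> where "\<alpha> s = 2 * \<Xi> * sqrt (\<Sum>t\<in>T. (a s t)\<^sup>2)" for s
  define \<beta> where "\<beta> t = 2 * \<Theta> * sqrt (\<Sum>s\<in>T. (a s t)\<^sup>2)" for t
  have nU: "norm_Lp P 4 (U s) \<le> \<alpha> s" for s
    unfolding U_def[abs_def] \<alpha>_def by (rule norm_linear_form_le[OF Y])
  have nV: "norm_Lp P 4 (V t) \<le> \<beta> t" for t
    unfolding V_def[abs_def] \<beta>_def by (rule norm_linear_form_le[OF X])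
  have infl: "influence 2 F k \<le> (\<Sum>s\<in>T. influence 4 (X s) k * \<alpha> s) + (\<Sum>t\<in>T. influence 4 (Y t) k * \<beta> t)" for k
  proof -
    let ?m = "\<lambda>z. mrg {k} (snd z) (fst z)"
    define dX where "dX s z = X s (fst z) - X s (?m z)" for s z
    define dY where "dY s z = Y s (fst z) - Y s (?m z)" for s z
    have dX: "in_Lp (P \<Otimes>\<^sub>M P) 4 (dX s)" and dY: "in_Lp (P \<Otimes>\<^sub>M P) 4 (dY s)" if "s \<in> T" for s
      unfolding dX_def[abs_def] dY_def[abs_def] using that DX DY by (auto intro!: in_Lp_resample)
    have FX: "F x = (\<Sum>s\<in>T. X s x * U s x)" for x
      by (simp add: F_def U_def sum_distrib_left algebra_simps)
    \<comment> \<open>Discrete product rule. In the second part the sum over \<open>s\<close> is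
      collected first, so that a linear form in \<open>X\<close> appears at the resampled point,
      which again has law \<open>P\<close>.\<close>
    have eq: "F (fst z) - F (?m z) = (\<Sum>s\<in>T. dX s z * U s (fst z)) + (\<Sum>t\<in>T. dY t z * V t (?m z))" for z
    proof -
      have "(\<Sum>t\<in>T. dY t z * V t (?m z)) = (\<Sum>t\<in>T. \<Sum>s\<in>T. a s t * X s (?m z) * dY t z)"
        by (simp add: V_def sum_distrib_left algebra_simps)
      also have "\<dots> = (\<Sum>s\<in>T. \<Sum>t\<in>T. a s t * X s (?m z) * dY t z)" by (rule sum.swap)
      also have "\<dots> = (\<Sum>s\<in>T. X s (?m z) * (U s (fst z) - U s (?m z)))"
        by (simp add: U_def dY_def sum_distrib_left sum_subtractf[symmetric] algebra_simps)
      finally show ?thesis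
        by (simp add: FX dX_def sum_subtractf[symmetric] sum.distrib[symmetric] algebra_simps)
    qed
    have U1: "in_Lp (P \<Otimes>\<^sub>M P) 4 (\<lambda>z. U s (fst z))" "norm_Lp (P \<Otimes>\<^sub>M P) 4 (\<lambda>z. U s (fst z)) \<le> \<alpha> s" for s
      using Lp_fst[OF U[of s]] nU[of s] by simp_all
    have V1: "in_Lp (P \<Otimes>\<^sub>M P) 4 (\<lambda>z. V s (?m z))" "norm_Lp (P \<Otimes>\<^sub>M P) 4 (\<lambda>z. V s (?m z)) \<le> \<beta> s" for s
      using Lp_mrg[OF V[of s], of "{k}"] nV[of s] by simp_all
    have t1: "in_Lp (P \<Otimes>\<^sub>M P) 2 (\<lambda>z. dX s z * U s (fst z))"
        "norm_Lp (P \<Otimes>\<^sub>M P) 2 (\<lambda>z. dX s z * U s (fst z)) \<le> influence 4 (X s) k * \<alpha> s" if "s \<in> T" for s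
    proof -
      show "in_Lp (P \<Otimes>\<^sub>M P) 2 (\<lambda>z. dX s z * U s (fst z))" by (rule norm_Lp_2_mult(1)[OF dX[OF that] U1(1)])
      have "norm_Lp (P \<Otimes>\<^sub>M P) 4 (dX s) = influence 4 (X s) k" by (simp add: influence_def dX_def[abs_def])
      then show "norm_Lp (P \<Otimes>\<^sub>M P) 2 (\<lambda>z. dX s z * U s (fst z)) \<le> influence 4 (X s) k * \<alpha> s"
        using norm_Lp_2_mult(2)[OF dX[OF that] U1(1)[of s]] mult_left_mono[OF U1(2)[of s] influence_nonneg[of 4 "X s" k]]
        by simp
    qed
    have t2: "in_Lp (P \<Otimes>\<^sub>M P) 2 (\<lambda>z. dY s z * V s (?m z))"
        "norm_Lp (P \<Otimes>\<^sub>M P) 2 (\<lambda>z. dY s z * V s (?m z)) \<le> influence 4 (Y s) k * \<beta> s" if "s \<in> T" for s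
    proof -
      show "in_Lp (P \<Otimes>\<^sub>M P) 2 (\<lambda>z. dY s z * V s (?m z))" by (rule norm_Lp_2_mult(1)[OF dY[OF that] V1(1)])
      have "norm_Lp (P \<Otimes>\<^sub>M P) 4 (dY s) = influence 4 (Y s) k" by (simp add: influence_def dY_def[abs_def])
      then show "norm_Lp (P \<Otimes>\<^sub>M P) 2 (\<lambda>z. dY s z * V s (?m z)) \<le> influence 4 (Y s) k * \<beta> s"
        using norm_Lp_2_mult(2)[OF dY[OF that] V1(1)[of s]] mult_left_mono[OF V1(2)[of s] influence_nonneg[of 4 "Y s" k]]
        by simp
    qed
    have "influence 2 F k \<le> norm_Lp (P \<Otimes>\<^sub>M P) 2 (\<lambda>z. \<Sum>s\<in>T. dX s z * U s (fst z)) + norm_Lp (P \<Otimes>\<^sub>M P) 2 (\<lambda>z. \<Sum>t\<in>T. dY t z * V t (?m z))"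
      unfolding influence_def eq using t1(1) t2(1) by (intro norm_Lp_triangle in_Lp_sum) auto
    also have "\<dots> \<le> (\<Sum>s\<in>T. influence 4 (X s) k * \<alpha> s) + (\<Sum>t\<in>T. influence 4 (Y t) k * \<beta> t)"
    proof (rule add_mono)
      show "norm_Lp (P \<Otimes>\<^sub>M P) 2 (\<lambda>z. \<Sum>s\<in>T. dX s z * U s (fst z)) \<le> (\<Sum>s\<in>T. influence 4 (X s) k * \<alpha> s)"
        using t1 by (rule_tac order.trans[OF norm_Lp_sum sum_mono]) auto
      show "norm_Lp (P \<Otimes>\<^sub>M P) 2 (\<lambda>z. \<Sum>t\<in>T. dY t z * V t (?m z)) \<le> (\<Sum>t\<in>T. influence 4 (Y t) k * \<beta> t)"
        using t2 by (rule_tac order.trans[OF norm_Lp_sum sum_mono]) auto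
    qed
    finally show ?thesis .
  qed
  let ?A = "\<Sum>s\<in>T. \<Sum>t\<in>T. (a s t)\<^sup>2"
  have A: "0 \<le> ?A" by (intro sum_nonneg) auto
  \<comment> \<open>The 16 is 2 * 4 + 2 * 4: a 2 from squaring a sum of two terms, a 4 from the
    linear forms. Efron-Stein multiplies by another 4, and the root of 64 is the 8 of the
    statement.\<close>
  have bound: "(\<Sum>k\<in>J. (influence 2 F k)\<^sup>2) \<le> 16 * (\<Theta>\<^sup>2 * \<Xi>\<^sup>2 * ?A)" if J: "finite J" for J
  proof -
    have "(\<Sum>k\<in>J. (influence 2 F k)\<^sup>2)
        \<le> (\<Sum>k\<in>J. 2 * (\<Sum>s\<in>T. influence 4 (X s) k * \<alpha> s)\<^sup>2 + 2 * (\<Sum>t\<in>T. influence 4 (Y t) k * \<beta> t)\<^sup>2)"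
    proof (rule sum_mono)
      fix k
      let ?u = "\<Sum>s\<in>T. influence 4 (X s) k * \<alpha> s" and ?v = "\<Sum>t\<in>T. influence 4 (Y t) k * \<beta> t"
      have "(influence 2 F k)\<^sup>2 \<le> (?u + ?v)\<^sup>2" by (intro power_mono infl influence_nonneg) simp
      also have "\<dots> \<le> 2 * ?u\<^sup>2 + 2 * ?v\<^sup>2"
        using sum_squares_bound[of ?u ?v] by (simp add: power2_sum)
      finally show "(influence 2 F k)\<^sup>2 \<le> 2 * ?u\<^sup>2 + 2 * ?v\<^sup>2" .
    qed
    also have "\<dots> = 2 * (\<Sum>k\<in>J. (\<Sum>s\<in>T. influence 4 (X s) k * \<alpha> s)\<^sup>2) + 2 * (\<Sum>k\<in>J. (\<Sum>t\<in>T. influence 4 (Y t) k * \<beta> t)\<^sup>2)"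
      by (simp add: sum.distrib sum_distrib_left)
    also have "\<dots> \<le> 2 * (\<Theta>\<^sup>2 * (\<Sum>s\<in>T. (\<alpha> s)\<^sup>2)) + 2 * (\<Xi>\<^sup>2 * (\<Sum>t\<in>T. (\<beta> t)\<^sup>2))"
      by (intro add_mono mult_left_mono coupling_bound_schur[OF X J] coupling_bound_schur[OF Y J]) auto
    also have "(\<Sum>s\<in>T. (\<alpha> s)\<^sup>2) = 4 * (\<Xi>\<^sup>2 * ?A)"
      by (simp add: \<alpha>_def power_mult_distrib sum_nonneg sum_distrib_left mult.assoc)
    also have "(\<Sum>t\<in>T. (\<beta> t)\<^sup>2) = 4 * (\<Theta>\<^sup>2 * (\<Sum>t\<in>T. \<Sum>s\<in>T. (a s t)\<^sup>2))"
      by (simp add: \<beta>_def power_mult_distrib sum_nonneg sum_distrib_left mult.assoc)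
    also have "(\<Sum>t\<in>T. \<Sum>s\<in>T. (a s t)\<^sup>2) = ?A" by (rule sum.swap)
    finally show ?thesis by (simp add: mult_ac)
  qed
  have "(norm_Lp P 2 (\<lambda>x. F x - (LINT x|P. F x)))\<^sup>2 \<le> 4 * (16 * (\<Theta>\<^sup>2 * \<Xi>\<^sup>2 * ?A))"
    by (rule norm_centered_le[OF _ F bound]) auto
  also have "\<dots> = (8 * \<Theta> * \<Xi> * sqrt ?A)\<^sup>2"
    using A by (simp add: power_mult_distrib)
  finally show "norm_Lp P 2 (\<lambda>x. F x - (LINT x|P. F x)) \<le> 8 * \<Theta> * \<Xi> * sqrt ?A"
    by (rule power2_le_imp_le) (use A \<Theta> \<Xi> in simp)
qed

end

section \<open>Stein's method for off-diagonal quadratic forms\<close>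

lemma norm_integral_le:
  fixes f :: "'a \<Rightarrow> 'b :: {banach, second_countable_topology}"
  assumes "integrable M f" "integrable M g" "\<And>x. norm (f x) \<le> g x"
  shows "norm (\<integral>x. f x \<partial>M) \<le> (\<integral>x. g x \<partial>M)"
  by (rule order.trans[OF integral_norm_bound integral_mono]) (use assms in auto)

lemma iexp_linear_approx: "cmod (iexp x - 1 - \<i> * x) \<le> x\<^sup>2 / 2"
  using iexp_approx1[of x 1] by (simp add: power2_eq_square algebra_simps)

lemma iexp_diff_le: "cmod (iexp x - iexp y) \<le> \<bar>x - y\<bar>"
proof -
  have "iexp x - iexp y = iexp y * (iexp (x - y) - 1)"
    by (simp add: algebra_simps flip: exp_add)
  moreover have "cmod (iexp (x - y) - 1) \<le> \<bar>x - y\<bar>" using iexp_approx1[of "x - y" 0] by simp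
  ultimately show ?thesis by (simp add: norm_mult)
qed

text \<open>The integrating factor \<open>exp (u\<^sup>2 * v / 2)\<close> turns the approximate
  equation into a bound on the derivative of \<open>\<psi>\<close>. On the segment from 0 to
  \<open>l\<close> the factor is largest at \<open>l\<close>, so it cancels when it is divided out
  again.\<close>

lemma gaussian_ode_bound:
  fixes \<phi> \<phi>' :: "real \<Rightarrow> complex"
  assumes deriv: "\<And>u. (\<phi> has_vector_derivative \<phi>' u) (at u)" and init: "\<phi> 0 = 1" and v: "0 \<le> v"
    and bound: "\<And>u. \<bar>u\<bar> \<le> \<bar>l\<bar> \<Longrightarrow> cmod (\<phi>' u + (u * v) *\<^sub>R \<phi> u) \<le> e"
  shows "cmod (\<phi> l - exp (- (l\<^sup>2 * v / 2))) \<le> \<bar>l\<bar> * e"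
proof -
  define \<psi> where "\<psi> u = exp (u\<^sup>2 * v / 2) *\<^sub>R \<phi> u" for u :: real
  define \<psi>' where "\<psi>' u = exp (u\<^sup>2 * v / 2) *\<^sub>R (\<phi>' u + (u * v) *\<^sub>R \<phi> u)" for u :: real
  have d: "(\<psi> has_vector_derivative \<psi>' u) (at u)" for u
    unfolding \<psi>_def \<psi>'_def
    by (rule derivative_eq_intros has_vector_derivative_scaleR deriv refl | simp add: algebra_simps)+
  have e: "0 \<le> e" using order.trans[OF norm_ge_zero bound[of 0]] by simp
  have "norm (\<psi> l - \<psi> 0) \<le> exp (l\<^sup>2 * v / 2) * e * norm (l - 0)"
  proof (rule differentiable_bound)
    show "convex (closed_segment 0 l)" by simp
    fix u assume u: "u \<in> closed_segment 0 l"
    show "(\<psi> has_derivative (\<lambda>h. h *\<^sub>R \<psi>' u)) (at u within closed_segment 0 l)"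
      using d[of u] by (simp add: has_vector_derivative_def has_derivative_at_withinI)
    have ul: "\<bar>u\<bar> \<le> \<bar>l\<bar>" using u by (auto simp: closed_segment_eq_real_ivl split: if_splits)
    have "norm (\<psi>' u) \<le> exp (l\<^sup>2 * v / 2) * e"
      unfolding \<psi>'_def norm_scaleR
      using ul v abs_le_square_iff[of u l] by (intro mult_mono bound) (auto intro!: mult_right_mono)
    then show "onorm (\<lambda>h. h *\<^sub>R \<psi>' u) \<le> exp (l\<^sup>2 * v / 2) * e"
      by (intro onorm_le) (simp add: mult.commute mult_left_mono)
  qed auto
  then have 1: "cmod (\<psi> l - 1) \<le> exp (l\<^sup>2 * v / 2) * (\<bar>l\<bar> * e)"
    by (simp add: \<psi>_def init mult_ac)
  have "\<phi> l - exp (- (l\<^sup>2 * v / 2)) = exp (- (l\<^sup>2 * v / 2)) *\<^sub>R (\<psi> l - 1)"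
    by (simp add: \<psi>_def scaleR_diff_right flip: exp_add) (simp add: scaleR_conv_of_real exp_of_real)
  then have "cmod (\<phi> l - exp (- (l\<^sup>2 * v / 2))) = exp (- (l\<^sup>2 * v / 2)) * cmod (\<psi> l - 1)"
    by simp
  also have "\<dots> \<le> exp (- (l\<^sup>2 * v / 2)) * (exp (l\<^sup>2 * v / 2) * (\<bar>l\<bar> * e))"
    using 1 by (rule mult_left_mono) simp
  also have "\<dots> = \<bar>l\<bar> * e" by (simp add: exp_minus)
  finally show ?thesis .
qed

lemma (in prob_space) integrable_iexp_mult:
  assumes [measurable]: "T \<in> borel_measurable M" and F: "integrable M (F :: 'a \<Rightarrow> complex)"
  shows "integrable M (\<lambda>x. F x * iexp (T x))"
  using F borel_measurable_integrable[OF F] by (rule_tac Bochner_Integration.integrable_bound) (auto simp: norm_mult)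

lemma (in prob_space) char_fun_has_derivative:
  assumes T: "in_Lp M 2 T"
  shows "((\<lambda>u. CLINT x|M. iexp (u * T x)) has_vector_derivative (CLINT x|M. \<i> * T x * iexp (u * T x))) (at u)"
proof -
  note [measurable] = in_LpD[OF T]
  have iT: "integrable M T" by (rule integrable_Lp[OF _ _ T]) auto
  have iT2: "integrable M (\<lambda>x. (T x)\<^sup>2)" using T by (simp add: in_Lp_def)
  let ?\<phi> = "\<lambda>u. CLINT x|M. iexp (u * T x)" and ?D = "CLINT x|M. \<i> * T x * iexp (u * T x)"
  define C where "C = (LINT x|M. (T x)\<^sup>2)"
  have ie: "integrable M (\<lambda>x. iexp (u * T x))" for u
    using integrable_iexp_mult[of "\<lambda>x. u * T x" "\<lambda>x. 1"] by simp
  have iD: "integrable M (\<lambda>x. \<i> * T x * iexp (u * T x))" for u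
    using iT by (intro integrable_iexp_mult) auto
  have bd: "cmod (?\<phi> (u + h) - ?\<phi> u - h *\<^sub>R ?D) \<le> h\<^sup>2 * C" for h
  proof -
    have "?\<phi> (u + h) - ?\<phi> u - h *\<^sub>R ?D
        = (CLINT x|M. iexp ((u + h) * T x) - iexp (u * T x) - h *\<^sub>R (\<i> * T x * iexp (u * T x)))"
      by (simp only: Bochner_Integration.integral_diff[OF Bochner_Integration.integrable_diff[OF ie ie] integrable_scaleR_right[OF iD]]
          Bochner_Integration.integral_diff[OF ie ie] integral_scaleR_right)
    also have "\<dots> = (CLINT x|M. iexp (u * T x) * (iexp (h * T x) - 1 - \<i> * (h * T x)))"
      by (intro Bochner_Integration.integral_cong refl)
         (simp add: algebra_simps scaleR_conv_of_real flip: exp_add)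
    also have "cmod \<dots> \<le> (LINT x|M. h\<^sup>2 * (T x)\<^sup>2)"
    proof (rule norm_integral_le)
      show "integrable M (\<lambda>x. iexp (u * T x) * (iexp (h * T x) - 1 - \<i> * (h * T x)))"
      proof (rule Bochner_Integration.integrable_bound)
        show "integrable M (\<lambda>x. h\<^sup>2 * (T x)\<^sup>2)" using iT2 by simp
        show "AE x in M. norm (iexp (u * T x) * (iexp (h * T x) - 1 - \<i> * (h * T x))) \<le> norm (h\<^sup>2 * (T x)\<^sup>2)"
        proof (rule AE_I2)
          fix x
          have "cmod (iexp (h * T x) - 1 - \<i> * (h * T x)) \<le> (h * T x)\<^sup>2"
            by (rule order.trans[OF iexp_linear_approx]) (use zero_le_power2[of "h * T x"] in linarith)
          then show "norm (iexp (u * T x) * (iexp (h * T x) - 1 - \<i> * (h * T x))) \<le> norm (h\<^sup>2 * (T x)\<^sup>2)"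
            by (simp add: norm_mult power_mult_distrib)
        qed
      qed measurable
      show "integrable M (\<lambda>x. h\<^sup>2 * (T x)\<^sup>2)" using iT2 by simp
      show "norm (iexp (u * T x) * (iexp (h * T x) - 1 - \<i> * (h * T x))) \<le> h\<^sup>2 * (T x)\<^sup>2" for x
      proof -
        have "cmod (iexp (h * T x) - 1 - \<i> * (h * T x)) \<le> (h * T x)\<^sup>2"
          by (rule order.trans[OF iexp_linear_approx]) (use zero_le_power2[of "h * T x"] in linarith)
        then show ?thesis by (simp add: norm_mult power_mult_distrib)
      qed
    qed
    finally show ?thesis by (simp add: C_def)
  qed
  show ?thesis
    unfolding has_vector_derivative_def has_derivative_iff_norm
  proof (intro conjI)
    show "bounded_linear (\<lambda>h. h *\<^sub>R ?D)" by (rule bounded_linear_scaleR_left)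
    show "((\<lambda>y. norm (?\<phi> y - ?\<phi> u - (y - u) *\<^sub>R ?D) / norm (y - u)) \<longlongrightarrow> 0) (at u)"
    proof (rule Lim_null_comparison)
      show "\<forall>\<^sub>F y in at u. norm (norm (?\<phi> y - ?\<phi> u - (y - u) *\<^sub>R ?D) / norm (y - u)) \<le> \<bar>y - u\<bar> * C"
      proof (intro always_eventually allI)
        fix y
        show "norm (norm (?\<phi> y - ?\<phi> u - (y - u) *\<^sub>R ?D) / norm (y - u)) \<le> \<bar>y - u\<bar> * C"
        proof (cases "y = u")
          case False
          have "cmod (?\<phi> y - ?\<phi> u - (y - u) *\<^sub>R ?D) \<le> (y - u)\<^sup>2 * C" using bd[of "y - u"] by simp
          also have "(y - u)\<^sup>2 = \<bar>y - u\<bar> * \<bar>y - u\<bar>" by (simp add: power2_eq_square)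
          finally have "cmod (?\<phi> y - ?\<phi> u - (y - u) *\<^sub>R ?D) \<le> (\<bar>y - u\<bar> * C) * \<bar>y - u\<bar>"
            by (simp only: mult_ac)
          then have "cmod (?\<phi> y - ?\<phi> u - (y - u) *\<^sub>R ?D) / \<bar>y - u\<bar> \<le> \<bar>y - u\<bar> * C"
            using False by (subst pos_divide_le_eq) auto
          then show ?thesis by (simp only: real_norm_def abs_divide abs_norm_cancel abs_idempotent)
        qed simp
      qed
      have "((\<lambda>y. \<bar>y - u\<bar> * C) \<longlongrightarrow> \<bar>u - u\<bar> * C) (at u)" by (intro tendsto_intros)
      then show "((\<lambda>y. \<bar>y - u\<bar> * C) \<longlongrightarrow> 0) (at u)" by simp
    qed
  qed
qed

context iid_space
begin

text \<open>Tikhomirov's form of Stein's method: the contribution of one block to \<open>\<phi>'\<close>.\<close>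

lemma stein_step:
  fixes W V Tm :: "(int \<Rightarrow> 's) \<Rightarrow> real"
  assumes W: "W \<in> borel_measurable P" "\<And>x. \<bar>W x\<bar> \<le> B" "dep_on A W"
    and EW: "(LINT x|P. W x) = 0" "(LINT x|P. (W x)\<^sup>2) = s"
    and V: "V \<in> borel_measurable P" "\<And>x. \<bar>V x\<bar> \<le> C" "dep_on (- A) V"
    and Tm: "Tm \<in> borel_measurable P" "dep_on (- A) Tm"
  defines "T \<equiv> \<lambda>x. Tm x + 2 * (W x * V x)"
  shows "cmod ((CLINT x|P. W x * V x * iexp (u * T x)) - 2 * \<i> * u * s * (CLINT x|P. (V x)\<^sup>2 * iexp (u * T x)))
      \<le> 6 * u\<^sup>2 * B ^ 3 * (LINT x|P. \<bar>V x\<bar> ^ 3)"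
proof -
  note [measurable] = W(1) V(1) Tm(1)
  have [measurable]: "T \<in> borel_measurable P" unfolding T_def by measurable
  have B0: "0 \<le> B" using W(2)[of undefined] by linarith
  have C0: "0 \<le> C" using V(2)[of undefined] by linarith
  have s: "\<bar>s\<bar> \<le> B\<^sup>2"
  proof -
    have W2: "(W x)\<^sup>2 \<le> B\<^sup>2" for x using W(2)[of x] B0 by (simp add: abs_le_square_iff[symmetric])
    have "integrable P (\<lambda>x. (W x)\<^sup>2)"
      by (rule P.integrable_const_bound[of _ "B\<^sup>2"]) (use W2 in auto)
    from integral_mono[OF this P.integrable_const W2] have "s \<le> B\<^sup>2" using EW(2) by (simp add: P.prob_space)
    moreover have "0 \<le> s" unfolding EW(2)[symmetric] by (intro integral_nonneg_AE) auto
    ultimately show ?thesis by simp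
  qed
  define em e where "em x = iexp (u * Tm x)" and "e x = iexp (u * T x)" for x
  have [measurable]: "em \<in> borel_measurable P" "e \<in> borel_measurable P"
    unfolding em_def[abs_def] e_def[abs_def] by measurable
  have nem: "cmod (em x) = 1" "cmod (e x) = 1" for x by (simp_all add: em_def e_def)
  have dep_em: "dep_on (- A) (\<lambda>x. V x * em x)" "dep_on (- A) (\<lambda>x. (V x)\<^sup>2 * em x)"
    unfolding em_def using V(3) Tm(2) unfolding dep_on_def by metis+
  have iW1: "integrable P W" by (rule P.integrable_const_bound[of _ B]) (use W(2) in auto)
  have iW2: "integrable P (\<lambda>x. (W x)\<^sup>2)"
    by (rule P.integrable_const_bound[of _ "B\<^sup>2"]) (use W(2) B0 in \<open>auto simp: abs_le_square_iff[symmetric]\<close>)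
  have V2: "(V x)\<^sup>2 \<le> C\<^sup>2" for x using V(2)[of x] C0 by (simp add: abs_le_square_iff[symmetric])
  have iV1: "integrable P (\<lambda>x. V x * em x)"
    by (rule P.integrable_const_bound[of _ C]) (use V(2) in \<open>auto simp: norm_mult nem\<close>)
  have iV2: "integrable P (\<lambda>x. (V x)\<^sup>2 * em x)"
    by (rule P.integrable_const_bound[of _ "C\<^sup>2"]) (use V2 in \<open>auto simp: norm_mult norm_power nem\<close>)
  have iV3: "integrable P (\<lambda>x. (V x)\<^sup>2 * e x)"
    by (rule P.integrable_const_bound[of _ "C\<^sup>2"]) (use V2 in \<open>auto simp: norm_mult norm_power nem\<close>)
  note i1 = integral_indep_scaleR[OF iW1 W(3) iV1 dep_em(1)]
  note i2 = integral_indep_scaleR[OF iW2 dep_on_comp[OF W(3)] iV2 dep_em(2)]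
  have WV: "\<bar>W x * V x\<bar> \<le> B * C" for x unfolding abs_mult using W(2) V(2) B0 by (intro mult_mono) auto
  have iWVe: "integrable P (\<lambda>x. W x * V x * e x)"
    by (rule P.integrable_const_bound[of _ "B * C"]) (use WV in \<open>auto simp: norm_mult nem abs_mult\<close>)
  have lin: "(CLINT x|P. f1 x) - c2 * (CLINT x|P. f2 x) - (CLINT x|P. f3 x) - c4 * (CLINT x|P. f4 x) + c5 * (CLINT x|P. f5 x)
      = (CLINT x|P. f1 x - c2 * f2 x - f3 x - c4 * f4 x + c5 * f5 x)"
    if "integrable P f1" "integrable P f2" "integrable P f3" "integrable P f4" "integrable P f5"
    for f1 f2 f3 f4 f5 :: "(int \<Rightarrow> 's) \<Rightarrow> complex" and c2 c4 c5
    using that by simp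
  \<comment> \<open>\<open>em\<close> is the exponential without the contribution of
    \<open>W\<close>. By independence the mean of \<open>W * V * em\<close> vanishes and that of
    \<open>W\<^sup>2 * V\<^sup>2 * em\<close> is \<open>s\<close> times that of
    \<open>V\<^sup>2 * em\<close>. Subtracting the first-order expansion of \<open>e\<close> around
    \<open>em\<close> therefore leaves only the third-order remainder \<open>?R\<close>.\<close>
  let ?R = "\<lambda>x. W x * V x * (e x - em x - 2 * \<i> * u * (W x * V x) * em x) + 2 * \<i> * u * s * (V x)\<^sup>2 * (em x - e x)"
  have "(CLINT x|P. W x * V x * e x) - 2 * \<i> * u * s * (CLINT x|P. (V x)\<^sup>2 * e x)
      = (CLINT x|P. W x * V x * e x) - 2 * \<i> * u * s * (CLINT x|P. (V x)\<^sup>2 * e x)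
        - (CLINT x|P. W x *\<^sub>R (V x * em x)) - 2 * \<i> * u * (CLINT x|P. (W x)\<^sup>2 *\<^sub>R ((V x)\<^sup>2 * em x))
        + 2 * \<i> * u * s * (CLINT x|P. (V x)\<^sup>2 * em x)"
    unfolding i1(2) i2(2) EW by (simp add: scaleR_conv_of_real)
  also have "\<dots> = (CLINT x|P. W x * V x * e x - 2 * \<i> * u * s * ((V x)\<^sup>2 * e x)
        - W x *\<^sub>R (V x * em x) - 2 * \<i> * u * ((W x)\<^sup>2 *\<^sub>R ((V x)\<^sup>2 * em x)) + 2 * \<i> * u * s * ((V x)\<^sup>2 * em x))"
    by (rule lin[OF iWVe iV3 i1(1) i2(1) iV2])
  also have "\<dots> = (CLINT x|P. ?R x)"
    by (intro Bochner_Integration.integral_cong refl) (simp add: scaleR_conv_of_real power2_eq_square algebra_simps)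
  also have "cmod \<dots> \<le> (LINT x|P. 6 * u\<^sup>2 * B ^ 3 * \<bar>V x\<bar> ^ 3)"
  proof -
    have le: "cmod (?R x) \<le> 6 * u\<^sup>2 * B ^ 3 * \<bar>V x\<bar> ^ 3" for x
    proof -
      have e_eq: "e x = em x * iexp (2 * u * (W x * V x))"
        unfolding e_def em_def T_def by (simp add: algebra_simps flip: exp_add)
      have "e x - em x - 2 * \<i> * u * (W x * V x) * em x
          = em x * (iexp (2 * u * (W x * V x)) - 1 - \<i> * (2 * u * (W x * V x)))"
        unfolding e_eq by (simp add: algebra_simps)
      then have 1: "cmod (e x - em x - 2 * \<i> * u * (W x * V x) * em x) \<le> (2 * u * (W x * V x))\<^sup>2 / 2"
        using iexp_linear_approx[of "2 * u * (W x * V x)"] by (simp add: norm_mult nem)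
      have 2: "cmod (em x - e x) \<le> \<bar>2 * u * (W x * V x)\<bar>"
        using iexp_diff_le[of "u * Tm x" "u * T x"] by (simp add: em_def e_def T_def algebra_simps abs_mult)
      \<comment> \<open>The final 6 is 2 + 4: the 2 comes from the second-order Taylor remainder,
        the 4 from exchanging \<open>em\<close> for \<open>e\<close> in the variance term, where
        \<open>s\<close> is at most \<open>B\<^sup>2\<close>.\<close>
      have "cmod (?R x) \<le> \<bar>W x * V x\<bar> * ((2 * u * (W x * V x))\<^sup>2 / 2) + 2 * \<bar>u\<bar> * \<bar>s\<bar> * (V x)\<^sup>2 * \<bar>2 * u * (W x * V x)\<bar>"
      proof (rule order.trans[OF norm_triangle_ineq add_mono])
        show "cmod (W x * V x * (e x - em x - 2 * \<i> * u * (W x * V x) * em x)) \<le> \<bar>W x * V x\<bar> * ((2 * u * (W x * V x))\<^sup>2 / 2)"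
          using mult_left_mono[OF 1, of "\<bar>W x * V x\<bar>"] by (simp only: norm_mult norm_of_real abs_mult abs_ge_zero mult_nonneg_nonneg)
        have "cmod (2 * \<i> * u * s * (V x)\<^sup>2 * (em x - e x)) = 2 * \<bar>u\<bar> * \<bar>s\<bar> * (V x)\<^sup>2 * cmod (em x - e x)"
          by (simp add: norm_mult norm_power)
        also have "\<dots> \<le> 2 * \<bar>u\<bar> * \<bar>s\<bar> * (V x)\<^sup>2 * \<bar>2 * u * (W x * V x)\<bar>"
          by (intro mult_left_mono 2) simp
        finally show "cmod (2 * \<i> * u * s * (V x)\<^sup>2 * (em x - e x)) \<le> 2 * \<bar>u\<bar> * \<bar>s\<bar> * (V x)\<^sup>2 * \<bar>2 * u * (W x * V x)\<bar>" .
      qed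
      also have "\<dots> = 2 * u\<^sup>2 * (\<bar>W x\<bar> ^ 3 * \<bar>V x\<bar> ^ 3) + 4 * u\<^sup>2 * (\<bar>s\<bar> * \<bar>W x\<bar> * \<bar>V x\<bar> ^ 3)"
      proof -
        have *: "w * v * ((2 * r * (w * v))\<^sup>2 / 2) + 2 * r * c * v\<^sup>2 * (2 * r * (w * v))
            = 2 * r\<^sup>2 * (w ^ 3 * v ^ 3) + 4 * r\<^sup>2 * (c * w * v ^ 3)" for w v r c :: real
          by (simp add: power2_eq_square power3_eq_cube)
        show ?thesis
          using *[of "\<bar>W x\<bar>" "\<bar>V x\<bar>" "\<bar>u\<bar>" "\<bar>s\<bar>"] by (simp add: abs_mult power_mult_distrib)
      qed
      also have "\<dots> \<le> 2 * u\<^sup>2 * (B ^ 3 * \<bar>V x\<bar> ^ 3) + 4 * u\<^sup>2 * (B\<^sup>2 * B * \<bar>V x\<bar> ^ 3)"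
        using W(2)[of x] s B0 by (intro add_mono mult_left_mono mult_right_mono mult_mono power_mono) auto
      also have "\<dots> = 6 * u\<^sup>2 * B ^ 3 * \<bar>V x\<bar> ^ 3" by (simp add: power2_eq_square power3_eq_cube)
      finally show ?thesis .
    qed
    have iR: "integrable P (\<lambda>x. 6 * u\<^sup>2 * B ^ 3 * \<bar>V x\<bar> ^ 3)"
      using V(2) by (intro integrable_mult_right P.integrable_const_bound[of _ "C ^ 3"]) (auto intro!: power_mono)
    show ?thesis
    proof (rule norm_integral_le[OF _ iR le])
      show "integrable P ?R"
        by (rule Bochner_Integration.integrable_bound[OF iR]) (use le B0 in \<open>auto simp: abs_mult\<close>)
    qed
  qed
  also have "\<dots> = 6 * u\<^sup>2 * B ^ 3 * (LINT x|P. \<bar>V x\<bar> ^ 3)" by simp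
  finally show ?thesis unfolding e_def .
qed


text \<open>The derivative of the characteristic function is \<open>\<i>\<close> times the sum of
  the means of \<open>W i * V i * iexp (u * T)\<close>. \<open>stein_step\<close> replaces each
  \<open>W i * V i\<close> by \<open>2 * \<i> * u * s * (V i)\<^sup>2\<close>, and the sum of the
  \<open>(V i)\<^sup>2\<close> concentrates at its mean \<open>s * K\<close>; this yields the
  variance \<open>2 * s\<^sup>2 * K\<close>. Both errors carry the factor \<open>\<rho>\<close>: the
  third moments of \<open>V i\<close>, and the Frobenius norm of the kernel of the sum of
  squares.\<close>

lemma quadratic_form_char_bound:
  fixes W :: "'i \<Rightarrow> (int \<Rightarrow> 's) \<Rightarrow> real" and c :: "'i \<Rightarrow> 'i \<Rightarrow> real"
  assumes cb: "coupling_bound I W \<Theta>"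
    and bounded: "\<And>i x. i \<in> I \<Longrightarrow> \<bar>W i x\<bar> \<le> B"
    and dep: "\<And>i. i \<in> I \<Longrightarrow> dep_on (A i) (W i)"
    and disj: "\<And>i j. i \<in> I \<Longrightarrow> j \<in> I \<Longrightarrow> i \<noteq> j \<Longrightarrow> A i \<inter> A j = {}"
    and var: "\<And>i. i \<in> I \<Longrightarrow> (LINT x|P. (W i x)\<^sup>2) = s"
    and sym: "\<And>i j. i \<in> I \<Longrightarrow> j \<in> I \<Longrightarrow> c i j = c j i" and diag: "\<And>i. i \<in> I \<Longrightarrow> c i i = 0"
    and op: "\<And>z. (\<Sum>i\<in>I. (\<Sum>j\<in>I. c i j * z j)\<^sup>2) \<le> \<rho>\<^sup>2 * (\<Sum>i\<in>I. (z i)\<^sup>2)" and \<rho>: "0 < \<rho>"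
  defines "T \<equiv> \<lambda>x. \<Sum>i\<in>I. \<Sum>j\<in>I. c i j * (W i x * W j x)"
    and "K \<equiv> \<Sum>i\<in>I. \<Sum>j\<in>I. (c i j)\<^sup>2"
  assumes s0: "0 \<le> s" and B0: "0 \<le> B"
  shows "cmod ((CLINT x|P. iexp (l * T x)) - exp (- (l\<^sup>2 * (2 * s\<^sup>2 * K) / 2)))
      \<le> \<bar>l\<bar> * (\<rho> * (6 * l\<^sup>2 * B ^ 3 * (K * (2 * \<Theta>\<^sup>2 + 8 * \<Theta> ^ 4)) + 16 * \<bar>l\<bar> * s * (\<Theta>\<^sup>2 * sqrt K)))"
proof -
  note D = coupling_boundD[OF cb]
  note [simp] = D(1)
  have W [measurable]: "W i \<in> borel_measurable P" if "i \<in> I" for i using in_LpD[OF D(2)[OF that]] .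
  have K0: "0 \<le> K" unfolding K_def by (intro sum_nonneg) auto
  define V where "V i x = (\<Sum>j\<in>I. c i j * W j x)" for i x
  define Tm where "Tm i x = (\<Sum>j\<in>I - {i}. \<Sum>k\<in>I - {i}. c j k * (W j x * W k x))" for i x
  define r where "r i = (\<Sum>j\<in>I. (c i j)\<^sup>2)" for i
  have V [measurable]: "V i \<in> borel_measurable P" for i unfolding V_def[abs_def] by measurable
  have T [measurable]: "T \<in> borel_measurable P" unfolding T_def by measurable
  have Tm [measurable]: "Tm i \<in> borel_measurable P" for i unfolding Tm_def[abs_def] by measurable
  have V4: "in_Lp P 4 (V i)" for i
    unfolding V_def[abs_def] using D by (intro in_Lp_sum in_Lp_cmult) auto
  have T2: "in_Lp P 2 T"
    unfolding T_def by (rule norm_quadratic_form(1)[OF cb cb])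
  have Vb: "\<bar>V i x\<bar> \<le> (\<Sum>j\<in>I. \<bar>c i j\<bar> * B)" for i x
    unfolding V_def by (rule order.trans[OF sum_abs]) (auto simp: abs_mult intro!: sum_mono mult_left_mono bounded)
  have dep': "dep_on (- A i) (W j)" if "i \<in> I" "j \<in> I" "i \<noteq> j" for i j
    using dep_on_mono[OF dep[OF that(2)]] disj[OF that] by blast
  have depV: "dep_on (- A i) (V i)" if i: "i \<in> I" for i
  proof -
    have "V i = (\<lambda>x. \<Sum>j\<in>I - {i}. c i j * W j x)"
      using i by (auto simp: V_def fun_eq_iff sum.remove[OF _ i] diag)
    then show ?thesis using i by (auto intro!: dep_on_sum dep_on_comp[where h = "(*) _"] dep')
  qed
  have depTm: "dep_on (- A i) (Tm i)" if i: "i \<in> I" for i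
    unfolding Tm_def[abs_def]
    using i by (intro dep_on_sum dep_on_comp[where h = "(*) _"] dep_on_comp2[where h = "(*)"] dep') auto
  have TV: "T x = (\<Sum>i\<in>I. W i x * V i x)" for x
    by (simp add: T_def V_def sum_distrib_left mult_ac)
  \<comment> \<open>By symmetry of \<open>c\<close>, block \<open>i\<close> enters equally from the
    left and from the right, whence the 2; the zero diagonal excludes a term in
    \<open>(W i)\<^sup>2\<close>.\<close>
  have T_split: "T x = Tm i x + 2 * (W i x * V i x)" if i: "i \<in> I" for i x
  proof -
    have "T x = W i x * V i x + (\<Sum>j\<in>I - {i}. W j x * V j x)"
      unfolding TV by (rule sum.remove) (use i in auto)
    also have "(\<Sum>j\<in>I - {i}. W j x * V j x) = (\<Sum>j\<in>I - {i}. c i j * (W j x * W i x) + (\<Sum>k\<in>I - {i}. c j k * (W j x * W k x)))"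
    proof (rule sum.cong[OF refl])
      fix j assume j: "j \<in> I - {i}"
      have "V j x = c j i * W i x + (\<Sum>k\<in>I - {i}. c j k * W k x)"
        unfolding V_def by (rule sum.remove) (use i in auto)
      then show "W j x * V j x = c i j * (W j x * W i x) + (\<Sum>k\<in>I - {i}. c j k * (W j x * W k x))"
        using j i sym[of i j] by (simp add: distrib_left sum_distrib_left mult_ac)
    qed
    also have "\<dots> = (\<Sum>j\<in>I - {i}. c i j * (W j x * W i x)) + Tm i x"
      by (simp add: sum.distrib Tm_def)
    also have "(\<Sum>j\<in>I - {i}. c i j * (W j x * W i x)) = W i x * V i x"
      using i by (simp add: V_def sum.remove[OF _ i] diag sum_distrib_left mult_ac)
    finally show ?thesis by simp
  qed
  have cov: "(LINT x|P. W j x * W k x) = (if j = k then s else 0)" if jk: "j \<in> I" "k \<in> I" for j k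
  proof (cases "j = k")
    case True then show ?thesis using var[OF jk(1)] by (simp add: power2_eq_square)
  next
    case False
    have "(LINT x|P. W j x *\<^sub>R W k x) = (LINT x|P. W j x) *\<^sub>R (LINT x|P. W k x)"
      by (rule integral_indep_scaleR(2)[OF P.integrable_Lp[OF _ _ D(2)] dep P.integrable_Lp[OF _ _ D(2)] dep'])
         (use jk False in auto)
    then show ?thesis using False D(3) jk by simp
  qed
  \<comment> \<open>The kernel of the sum of the \<open>(V i)\<^sup>2\<close> as a quadratic form in
    \<open>W\<close>, so that the moment bound for quadratic forms controls its fluctuation.\<close>
  define a where "a j k = (\<Sum>i\<in>I. c i j * c i k)" for j k
  let ?S = "\<lambda>x. \<Sum>i\<in>I. (V i x)\<^sup>2"
  have S_eq: "?S x = (\<Sum>j\<in>I. \<Sum>k\<in>I. a j k * (W j x * W k x))" for x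
  proof -
    have "?S x = (\<Sum>i\<in>I. \<Sum>j\<in>I. \<Sum>k\<in>I. c i j * c i k * (W j x * W k x))"
      by (simp add: V_def power2_eq_square sum_product mult_ac)
    also have "\<dots> = (\<Sum>j\<in>I. \<Sum>i\<in>I. \<Sum>k\<in>I. c i j * c i k * (W j x * W k x))" by (rule sum.swap)
    also have "\<dots> = (\<Sum>j\<in>I. \<Sum>k\<in>I. \<Sum>i\<in>I. c i j * c i k * (W j x * W k x))"
      by (intro sum.cong refl sum.swap)
    finally show ?thesis by (simp add: a_def sum_distrib_right)
  qed
  have ES: "(LINT x|P. ?S x) = s * K"
  proof -
    have i: "integrable P (\<lambda>x. W j x * W k x)" if "j \<in> I" "k \<in> I" for j k
      by (rule P.integrable_Lp[OF _ _ norm_Lp_2_mult(1)[OF D(2) D(2)]]) (use that in auto)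
    have "(LINT x|P. ?S x) = (\<Sum>j\<in>I. \<Sum>k\<in>I. a j k * (LINT x|P. W j x * W k x))"
      unfolding S_eq using i by (simp add: Bochner_Integration.integral_sum Bochner_Integration.integrable_sum)
    also have "\<dots> = (\<Sum>j\<in>I. \<Sum>k\<in>I. if j = k then a j k * s else 0)"
      by (intro sum.cong refl) (simp add: cov)
    also have "\<dots> = (\<Sum>j\<in>I. a j j * s)" by (simp add: sum.delta')
    also have "\<dots> = s * (\<Sum>j\<in>I. \<Sum>i\<in>I. (c i j)\<^sup>2)"
      by (simp add: a_def power2_eq_square sum_distrib_right sum_distrib_left mult_ac)
    also have "(\<Sum>j\<in>I. \<Sum>i\<in>I. (c i j)\<^sup>2) = K" unfolding K_def by (rule sum.swap)
    finally show ?thesis .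
  qed
  \<comment> \<open>\<open>a\<close> is the product of \<open>c\<close> with itself; the operator
    bound is applied to each column of \<open>c\<close>.\<close>
  have a_le: "(\<Sum>j\<in>I. \<Sum>k\<in>I. (a j k)\<^sup>2) \<le> \<rho>\<^sup>2 * K"
  proof -
    have "(\<Sum>j\<in>I. \<Sum>k\<in>I. (a j k)\<^sup>2) = (\<Sum>k\<in>I. \<Sum>j\<in>I. (\<Sum>i\<in>I. c j i * c i k)\<^sup>2)"
      unfolding a_def by (subst sum.swap) (intro sum.cong refl arg_cong[where f = "\<lambda>x. x\<^sup>2"], simp add: sym)
    also have "\<dots> \<le> (\<Sum>k\<in>I. \<rho>\<^sup>2 * (\<Sum>i\<in>I. (c i k)\<^sup>2))"
      by (intro sum_mono op)
    also have "\<dots> = \<rho>\<^sup>2 * K" unfolding K_def sum_distrib_left[symmetric] by (rule arg_cong[OF sum.swap])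
    finally show ?thesis .
  qed
  have S_dev: "(LINT x|P. \<bar>?S x - s * K\<bar>) \<le> 8 * \<Theta>\<^sup>2 * (\<rho> * sqrt K)" and iS: "integrable P ?S"
  proof -
    have S2: "in_Lp P 2 ?S" unfolding S_eq by (rule norm_quadratic_form(1)[OF cb cb])
    show "integrable P ?S" by (rule P.integrable_Lp[OF _ _ S2]) auto
    have S3: "in_Lp P 2 (\<lambda>x. ?S x - s * K)" by (intro in_Lp_diff S2 P.in_Lp_const) auto
    have S4: "in_Lp P 2 (\<lambda>x. \<bar>?S x - s * K\<bar>)"
      by (rule in_Lp_mono[OF _ S3]) (use in_LpD[OF S3] in auto)
    have "(LINT x|P. \<bar>?S x - s * K\<bar>) \<le> norm_Lp P 2 (\<lambda>x. \<bar>?S x - s * K\<bar>)"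
      using P.abs_expectation_le_norm_Lp[OF _ _ S4] by auto
    also have "\<dots> = norm_Lp P 2 (\<lambda>x. ?S x - s * K)" by (simp add: norm_Lp_def)
    also have "\<dots> \<le> 8 * \<Theta> * \<Theta> * sqrt (\<Sum>j\<in>I. \<Sum>k\<in>I. (a j k)\<^sup>2)"
      using norm_quadratic_form(2)[OF cb cb, of a] by (simp add: S_eq[symmetric] ES)
    also have "\<dots> \<le> 8 * \<Theta> * \<Theta> * sqrt (\<rho>\<^sup>2 * K)"
      using coupling_bound_nonneg[OF cb] by (intro mult_left_mono real_sqrt_le_mono a_le) auto
    also have "\<dots> = 8 * \<Theta>\<^sup>2 * (\<rho> * sqrt K)"
      using \<rho> by (simp add: real_sqrt_mult power2_eq_square)
    finally show "(LINT x|P. \<bar>?S x - s * K\<bar>) \<le> 8 * \<Theta>\<^sup>2 * (\<rho> * sqrt K)" .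
  qed
  \<comment> \<open>The operator bound on a unit vector.\<close>
  have r_le: "r i \<le> \<rho>\<^sup>2" if i: "i \<in> I" for i
  proof -
    have "r i = (\<Sum>k\<in>I. (\<Sum>j\<in>I. c k j * (if j = i then 1 else 0))\<^sup>2)"
      using i by (simp add: r_def sym[of i] if_distrib[of "(*) _"] cong: if_cong)
    also have "\<dots> \<le> \<rho>\<^sup>2 * (\<Sum>j\<in>I. (if j = i then 1 else 0)\<^sup>2)" by (rule op)
    also have "(\<Sum>j\<in>I. (if j = i then 1 else 0::real)\<^sup>2) = 1" using i by (simp add: if_distrib[of "\<lambda>x. x\<^sup>2"] cong: if_cong)
    finally show ?thesis by simp
  qed
  have V3: "(LINT x|P. \<bar>V i x\<bar> ^ 3) \<le> \<rho> * r i * (2 * \<Theta>\<^sup>2 + 8 * \<Theta> ^ 4)" if i: "i \<in> I" for i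
  proof -
    have iV4: "integrable P (\<lambda>x. V i x ^ 4)" using V4 by (rule in_Lp_integrable)
    have V2: "in_Lp P 2 (V i)" by (rule P.in_Lp_2[OF V4])
    have iV2: "integrable P (\<lambda>x. (V i x)\<^sup>2)" using V2 by (rule in_Lp_integrable)
    have n: "(norm_Lp P 4 (V i))\<^sup>2 \<le> 4 * (\<Theta>\<^sup>2 * r i)"
      unfolding V_def[abs_def] r_def by (rule norm_linear_form[OF cb])
    have E2: "(LINT x|P. (V i x)\<^sup>2) \<le> 4 * (\<Theta>\<^sup>2 * r i)"
    proof -
      have "(LINT x|P. (V i x)\<^sup>2) = (norm_Lp P 2 (V i))\<^sup>2" by (rule norm_Lp_power[symmetric]) auto
      also have "\<dots> \<le> (norm_Lp P 4 (V i))\<^sup>2" by (intro power_mono P.norm_Lp_2_le V4) auto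
      finally show ?thesis using n by linarith
    qed
    have E4: "(LINT x|P. V i x ^ 4) \<le> 16 * (\<Theta> ^ 4 * (r i * \<rho>\<^sup>2))"
    proof -
      have "(LINT x|P. V i x ^ 4) = norm_Lp P 4 (V i) ^ 4" by (rule norm_Lp_power[symmetric]) auto
      also have "\<dots> = ((norm_Lp P 4 (V i))\<^sup>2)\<^sup>2" by simp
      also have "\<dots> \<le> (4 * (\<Theta>\<^sup>2 * r i))\<^sup>2" by (intro power_mono n) auto
      also have "\<dots> = 16 * (\<Theta> ^ 4 * (r i * r i))" by (simp add: power_mult_distrib power2_eq_square power4_eq_xxxx)
      also have "\<dots> \<le> 16 * (\<Theta> ^ 4 * (r i * \<rho>\<^sup>2))"
        using r_le[OF i] by (intro mult_left_mono) (auto simp: r_def sum_nonneg zero_le_even_power)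
      finally show ?thesis .
    qed
    \<comment> \<open>The third power is interpolated between the second and the fourth at scale
      \<open>\<rho>\<close>. Since the fourth moment is of order
      \<open>r i * \<rho>\<^sup>2\<close>, both terms gain a factor \<open>\<rho>\<close>.\<close>
    have le: "\<bar>V i x\<bar> ^ 3 \<le> \<rho> / 2 * (V i x)\<^sup>2 + 1 / (2 * \<rho>) * V i x ^ 4" for x
    proof -
      let ?v = "\<bar>V i x\<bar>"
      have "0 \<le> (\<rho> * ?v - ?v\<^sup>2)\<^sup>2" by simp
      then have "2 * \<rho> * ?v ^ 3 \<le> \<rho>\<^sup>2 * ?v\<^sup>2 + ?v ^ 4"
        unfolding power2_diff by (simp only: power_mult_distrib power2_eq_square power3_eq_cube power4_eq_xxxx) (simp add: algebra_simps)
      then have "?v ^ 3 \<le> \<rho> / 2 * ?v\<^sup>2 + 1 / (2 * \<rho>) * ?v ^ 4"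
        using \<rho> by (simp add: field_simps power2_eq_square)
      then show ?thesis by (simp add: power_even_abs)
    qed
    have "(LINT x|P. \<bar>V i x\<bar> ^ 3) \<le> (LINT x|P. \<rho> / 2 * (V i x)\<^sup>2 + 1 / (2 * \<rho>) * V i x ^ 4)"
    proof (rule integral_mono[OF _ _ le])
      show i24: "integrable P (\<lambda>x. \<rho> / 2 * (V i x)\<^sup>2 + 1 / (2 * \<rho>) * V i x ^ 4)"
        using iV2 iV4 by simp
      show "integrable P (\<lambda>x. \<bar>V i x\<bar> ^ 3)"
        by (rule Bochner_Integration.integrable_bound[OF i24])
           (use le in \<open>auto intro: order.trans[OF _ abs_ge_self]\<close>)
    qed
    also have "\<dots> = \<rho> / 2 * (LINT x|P. (V i x)\<^sup>2) + 1 / (2 * \<rho>) * (LINT x|P. V i x ^ 4)"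
      using iV2 iV4 by simp
    also have "\<dots> \<le> \<rho> / 2 * (4 * (\<Theta>\<^sup>2 * r i)) + 1 / (2 * \<rho>) * (16 * (\<Theta> ^ 4 * (r i * \<rho>\<^sup>2)))"
      using \<rho> by (intro add_mono mult_left_mono E2 E4) auto
    also have "\<dots> = \<rho> * r i * (2 * \<Theta>\<^sup>2 + 8 * \<Theta> ^ 4)"
      using \<rho> by (simp add: field_simps power2_eq_square)
    finally show ?thesis .
  qed
  have V3_sum: "(\<Sum>i\<in>I. LINT x|P. \<bar>V i x\<bar> ^ 3) \<le> \<rho> * (K * (2 * \<Theta>\<^sup>2 + 8 * \<Theta> ^ 4))"
  proof -
    have "(\<Sum>i\<in>I. LINT x|P. \<bar>V i x\<bar> ^ 3) \<le> (\<Sum>i\<in>I. \<rho> * r i * (2 * \<Theta>\<^sup>2 + 8 * \<Theta> ^ 4))"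
      by (intro sum_mono V3)
    then show ?thesis by (simp add: K_def r_def sum_distrib_left sum_distrib_right mult_ac)
  qed
  define \<phi> where "\<phi> u = (CLINT x|P. iexp (u * T x))" for u
  define \<phi>' where "\<phi>' u = (CLINT x|P. \<i> * T x * iexp (u * T x))" for u
  let ?e = "\<rho> * (6 * l\<^sup>2 * B ^ 3 * (K * (2 * \<Theta>\<^sup>2 + 8 * \<Theta> ^ 4)) + 16 * \<bar>l\<bar> * s * (\<Theta>\<^sup>2 * sqrt K))"
  have "cmod (\<phi> l - exp (- (l\<^sup>2 * (2 * s\<^sup>2 * K) / 2))) \<le> \<bar>l\<bar> * ?e"
  proof (rule gaussian_ode_bound)
    show "(\<phi> has_vector_derivative \<phi>' u) (at u)" for u
      unfolding \<phi>_def[abs_def] \<phi>'_def by (rule P.char_fun_has_derivative[OF T2])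
    show "\<phi> 0 = 1" by (simp add: \<phi>_def P.prob_space)
    show "0 \<le> 2 * s\<^sup>2 * K" using K0 by simp
    fix u :: real assume u: "\<bar>u\<bar> \<le> \<bar>l\<bar>"
    have iWV: "integrable P (\<lambda>x. complex_of_real (W i x * V i x))" if "i \<in> I" for i
      by (rule integrable_of_real[OF P.integrable_Lp[OF _ _ norm_Lp_2_mult(1)[OF D(2)[OF that] V4[of i]]]]) auto
    have iWVe: "integrable P (\<lambda>x. W i x * V i x * iexp (u * T x))" if "i \<in> I" for i
      using P.integrable_iexp_mult[OF _ iWV[OF that], of "\<lambda>x. u * T x"] by simp
    have iVV: "integrable P (\<lambda>x. complex_of_real ((V i x)\<^sup>2))" for i
      by (rule integrable_of_real[OF in_Lp_integrable[OF P.in_Lp_2[OF V4[of i]]]])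
    have iVVe: "integrable P (\<lambda>x. (V i x)\<^sup>2 * iexp (u * T x))" for i
      using P.integrable_iexp_mult[OF _ iVV, of "\<lambda>x. u * T x"] by simp
    have iSe: "integrable P (\<lambda>x. (?S x) * iexp (u * T x))"
      using P.integrable_iexp_mult[OF _ integrable_of_real[OF iS], of "\<lambda>x. u * T x"] by simp
    have ie: "integrable P (\<lambda>x. iexp (u * T x))"
      using P.integrable_iexp_mult[of "\<lambda>x. u * T x" "\<lambda>x. 1"] by simp
    define G where "G i = (CLINT x|P. W i x * V i x * iexp (u * T x))" for i
    define H where "H i = (CLINT x|P. (V i x)\<^sup>2 * iexp (u * T x))" for i
    have \<phi>'_eq: "\<phi>' u = \<i> * (\<Sum>i\<in>I. G i)"
    proof -
      have "\<phi>' u = (CLINT x|P. \<i> * (\<Sum>i\<in>I. W i x * V i x * iexp (u * T x)))"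
        unfolding \<phi>'_def
        by (intro Bochner_Integration.integral_cong refl) (simp add: TV sum_distrib_left sum_distrib_right mult_ac)
      also have "\<dots> = \<i> * (\<Sum>i\<in>I. G i)"
        unfolding G_def using iWVe by (subst integral_mult_right_zero) (subst Bochner_Integration.integral_sum, auto)
      finally show ?thesis .
    qed
    have H_sum: "(\<Sum>i\<in>I. H i) = (CLINT x|P. (?S x) * iexp (u * T x))"
      unfolding H_def using iVVe
      by (subst Bochner_Integration.integral_sum[symmetric]) (auto simp: sum_distrib_right)
    have GH: "cmod ((\<Sum>i\<in>I. G i) - 2 * \<i> * u * s * (\<Sum>i\<in>I. H i)) \<le> 6 * u\<^sup>2 * B ^ 3 * (\<rho> * (K * (2 * \<Theta>\<^sup>2 + 8 * \<Theta> ^ 4)))"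
    proof -
      have "(\<Sum>i\<in>I. G i) - 2 * \<i> * u * s * (\<Sum>i\<in>I. H i) = (\<Sum>i\<in>I. G i - 2 * \<i> * u * s * H i)"
        by (simp add: sum_subtractf sum_distrib_left)
      also have "cmod \<dots> \<le> (\<Sum>i\<in>I. 6 * u\<^sup>2 * B ^ 3 * (LINT x|P. \<bar>V i x\<bar> ^ 3))"
      proof (rule order.trans[OF norm_sum sum_mono])
        fix i assume i: "i \<in> I"
        from stein_step[OF W[OF i] bounded[OF i] dep[OF i] D(3)[OF i] var[OF i] V[of i] Vb depV[OF i] Tm[of i] depTm[OF i], of u]
        show "cmod (G i - 2 * \<i> * u * s * H i) \<le> 6 * u\<^sup>2 * B ^ 3 * (LINT x|P. \<bar>V i x\<bar> ^ 3)"
          unfolding G_def H_def T_split[OF i] by simp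
      qed
      also have "\<dots> = 6 * u\<^sup>2 * B ^ 3 * (\<Sum>i\<in>I. LINT x|P. \<bar>V i x\<bar> ^ 3)" by (simp add: sum_distrib_left)
      also have "\<dots> \<le> 6 * u\<^sup>2 * B ^ 3 * (\<rho> * (K * (2 * \<Theta>\<^sup>2 + 8 * \<Theta> ^ 4)))"
        using B0 by (intro mult_left_mono V3_sum) auto
      finally show ?thesis .
    qed
    have HS: "cmod ((\<Sum>i\<in>I. H i) - s * K * \<phi> u) \<le> 8 * \<Theta>\<^sup>2 * (\<rho> * sqrt K)"
    proof -
      have "(\<Sum>i\<in>I. H i) - s * K * \<phi> u = (CLINT x|P. (?S x) * iexp (u * T x) - (s * K) *\<^sub>R iexp (u * T x))"
        unfolding H_sum \<phi>_def
        by (subst Bochner_Integration.integral_diff[OF iSe integrable_scaleR_right[OF ie]])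
           (simp add: scaleR_conv_of_real[symmetric])
      also have "\<dots> = (CLINT x|P. complex_of_real (?S x - s * K) * iexp (u * T x))"
        by (intro Bochner_Integration.integral_cong refl) (simp add: scaleR_conv_of_real algebra_simps)
      also have "cmod \<dots> \<le> (LINT x|P. \<bar>?S x - s * K\<bar>)"
      proof (rule norm_integral_le)
        show i1: "integrable P (\<lambda>x. \<bar>?S x - s * K\<bar>)" using iS by simp
        have "integrable P (\<lambda>x. complex_of_real (?S x - s * K))"
          using iS by (intro integrable_of_real Bochner_Integration.integrable_diff) auto
        from P.integrable_iexp_mult[OF _ this, of "\<lambda>x. u * T x"]
        show "integrable P (\<lambda>x. complex_of_real (?S x - s * K) * iexp (u * T x))" by simp
        show "cmod (complex_of_real (?S x - s * K) * iexp (u * T x)) \<le> \<bar>?S x - s * K\<bar>" for x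
          by (simp only: norm_mult norm_of_real norm_exp_i_times mult_1_right order_refl)
      qed
      finally show ?thesis using S_dev by linarith
    qed
    have "\<phi>' u + (u * (2 * s\<^sup>2 * K)) *\<^sub>R \<phi> u
        = \<i> * ((\<Sum>i\<in>I. G i) - 2 * \<i> * u * s * (\<Sum>i\<in>I. H i)) - 2 * u * s * ((\<Sum>i\<in>I. H i) - s * K * \<phi> u)"
      unfolding \<phi>'_eq by (simp add: scaleR_conv_of_real power2_eq_square algebra_simps)
    also have "cmod \<dots> \<le> 6 * u\<^sup>2 * B ^ 3 * (\<rho> * (K * (2 * \<Theta>\<^sup>2 + 8 * \<Theta> ^ 4))) + 2 * \<bar>u\<bar> * s * (8 * \<Theta>\<^sup>2 * (\<rho> * sqrt K))"
    proof (rule order.trans[OF norm_triangle_ineq4 add_mono])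
      show "cmod (\<i> * ((\<Sum>i\<in>I. G i) - 2 * \<i> * u * s * (\<Sum>i\<in>I. H i))) \<le> 6 * u\<^sup>2 * B ^ 3 * (\<rho> * (K * (2 * \<Theta>\<^sup>2 + 8 * \<Theta> ^ 4)))"
        using GH by (simp add: norm_mult)
      have "cmod (2 * u * s * ((\<Sum>i\<in>I. H i) - s * K * \<phi> u)) = 2 * \<bar>u\<bar> * s * cmod ((\<Sum>i\<in>I. H i) - s * K * \<phi> u)"
        using s0 by (simp add: norm_mult)
      also have "\<dots> \<le> 2 * \<bar>u\<bar> * s * (8 * \<Theta>\<^sup>2 * (\<rho> * sqrt K))"
        using s0 by (intro mult_left_mono HS) auto
      finally show "cmod (2 * u * s * ((\<Sum>i\<in>I. H i) - s * K * \<phi> u)) \<le> 2 * \<bar>u\<bar> * s * (8 * \<Theta>\<^sup>2 * (\<rho> * sqrt K))" .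
    qed
    also have "\<dots> = \<rho> * (6 * u\<^sup>2 * B ^ 3 * (K * (2 * \<Theta>\<^sup>2 + 8 * \<Theta> ^ 4)) + 16 * \<bar>u\<bar> * s * (\<Theta>\<^sup>2 * sqrt K))"
      by (simp add: algebra_simps)
    also have "\<dots> \<le> ?e"
    proof -
      have "u\<^sup>2 \<le> l\<^sup>2" using u by (simp add: abs_le_square_iff)
      then show ?thesis
        using u \<rho> B0 K0 s0 by (intro mult_left_mono add_mono mult_right_mono) (auto simp: zero_le_even_power)
    qed
    finally show "cmod (\<phi>' u + (u * (2 * s\<^sup>2 * K)) *\<^sub>R \<phi> u) \<le> ?e" .
  qed
  then show ?thesis by (simp add: \<phi>_def)
qed

end

section \<open>The kernel of the averaged periodogram\<close>

text \<open>The matrix entry at lag \<open>k\<close> of \<open>sqrt m * Q_n\<close>: the squared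
  modulus produces cosines of the lag, and \<open>sqrt m\<close> times the average over
  \<open>m\<close> frequencies leaves \<open>sqrt m\<close> in the denominator.\<close>

definition kern :: "nat \<Rightarrow> nat \<Rightarrow> int \<Rightarrow> real" where
  "kern n m k = (\<Sum>j=1..m. cos (of_int k * (2 * pi * real j / real n))) / (2 * pi * real n * sqrt (real m))"

text \<open>The nonzero eigenvalue of the matrix: n / 2, the sum of a squared cosine over a full
  period, divided by the normalisation of \<open>kern\<close>.\<close>

definition kappa :: "nat \<Rightarrow> real" where
  "kappa m = 1 / (4 * pi * sqrt (real m))"

text \<open>Blocks start at the multiples of \<open>b\<close>, and only the first \<open>q\<close>
  times of each are kept; the lag is rounded to the distance of the block starts. Zeros are put on
  the gaps and the incomplete last block, and on pairs within one block, which makes the block form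
  off-diagonal.\<close>

definition block_kern :: "nat \<Rightarrow> nat \<Rightarrow> nat \<Rightarrow> nat \<Rightarrow> nat \<Rightarrow> nat \<Rightarrow> real" where
  "block_kern n m q b s t =
     (if s mod b < q \<and> s div b < n div b \<and> t mod b < q \<and> t div b < n div b \<and> s div b \<noteq> t div b
      then kern n m (int (b * (s div b)) - int (b * (t div b))) else 0)"

text \<open>Multiplication by \<open>2 * sin (w / 2)\<close> makes the sum telescope over full
  periods, and this factor is nonzero because \<open>n\<close> does not divide \<open>r\<close>. The
  phase \<open>\<alpha>\<close> accommodates the product-to-sum formula.\<close>

lemma sum_cos_arith:
  fixes r :: int
  assumes n: "0 < n" and r: "\<not> int n dvd r"
  shows "(\<Sum>i<n. cos (of_int (int i) * (2 * pi * of_int r / real n) + \<alpha>)) = 0"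
proof -
  define w where "w = 2 * pi * of_int r / real n"
  define f where "f i = sin (real i * w + \<alpha> - w / 2)" for i
  have step: "2 * sin (w / 2) * cos (real i * w + \<alpha>) = f (Suc i) - f i" for i
  proof -
    have "f (Suc i) = sin ((real i * w + \<alpha>) + w / 2)" by (simp add: f_def algebra_simps)
    then show ?thesis by (simp add: f_def sin_add sin_diff)
  qed
  have nw: "real n * w = 2 * pi * of_int r" using n by (simp add: w_def)
  have "f n = sin ((\<alpha> - w / 2) + 2 * pi * of_int r)"
    unfolding f_def nw[symmetric] by (simp add: algebra_simps)
  also have "\<dots> = f 0"
    by (simp only: sin_add sin_int_2pin cos_int_2pin f_def) simp
  finally have "2 * sin (w / 2) * (\<Sum>i<n. cos (real i * w + \<alpha>)) = 0"
    unfolding sum_distrib_left step sum_lessThan_telescope by simp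
  moreover have "sin (w / 2) \<noteq> 0"
  proof
    assume "sin (w / 2) = 0"
    then obtain k :: int where "w / 2 = of_int k * pi" by (auto simp: sin_zero_iff_int2)
    then have "of_int r = (of_int (int n * k) :: real)" using n by (simp add: w_def field_simps)
    then have "r = int n * k" by linarith
    then show False using r by simp
  qed
  ultimately show ?thesis by (simp add: w_def)
qed

lemma one_minus_cos_le: "1 - cos x \<le> x\<^sup>2 / (2::real)"
proof -
  have "1 - cos x = 2 * (sin (x / 2))\<^sup>2" using cos_double_sin[of "x / 2"] by simp
  also have "(sin (x / 2))\<^sup>2 \<le> (x / 2)\<^sup>2" using abs_sin_x_le_abs_x[of "x / 2"] by (simp only: abs_le_square_iff)
  finally show ?thesis by (simp add: power2_eq_square)
qed

context
  fixes n m :: nat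
  assumes m: "1 \<le> m" and mn: "2 * m < n"
begin

text \<open>The matrix \<open>kern n m (s - t)\<close> is \<open>kappa m\<close> times a projection; every norm needed below is read off
  from this identity.\<close>

lemma kern_orthogonality:
  fixes j k :: int
  shows "(\<Sum>i<n. kern n m (int i - j) * kern n m (int i - k)) = kappa m * kern n m (j - k)"
proof -
  define w where "w p = 2 * pi * real p / real n" for p
  have n: "0 < n" using mn by simp
  have inner: "(\<Sum>i<n. cos (of_int (int i - j) * w p) * cos (of_int (int i - k) * w q))
      = (if p = q then real n / 2 * cos (of_int (j - k) * w p) else 0)"
    if pq: "p \<in> {1..m}" "q \<in> {1..m}" for p q
  proof -
    let ?\<alpha> = "of_int k * w q - of_int j * w p" and ?\<beta> = "- of_int k * w q - of_int j * w p"
    have w_diff: "w p - w q = 2 * pi * of_int (int p - int q) / real n"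
      by (simp add: w_def diff_divide_distrib right_diff_distrib)
    have w_sum: "w p + w q = 2 * pi * of_int (int p + int q) / real n"
      by (simp add: w_def add_divide_distrib distrib_left)
    \<comment> \<open>Here \<open>2 * m < n\<close> excludes aliasing: the sum of two frequency
      indices lies strictly between 0 and \<open>n\<close>.\<close>
    have "\<not> int n dvd (int p + int q)"
      using pq mn zdvd_imp_le[of "int n" "int p + int q"] by auto
    from sum_cos_arith[OF n this, of ?\<beta>]
    have 2: "(\<Sum>i<n. cos (real i * (w p + w q) + ?\<beta>)) = 0" unfolding w_sum by simp
    have 1: "(\<Sum>i<n. cos (real i * (w p - w q) + ?\<alpha>)) = (if p = q then real n * cos (of_int (j - k) * w p) else 0)"
    proof (cases "p = q")
      case True
      have "?\<alpha> = - (of_int (j - k) * w p)" using True by (simp add: algebra_simps)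
      then show ?thesis using True by simp
    next
      case False
      then have "\<not> int n dvd (int p - int q)"
        using pq mn zdvd_imp_le[of "int n" "int p - int q"] zdvd_imp_le[of "int n" "int q - int p"]
        by (cases "p < q") (auto simp: dvd_diff_commute)
      from sum_cos_arith[OF n this, of ?\<alpha>] show ?thesis
        unfolding w_diff using False by simp
    qed
    have "(\<Sum>i<n. cos (of_int (int i - j) * w p) * cos (of_int (int i - k) * w q))
        = (\<Sum>i<n. (cos (real i * (w p - w q) + ?\<alpha>) + cos (real i * (w p + w q) + ?\<beta>)) / 2)"
      by (intro sum.cong refl) (simp add: cos_times_cos algebra_simps)
    also have "\<dots> = ((\<Sum>i<n. cos (real i * (w p - w q) + ?\<alpha>)) + (\<Sum>i<n. cos (real i * (w p + w q) + ?\<beta>))) / 2"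
      by (simp add: sum.distrib flip: sum_divide_distrib)
    also have "\<dots> = (if p = q then real n / 2 * cos (of_int (j - k) * w p) else 0)"
      unfolding 1 2 by simp
    finally show ?thesis .
  qed
  define d where "d = 2 * pi * real n * sqrt (real m)"
  have d: "d \<noteq> 0" using n m by (simp add: d_def)
  have kern: "kern n m h = (\<Sum>p=1..m. cos (of_int h * w p)) / d" for h
    by (simp add: kern_def w_def d_def)
  have "(\<Sum>i<n. kern n m (int i - j) * kern n m (int i - k))
      = (\<Sum>i<n. (\<Sum>p=1..m. \<Sum>q=1..m. cos (of_int (int i - j) * w p) * cos (of_int (int i - k) * w q)) / d\<^sup>2)"
    by (simp only: kern times_divide_times_eq sum_product power2_eq_square)
  also have "\<dots> = (\<Sum>i<n. \<Sum>p=1..m. \<Sum>q=1..m. cos (of_int (int i - j) * w p) * cos (of_int (int i - k) * w q)) / d\<^sup>2"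
    by (rule sum_divide_distrib[symmetric])
  also have "(\<Sum>i<n. \<Sum>p=1..m. \<Sum>q=1..m. cos (of_int (int i - j) * w p) * cos (of_int (int i - k) * w q))
      = (\<Sum>p=1..m. \<Sum>q=1..m. \<Sum>i<n. cos (of_int (int i - j) * w p) * cos (of_int (int i - k) * w q))"
    by (subst sum.swap) (intro sum.cong refl sum.swap)
  also have "\<dots> = (\<Sum>p=1..m. \<Sum>q=1..m. if p = q then real n / 2 * cos (of_int (j - k) * w p) else 0)"
    by (intro sum.cong refl inner)
  also have "\<dots> = real n / 2 * (\<Sum>p=1..m. cos (of_int (j - k) * w p))"
    by (simp add: sum_distrib_left)
  also have "\<dots> / d\<^sup>2 = kappa m * kern n m (j - k)"
  proof -
    have "real n / 2 / d = kappa m"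
      using n m by (simp add: kappa_def d_def field_simps)
    then show ?thesis unfolding kern by (simp add: power2_eq_square) (metis times_divide_eq_left times_divide_eq_right divide_divide_eq_left mult.commute)
  qed
  finally show ?thesis .
qed

lemma kern_minus: "kern n m (- k) = kern n m k"
  by (simp add: kern_def)

lemma kern_0: "kern n m 0 = sqrt (real m) / (2 * pi * real n)"
proof -
  have "kern n m 0 = (real m / sqrt (real m)) / (2 * pi * real n)" by (simp add: kern_def mult_ac)
  then show ?thesis by (simp add: real_div_sqrt)
qed

lemma kern_0_nonneg: "0 \<le> kern n m 0"
  unfolding kern_0 by simp

lemma kappa_pos: "0 < kappa m"
  unfolding kappa_def using m by simp

lemma kern_abs_le: "\<bar>kern n m k\<bar> \<le> kern n m 0"
proof -
  have "\<bar>\<Sum>j=1..m. cos (of_int k * (2 * pi * real j / real n))\<bar> \<le> (\<Sum>j=1..m. 1)"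
    by (rule order.trans[OF sum_abs sum_mono]) simp
  then show ?thesis by (simp add: kern_def abs_divide abs_mult divide_right_mono)
qed

lemma kern_sum_squares: "(\<Sum>s<n. (kern n m (int s - t))\<^sup>2) = kappa m * kern n m 0"
  using kern_orthogonality[of t t] by (simp add: power2_eq_square)

lemma kern_sum_squares': "(\<Sum>t<n. (kern n m (s - int t))\<^sup>2) = kappa m * kern n m 0"
  using kern_sum_squares[of s] kern_minus[of "s - int _"] by simp

lemma n_kappa_kern_0: "real n * (kappa m * kern n m 0) = 1 / (8 * pi\<^sup>2)"
  using m mn by (simp add: kappa_def kern_0 power2_eq_square)

text \<open>All frequencies are at most \<open>2 * pi * m / n\<close>, so the kernel hardly changes
  over a bounded lag once \<open>m / n\<close> is small; here m = o(n) takes effect.\<close>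

lemma kern_0_diff_le: "kern n m 0 - kern n m h \<le> kern n m 0 * ((of_int h * (2 * pi * real m / real n))\<^sup>2 / 2)"
proof -
  define w where "w p = 2 * pi * real p / real n" for p
  define d where "d = 2 * pi * real n * sqrt (real m)"
  have "(\<Sum>p=1..m. 1 - cos (of_int h * w p)) \<le> (\<Sum>p=1..m. (of_int h * w m)\<^sup>2 / 2)"
  proof (rule sum_mono)
    fix p assume p: "p \<in> {1..m}"
    have "1 - cos (of_int h * w p) \<le> (of_int h * w p)\<^sup>2 / 2"
      by (rule one_minus_cos_le)
    also have "\<dots> \<le> (of_int h * w m)\<^sup>2 / 2"
    proof -
      have "0 \<le> w p" "w p \<le> w m" using p by (auto simp: w_def intro!: divide_right_mono)
      then show ?thesis unfolding power_mult_distrib by (intro divide_right_mono mult_left_mono power_mono) auto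
    qed
    finally show "1 - cos (of_int h * w p) \<le> (of_int h * w m)\<^sup>2 / 2" .
  qed
  then have "(\<Sum>p=1..m. 1 - cos (of_int h * w p)) / d \<le> (\<Sum>p=1..m. (of_int h * w m)\<^sup>2 / 2) / d"
    by (rule divide_right_mono) (simp add: d_def)
  then show ?thesis
    by (simp add: kern_def w_def d_def sum_subtractf diff_divide_distrib)
qed

text \<open>Expanding the square and using orthogonality for each product leaves only the lags 0 and
  \<open>h\<close>; the cost of rounding a lag is thus known exactly.\<close>

lemma kern_shift_sum:
  "(\<Sum>s<n. (kern n m (int s - t) - kern n m (int s - t + h))\<^sup>2) = 2 * kappa m * (kern n m 0 - kern n m h)"
proof -
  have "(\<Sum>s<n. (kern n m (int s - t) - kern n m (int s - t + h))\<^sup>2)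
      = (\<Sum>s<n. kern n m (int s - t) * kern n m (int s - t)) + (\<Sum>s<n. kern n m (int s - (t - h)) * kern n m (int s - (t - h)))
        - 2 * (\<Sum>s<n. kern n m (int s - t) * kern n m (int s - (t - h)))"
    by (simp add: power2_diff power2_eq_square sum.distrib sum_subtractf sum_distrib_left algebra_simps)
  then show ?thesis unfolding kern_orthogonality by (simp add: algebra_simps)
qed

text \<open>The rows are extended from the points \<open>p i\<close> to all of
  \<open>{..<n}\<close>, where the projection identity gives \<open>u\<close> as
  \<open>kappa m\<close> times an inner product of \<open>z\<close> with \<open>y\<close>.
  Cauchy-Schwarz then bounds \<open>u\<^sup>2\<close> by \<open>(kappa m)\<^sup>2 * Z * u\<close>.
  Submatrices are included since the block starts form one.\<close>

lemma kern_operator_norm: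
  assumes I: "finite I" and inj: "inj_on p I" "p ` I \<subseteq> {..<n}"
  shows "(\<Sum>i\<in>I. (\<Sum>j\<in>I. kern n m (int (p i) - int (p j)) * z j)\<^sup>2) \<le> (kappa m)\<^sup>2 * (\<Sum>i\<in>I. (z i)\<^sup>2)"
proof -
  define y where "y s = (\<Sum>j\<in>I. kern n m (int s - int (p j)) * z j)" for s
  define u where "u = (\<Sum>s<n. (y s)\<^sup>2)"
  define Z where "Z = (\<Sum>i\<in>I. (z i)\<^sup>2)"
  have u0: "0 \<le> u" unfolding u_def by (intro sum_nonneg) auto
  have le: "(\<Sum>i\<in>I. (y (p i))\<^sup>2) \<le> u"
  proof -
    have "(\<Sum>i\<in>I. (y (p i))\<^sup>2) = (\<Sum>s\<in>p ` I. (y s)\<^sup>2)" by (simp add: sum.reindex[OF inj(1)])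
    also have "\<dots> \<le> u" unfolding u_def by (rule sum_mono2[OF _ inj(2)]) auto
    finally show ?thesis .
  qed
  have "u = (\<Sum>s<n. \<Sum>j\<in>I. \<Sum>k\<in>I. z j * z k * (kern n m (int s - int (p j)) * kern n m (int s - int (p k))))"
    by (simp add: u_def y_def power2_eq_square sum_product mult_ac)
  also have "\<dots> = (\<Sum>j\<in>I. \<Sum>k\<in>I. \<Sum>s<n. z j * z k * (kern n m (int s - int (p j)) * kern n m (int s - int (p k))))"
    by (subst sum.swap) (intro sum.cong refl sum.swap)
  also have "\<dots> = (\<Sum>j\<in>I. \<Sum>k\<in>I. z j * z k * (kappa m * kern n m (int (p j) - int (p k))))"
    by (simp only: sum_distrib_left[symmetric] kern_orthogonality)
  also have "\<dots> = kappa m * (\<Sum>j\<in>I. z j * y (p j))"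
    by (simp add: y_def sum_distrib_left mult_ac)
  finally have u: "u = kappa m * (\<Sum>j\<in>I. z j * y (p j))" .
  have "u\<^sup>2 = (kappa m)\<^sup>2 * (\<Sum>j\<in>I. z j * y (p j))\<^sup>2" by (subst u) (simp add: power_mult_distrib)
  also have "\<dots> \<le> (kappa m)\<^sup>2 * (Z * (\<Sum>j\<in>I. (y (p j))\<^sup>2))"
    unfolding Z_def by (intro mult_left_mono Cauchy_Schwarz_ineq_sum) auto
  also have "\<dots> \<le> (kappa m)\<^sup>2 * (Z * u)"
    by (intro mult_left_mono le) (auto simp: Z_def sum_nonneg)
  finally have "u * u \<le> ((kappa m)\<^sup>2 * Z) * u" by (simp add: power2_eq_square mult_ac)
  then have "u \<le> (kappa m)\<^sup>2 * Z"
    using u0 by (cases "u = 0") (auto simp: Z_def sum_nonneg)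
  then show ?thesis using le by (simp add: y_def Z_def)
qed

section \<open>The error of freezing the kernel on blocks\<close>

lemma card_gap_times:
  assumes b: "0 < b" "q \<le> b"
  shows "card {t \<in> {..<n}. \<not> (t mod b < q \<and> t div b < n div b)} \<le> b + (n div b) * (b - q)"
proof -
  let ?S = "(\<lambda>(i, r). i * b + r) ` ({..<n div b} \<times> {q..<b})"
  have "{t \<in> {..<n}. \<not> (t mod b < q \<and> t div b < n div b)} \<subseteq> {n div b * b..<n} \<union> ?S"
  proof
    fix t assume t: "t \<in> {t \<in> {..<n}. \<not> (t mod b < q \<and> t div b < n div b)}"
    show "t \<in> {n div b * b..<n} \<union> ?S"
    proof (cases "t div b < n div b")
      case True
      then have "t mod b \<in> {q..<b}" using t b by simp
      then have "(\<lambda>(i, r). i * b + r) (t div b, t mod b) \<in> ?S" using True by (intro imageI) auto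
      then show ?thesis by simp
    next
      case False
      then have "n div b * b \<le> t div b * b" by simp
      also have "\<dots> \<le> t" by simp
      finally show ?thesis using t by simp
    qed
  qed
  then have "card {t \<in> {..<n}. \<not> (t mod b < q \<and> t div b < n div b)} \<le> card ({n div b * b..<n} \<union> ?S)"
    by (intro card_mono) auto
  also have "\<dots> \<le> card {n div b * b..<n} + card ?S" by (rule card_Un_le)
  also have "card {n div b * b..<n} = n mod b" by (simp add: minus_div_mult_eq_mod)
  also have "card ?S \<le> card ({..<n div b} \<times> {q..<b})" by (rule card_image_le) simp
  also have "\<dots> = (n div b) * (b - q)" by (simp add: card_cartesian_product)
  finally show ?thesis using b mod_less_divisor[of b n] by linarith
qed

text \<open>Three sources of error: rows and columns in gaps, each with square sum
  \<open>kappa m * kern n m 0\<close>; pairs within one block, at most \<open>b\<close> per row; and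
  the rounding of lags by some \<open>h\<close> with absolute value at most \<open>q\<close>. As n
  grows with \<open>q\<close> and \<open>b\<close> fixed, only the proportion of gaps
  survives.\<close>

lemma block_kern_error:
  assumes b: "0 < b" "q \<le> b"
  shows "(\<Sum>s<n. \<Sum>t<n. (kern n m (int s - int t) - block_kern n m q b s t)\<^sup>2)
    \<le> 1 / (8 * pi\<^sup>2) * (2 * (real b / real n + real (b - q) / real b) + (2 * real q + 1) * ((real q)\<^sup>2 * (2 * pi * real m / real n)\<^sup>2))
       + real b * real m / (4 * pi\<^sup>2 * real n)"
proof -
  have n: "0 < n" using mn by simp
  let ?K = "kern n m"
  define bad where "bad t \<longleftrightarrow> \<not> (t mod b < q \<and> t div b < n div b)" for t
  define B where "B = {t \<in> {..<n}. bad t}"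
  define R where "R h s t = (?K (int s - int t) - ?K (int s - int t + h))\<^sup>2" for h :: int and s t :: nat
  define u where "u s t = (if bad s then (?K (int s - int t))\<^sup>2 else 0) + (if bad t then (?K (int s - int t))\<^sup>2 else 0)
      + (if s div b = t div b then (?K 0)\<^sup>2 else 0) + (\<Sum>h\<in>{- int q..int q}. R h s t)" for s t
  have K2: "(?K h)\<^sup>2 \<le> (?K 0)\<^sup>2" for h
    using kern_abs_le[of h] kern_0_nonneg by (simp add: abs_le_square_iff[symmetric])
  have R0: "0 \<le> (\<Sum>h\<in>{- int q..int q}. R h s t)" for s t by (intro sum_nonneg) (simp add: R_def)
  have "(?K (int s - int t) - block_kern n m q b s t)\<^sup>2 \<le> u s t" for s t
  proof (cases "bad s \<or> bad t \<or> s div b = t div b")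
    case True
    then have "block_kern n m q b s t = 0" by (auto simp: block_kern_def bad_def)
    moreover have "(?K (int s - int t))\<^sup>2 \<le> u s t" using True R0[of s t] K2[of "int s - int t"] by (auto simp: u_def)
    ultimately show ?thesis by simp
  next
    case False
    define h where "h = int (t mod b) - int (s mod b)"
    have h: "h \<in> {- int q..int q}" using False by (auto simp: bad_def h_def)
    have "int s = int (b * (s div b)) + int (s mod b)" "int t = int (b * (t div b)) + int (t mod b)"
      unfolding of_nat_add[symmetric] by simp_all
    then have "block_kern n m q b s t = ?K (int s - int t + h)"
      using False by (simp add: block_kern_def bad_def h_def)
    then have "(?K (int s - int t) - block_kern n m q b s t)\<^sup>2 = R h s t" by (simp add: R_def)
    \<comment> \<open>The rounding \<open>h\<close> depends on the pair. Summing over all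
      \<open>h\<close> costs a factor \<open>2 * q + 1\<close> but lets \<open>s\<close> run freely,
      so that \<open>kern_shift_sum\<close> applies.\<close>
    also have "\<dots> \<le> (\<Sum>h\<in>{- int q..int q}. R h s t)"
      by (rule member_le_sum[OF h]) (auto simp: R_def)
    also have "\<dots> \<le> u s t" by (simp add: u_def)
    finally show ?thesis .
  qed
  then have "(\<Sum>s<n. \<Sum>t<n. (?K (int s - int t) - block_kern n m q b s t)\<^sup>2) \<le> (\<Sum>s<n. \<Sum>t<n. u s t)"
    by (intro sum_mono)
  also have "\<dots> = (\<Sum>s<n. \<Sum>t<n. if bad s then (?K (int s - int t))\<^sup>2 else 0)
      + (\<Sum>s<n. \<Sum>t<n. if bad t then (?K (int s - int t))\<^sup>2 else 0)
      + (\<Sum>s<n. \<Sum>t<n. if s div b = t div b then (?K 0)\<^sup>2 else 0)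
      + (\<Sum>s<n. \<Sum>t<n. \<Sum>h\<in>{- int q..int q}. R h s t)"
    by (simp add: u_def sum.distrib)
  also have "(\<Sum>s<n. \<Sum>t<n. if bad s then (?K (int s - int t))\<^sup>2 else 0) = real (card B) * (kappa m * ?K 0)"
  proof -
    have "(\<Sum>s<n. \<Sum>t<n. if bad s then (?K (int s - int t))\<^sup>2 else 0) = (\<Sum>s<n. if bad s then kappa m * ?K 0 else 0)"
      by (intro sum.cong refl) (simp add: kern_sum_squares')
    also have "\<dots> = (\<Sum>s\<in>B. kappa m * ?K 0)" unfolding B_def by (rule sum.inter_filter[symmetric]) simp
    finally show ?thesis by simp
  qed
  also have "(\<Sum>s<n. \<Sum>t<n. if bad t then (?K (int s - int t))\<^sup>2 else 0) = real (card B) * (kappa m * ?K 0)"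
  proof -
    have "(\<Sum>s<n. \<Sum>t<n. if bad t then (?K (int s - int t))\<^sup>2 else 0) = (\<Sum>t<n. \<Sum>s<n. if bad t then (?K (int s - int t))\<^sup>2 else 0)"
      by (rule sum.swap)
    also have "\<dots> = (\<Sum>t<n. if bad t then kappa m * ?K 0 else 0)"
      by (intro sum.cong refl) (simp add: kern_sum_squares)
    also have "\<dots> = (\<Sum>t\<in>B. kappa m * ?K 0)" unfolding B_def by (rule sum.inter_filter[symmetric]) simp
    finally show ?thesis by simp
  qed
  also have "(\<Sum>s<n. \<Sum>t<n. if s div b = t div b then (?K 0)\<^sup>2 else 0) \<le> real n * (real b * (?K 0)\<^sup>2)"
  proof -
    have "(\<Sum>t<n. if s div b = t div b then (?K 0)\<^sup>2 else 0) \<le> real b * (?K 0)\<^sup>2" for s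
    proof -
      have "{t \<in> {..<n}. s div b = t div b} \<subseteq> {s div b * b..<s div b * b + b}"
      proof
        fix t assume "t \<in> {t \<in> {..<n}. s div b = t div b}"
        then have eq: "s div b = t div b" by simp
        have "t = t div b * b + t mod b" by simp
        then show "t \<in> {s div b * b..<s div b * b + b}"
          using mod_less_divisor[OF b(1), of t] unfolding eq atLeastLessThan_iff by linarith
      qed
      then have "card {t \<in> {..<n}. s div b = t div b} \<le> card {s div b * b..<s div b * b + b}"
        by (intro card_mono) auto
      then have "card {t \<in> {..<n}. s div b = t div b} \<le> b" by simp
      moreover have "(\<Sum>t<n. if s div b = t div b then (?K 0)\<^sup>2 else 0) = (\<Sum>t\<in>{t \<in> {..<n}. s div b = t div b}. (?K 0)\<^sup>2)"
        by (rule sum.inter_filter[symmetric]) simp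
      ultimately show ?thesis by (simp add: mult_right_mono)
    qed
    then have "(\<Sum>s<n. \<Sum>t<n. if s div b = t div b then (?K 0)\<^sup>2 else 0) \<le> (\<Sum>s<n. real b * (?K 0)\<^sup>2)"
      by (rule sum_mono)
    then show ?thesis by simp
  qed
  also have "(\<Sum>s<n. \<Sum>t<n. \<Sum>h\<in>{- int q..int q}. R h s t)
      \<le> (2 * real q + 1) * (real n * (kappa m * ?K 0 * ((real q)\<^sup>2 * (2 * pi * real m / real n)\<^sup>2)))"
  proof -
    have "(\<Sum>s<n. \<Sum>t<n. \<Sum>h\<in>{- int q..int q}. R h s t) = (\<Sum>h\<in>{- int q..int q}. \<Sum>t<n. \<Sum>s<n. R h s t)"
      by (subst sum.swap, subst (2) sum.swap, subst sum.swap) (rule refl)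
    also have "\<dots> = (\<Sum>h\<in>{- int q..int q}. real n * (2 * kappa m * (?K 0 - ?K h)))"
      by (simp add: R_def kern_shift_sum)
    also have "\<dots> \<le> (\<Sum>h\<in>{- int q..int q}. real n * (2 * kappa m * (?K 0 * (((real q)\<^sup>2 * (2 * pi * real m / real n)\<^sup>2) / 2))))"
    proof (intro sum_mono mult_left_mono)
      fix h assume h: "h \<in> {- int q..int q}"
      then have "\<bar>real_of_int h\<bar> \<le> \<bar>real q\<bar>" by (auto simp: abs_le_iff)
      then have "(real_of_int h)\<^sup>2 \<le> (real q)\<^sup>2" by (simp only: abs_le_square_iff)
      then have "(of_int h * (2 * pi * real m / real n))\<^sup>2 / 2 \<le> ((real q)\<^sup>2 * (2 * pi * real m / real n)\<^sup>2) / 2"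
        unfolding power_mult_distrib[of "of_int h"] by (intro divide_right_mono mult_right_mono) auto
      then show "?K 0 - ?K h \<le> ?K 0 * (((real q)\<^sup>2 * (2 * pi * real m / real n)\<^sup>2) / 2)"
        using kern_0_diff_le[of h] mult_left_mono[OF _ kern_0_nonneg] by (meson order.trans)
    qed (use kappa_pos in auto)
    also have "\<dots> = (2 * real q + 1) * (real n * (kappa m * ?K 0 * ((real q)\<^sup>2 * (2 * pi * real m / real n)\<^sup>2)))"
      by simp
    finally show ?thesis .
  qed
  finally have *: "(\<Sum>s<n. \<Sum>t<n. (?K (int s - int t) - block_kern n m q b s t)\<^sup>2)
      \<le> real (card B) * (kappa m * ?K 0) + real (card B) * (kappa m * ?K 0) + real n * (real b * (?K 0)\<^sup>2)
        + (2 * real q + 1) * (real n * (kappa m * ?K 0 * ((real q)\<^sup>2 * (2 * pi * real m / real n)\<^sup>2)))"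
    by simp
  have kK: "kappa m * ?K 0 = 1 / (8 * pi\<^sup>2) / real n"
    using n_kappa_kern_0 n by (simp add: field_simps)
  have 1: "real (card B) * (kappa m * ?K 0) \<le> 1 / (8 * pi\<^sup>2) * (real b / real n + real (b - q) / real b)"
  proof -
    have "card B \<le> b + (n div b) * (b - q)" unfolding B_def bad_def by (rule card_gap_times[OF b])
    then have "real (card B) \<le> real (b + (n div b) * (b - q))" by (simp only: of_nat_le_iff)
    also have "\<dots> = real b + real (n div b) * real (b - q)" by simp
    also have "\<dots> \<le> real b + real n / real b * real (b - q)"
      by (intro add_mono mult_right_mono of_nat_div_le_of_nat) auto
    also have "\<dots> = real n * (real b / real n + real (b - q) / real b)"
      using n b by (simp add: field_simps)
    finally have "real (card B) * (1 / (8 * pi\<^sup>2) / real n) \<le> (real n * (real b / real n + real (b - q) / real b)) * (1 / (8 * pi\<^sup>2) / real n)"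
      by (intro mult_right_mono) auto
    also have "\<dots> = 1 / (8 * pi\<^sup>2) * (real b / real n + real (b - q) / real b)" using n by simp
    finally show ?thesis by (simp only: kK)
  qed
  have 2: "real n * (real b * (?K 0)\<^sup>2) = real b * real m / (4 * pi\<^sup>2 * real n)"
    using n by (simp add: kern_0 power_divide power_mult_distrib power2_eq_square)
  have 3: "(2 * real q + 1) * (real n * (kappa m * ?K 0 * ((real q)\<^sup>2 * (2 * pi * real m / real n)\<^sup>2)))
      = 1 / (8 * pi\<^sup>2) * ((2 * real q + 1) * ((real q)\<^sup>2 * (2 * pi * real m / real n)\<^sup>2))"
    unfolding kK using n by simp
  show ?thesis using * 1 unfolding 2 3 by (simp only: distrib_left)
qed

end

section \<open>Stationary processes and block sums\<close>

definition sh :: "int \<Rightarrow> (int \<Rightarrow> 's) \<Rightarrow> (int \<Rightarrow> 's)" where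
  "sh t x = (\<lambda>i. x (i + t))"

lemma sh_sh: "sh s (sh t x) = sh (s + t) x"
  by (simp add: sh_def add.assoc)

lemma sh_mrg: "sh t (mrg {k} y x) = mrg {k - t} (sh t y) (sh t x)"
  by (auto simp: sh_def mrg_def fun_eq_iff)

lemma dep_on_sh: "dep_on J F \<Longrightarrow> (\<And>i. i \<in> J \<Longrightarrow> i + t \<in> K) \<Longrightarrow> dep_on K (\<lambda>x. F (sh t x))"
  unfolding dep_on_def by (auto simp: sh_def)

definition clip :: "real \<Rightarrow> real \<Rightarrow> real" where
  "clip B u = max (- B) (min B u)"

lemma clip_lipschitz: "\<bar>clip B u - clip B v\<bar> \<le> \<bar>u - v\<bar>"
  unfolding clip_def by (auto simp: max_def min_def)

lemma abs_clip_le: "0 \<le> B \<Longrightarrow> \<bar>clip B u\<bar> \<le> B"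
  unfolding clip_def by (auto simp: max_def min_def)

lemma abs_clip_le': "0 \<le> B \<Longrightarrow> \<bar>clip B u\<bar> \<le> \<bar>u\<bar>"
  unfolding clip_def by (auto simp: max_def min_def)

lemma borel_measurable_clip [measurable]: "clip B \<in> borel_measurable borel"
  unfolding clip_def[abs_def] by measurable

lemma clip_tendsto: "(\<lambda>n. clip (real n) u) \<longlonglongrightarrow> u"
proof (rule tendsto_eventually)
  show "\<forall>\<^sub>F n in sequentially. clip (real n) u = u"
    using eventually_ge_at_top[of "nat \<lceil>\<bar>u\<bar>\<rceil>"]
  proof eventually_elim
    case (elim n)
    then have "\<bar>u\<bar> \<le> real n" by linarith
    then show ?case unfolding clip_def by (auto simp: max_def min_def)
  qed
qed

section \<open>The shift and approximation of stationary processes\<close>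

context iid_space
begin

lemma measurable_sh [measurable]: "sh t \<in> measurable P P"
proof -
  have "(\<lambda>x i. sh t x i) \<in> measurable P (PiM UNIV (\<lambda>_. \<mu>))"
    by (rule measurable_PiM_single') (auto simp: sh_def P_def space_PiM PiE_iff)
  then show ?thesis by (simp add: P_def)
qed

lemma distr_sh: "distr P P (sh t) = P"
proof -
  have "distr (PiM UNIV (\<lambda>_. \<mu>)) (PiM UNIV (\<lambda>_. \<mu>)) (\<lambda>\<omega>. \<lambda>n\<in>UNIV. \<omega> (n + t)) = PiM (UNIV::int set) (\<lambda>_. \<mu>)"
    using distr_PiM_reindex[of UNIV "\<lambda>_. \<mu>" "\<lambda>n. n + t" UNIV] by (simp add: prob_space_axioms inj_on_def)
  then show ?thesis by (simp only: P_def sh_def[abs_def] restrict_UNIV)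
qed

lemma distr_sh_pair: "distr (P \<Otimes>\<^sub>M P) (P \<Otimes>\<^sub>M P) (\<lambda>z. (sh t (fst z), sh t (snd z))) = P \<Otimes>\<^sub>M P"
proof -
  have "distr P P (sh t) \<Otimes>\<^sub>M distr P P (sh t) = distr (P \<Otimes>\<^sub>M P) (P \<Otimes>\<^sub>M P) (\<lambda>(x, y). (sh t x, sh t y))"
    by (rule pair_measure_distr) (auto simp: distr_sh P.sigma_finite_measure_axioms)
  then show ?thesis by (simp add: distr_sh case_prod_beta')
qed

lemma Lp_sh:
  assumes "in_Lp P p F"
  shows "in_Lp P p (\<lambda>x. F (sh t x))" "norm_Lp P p (\<lambda>x. F (sh t x)) = norm_Lp P p F"
  using assms in_Lp_distr[OF measurable_sh in_LpD[OF assms], of t p]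
    norm_Lp_distr[OF measurable_sh in_LpD[OF assms], of t p] by (simp_all add: distr_sh)

lemma integral_sh:
  assumes "F \<in> borel_measurable P" shows "(LINT x|P. F (sh t x)) = (LINT x|P. F x :: real)"
  using integral_distr[OF measurable_sh assms, of t] by (simp add: distr_sh)

lemma influence_sh:
  assumes [measurable]: "F \<in> borel_measurable P"
  shows "influence p (\<lambda>x. F (sh t x)) k = influence p F (k - t)"
proof -
  have "(\<lambda>z. (sh t (fst z), sh t (snd z))) \<in> measurable (P \<Otimes>\<^sub>M P) (P \<Otimes>\<^sub>M P)" by measurable
  from norm_Lp_distr[OF this, of "\<lambda>z. F (fst z) - F (mrg {k - t} (snd z) (fst z))" p]
  show ?thesis by (simp add: influence_def distr_sh_pair sh_mrg)
qed

text \<open>For a stationary process, the sum over all innovations at a fixed time equals the sum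
  over all times for a fixed innovation; this is therefore a bound on \<Theta>_4.\<close>

definition influence_sum_le :: "((int \<Rightarrow> 's) \<Rightarrow> real) \<Rightarrow> real \<Rightarrow> bool" where
  "influence_sum_le F \<Theta> \<longleftrightarrow> (\<forall>J. finite J \<longrightarrow> (\<Sum>k\<in>J. influence 4 F k) \<le> \<Theta>)"

text \<open>The influence depends only on \<open>k - \<tau> t\<close>, so a row sum and a column sum
  are both partial sums of the influences of \<open>F\<close>; injectivity of \<open>\<tau>\<close>
  keeps the column indices distinct.\<close>

lemma coupling_bound_stationary:
  assumes F: "in_Lp P 4 F" and EF: "(LINT x|P. F x) = 0" and infl: "influence_sum_le F \<Theta>"
    and T: "finite T" "inj_on \<tau> T"
  shows "coupling_bound T (\<lambda>t x. F (sh (\<tau> t) x)) \<Theta>"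
  unfolding coupling_bound_def
proof (intro conjI ballI allI impI)
  note [measurable] = in_LpD[OF F]
  show "finite T" by fact
  show "in_Lp P 4 (\<lambda>x. F (sh (\<tau> t) x))" for t by (rule Lp_sh(1)[OF F])
  show "(LINT x|P. F (sh (\<tau> t) x)) = 0" for t using EF by (simp add: integral_sh)
  show "(\<Sum>k\<in>J. influence 4 (\<lambda>x. F (sh (\<tau> t) x)) k) \<le> \<Theta>" if "finite J" for J t
  proof -
    have "(\<Sum>k\<in>J. influence 4 (\<lambda>x. F (sh (\<tau> t) x)) k) = (\<Sum>k\<in>(\<lambda>k. k - \<tau> t) ` J. influence 4 F k)"
      by (subst sum.reindex) (auto simp: inj_on_def influence_sh)
    also have "\<dots> \<le> \<Theta>" using infl that by (simp add: influence_sum_le_def)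
    finally show ?thesis .
  qed
  show "(\<Sum>t\<in>T. influence 4 (\<lambda>x. F (sh (\<tau> t) x)) k) \<le> \<Theta>" for k
  proof -
    have "(\<Sum>t\<in>T. influence 4 (\<lambda>x. F (sh (\<tau> t) x)) k) = (\<Sum>j\<in>(\<lambda>t. k - \<tau> t) ` T. influence 4 F j)"
      using T by (subst sum.reindex) (auto simp: inj_on_def influence_sh)
    also have "\<dots> \<le> \<Theta>" using infl T by (simp add: influence_sum_le_def)
    finally show ?thesis .
  qed
qed

text \<open>Both approximation steps, averaging out remote coordinates and clipping, do not increase the
  influences, so that the influences of the error are dominated by those of \<open>F\<close>.\<close>

lemma bounded_finite_range_approximation:
  assumes F: "in_Lp P 4 F" and EF: "(LINT x|P. F x) = 0" and infl: "influence_sum_le F \<Theta>"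
    and e: "0 < e"
  shows "\<exists>G L B. G \<in> borel_measurable P \<and> (\<forall>x. \<bar>G x\<bar> \<le> B) \<and> dep_on {- int L..int L} G \<and>
    (LINT x|P. G x) = 0 \<and> influence_sum_le G \<Theta> \<and> influence_sum_le (\<lambda>x. F x - G x) e"
proof -
  note [measurable] = in_LpD[OF F]
  have p4: "even (4::nat)" "0 < (4::nat)" by auto
  define S where "S = {(\<Sum>k\<in>J. influence 4 F k) | J. finite J}"
  have S: "S \<noteq> {}" "bdd_above S"
    using infl unfolding S_def influence_sum_le_def by (auto intro!: bdd_aboveI[of _ \<Theta>])
  obtain s where "s \<in> S" "Sup S - e / 4 < s" using less_cSupD[OF S(1), of "Sup S - e / 4"] e by auto
  then obtain J0 where J0: "finite J0" "Sup S - e / 4 < (\<Sum>k\<in>J0. influence 4 F k)"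
    by (auto simp: S_def)
  \<comment> \<open>Outside \<open>J0\<close> the influences of the error are at most twice those of
    \<open>F\<close>, a total of \<open>e / 2\<close>.\<close>
  have tail: "(\<Sum>k\<in>J. influence 4 F k) \<le> e / 4" if J: "finite J" "J \<inter> J0 = {}" for J
  proof -
    have "(\<Sum>k\<in>J \<union> J0. influence 4 F k) \<le> Sup S"
      using J J0 by (intro cSup_upper[OF _ S(2)]) (auto simp: S_def)
    then show ?thesis using J J0 by (simp add: sum.union_disjoint)
  qed
  \<comment> \<open>Inside \<open>J0\<close> each influence is at most twice the norm of the error,
    which will be at most \<open>4 * d\<close>; this choice makes the at most \<open>card J0\<close>
    of them sum to at most \<open>e / 2\<close>.\<close>
  define d where "d = e / (16 * (real (card J0) + 1))"
  have d: "0 < d" using e by (simp add: d_def)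
  obtain J1 where J1: "finite J1" "\<forall>K. J1 \<subseteq> K \<longrightarrow> norm_Lp P 4 (\<lambda>x. F x - cnd (- K) F x) \<le> d"
    using norm_diff_cnd_small[OF p4 F d] by auto
  define L where "L = Max (insert 0 ((\<lambda>k. nat \<bar>k\<bar>) ` J1))"
  define K where "K = {- int L..int L}"
  have "J1 \<subseteq> K"
  proof
    fix k assume k: "k \<in> J1"
    then have "nat \<bar>k\<bar> \<le> L" unfolding L_def using J1(1) by (intro Max_ge) auto
    then show "k \<in> K" by (auto simp: K_def)
  qed
  define C where "C = cnd (- K) F"
  have C: "in_Lp P 4 C" unfolding C_def by (rule Lp_cnd(1)[OF p4 F])
  note [measurable] = in_LpD[OF C]
  have nC: "norm_Lp P 4 (\<lambda>x. F x - C x) \<le> d" using J1(2) \<open>J1 \<subseteq> K\<close> by (simp add: C_def)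
  have "(\<lambda>n. norm_Lp P 4 (\<lambda>x. F x - clip (real n) (F x))) \<longlonglongrightarrow> 0"
  proof (rule norm_Lp_dominated[OF p4 in_Lp_cmult[OF F, of 2]])
    show "AE x in P. \<bar>F x - clip (real n) (F x)\<bar> \<le> \<bar>2 * F x\<bar>" for n
    proof (rule AE_I2)
      fix x show "\<bar>F x - clip (real n) (F x)\<bar> \<le> \<bar>2 * F x\<bar>"
        using abs_clip_le'[of "real n" "F x"] by simp
    qed
    show "AE x in P. (\<lambda>n. F x - clip (real n) (F x)) \<longlonglongrightarrow> 0"
    proof (rule AE_I2)
      fix x show "(\<lambda>n. F x - clip (real n) (F x)) \<longlonglongrightarrow> 0"
        using tendsto_diff[OF tendsto_const clip_tendsto, of "F x" "F x"] by simp
    qed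
  qed measurable
  from order_tendstoD(2)[OF this d] obtain n :: nat
    where n: "norm_Lp P 4 (\<lambda>x. F x - clip (real n) (F x)) < d" by (auto simp: eventually_sequentially)
  \<comment> \<open>Clipping comes after averaging, so that the result is bounded everywhere and
    still depends on \<open>K\<close> only.\<close>
  define H where "H x = clip (real n) (C x)" for x
  have H_meas [measurable]: "H \<in> borel_measurable P" unfolding H_def[abs_def] by measurable
  have H_b: "\<bar>H x\<bar> \<le> real n" for x by (simp add: H_def abs_clip_le)
  have H: "in_Lp P 4 H" by (rule P.in_Lp_bounded[OF H_meas H_b])
  have cF: "in_Lp P 4 (\<lambda>x. clip (real n) (F x))"
    by (rule in_Lp_mono[OF _ F]) (auto simp: abs_clip_le')
  have nH: "norm_Lp P 4 (\<lambda>x. F x - H x) \<le> 2 * d"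
  proof -
    have "norm_Lp P 4 (\<lambda>x. (F x - clip (real n) (F x)) + (clip (real n) (F x) - H x))
        \<le> norm_Lp P 4 (\<lambda>x. F x - clip (real n) (F x)) + norm_Lp P 4 (\<lambda>x. clip (real n) (F x) - H x)"
      by (intro norm_Lp_triangle p4 in_Lp_diff F cF H)
    moreover have "norm_Lp P 4 (\<lambda>x. clip (real n) (F x) - H x) \<le> norm_Lp P 4 (\<lambda>x. F x - C x)"
      unfolding H_def by (intro norm_Lp_mono p4 in_Lp_diff F C) (auto simp: clip_lipschitz)
    ultimately show ?thesis using n nC by simp
  qed
  \<comment> \<open>Clipping may destroy the zero mean; the constant that restores it is small and
    does not change influences.\<close>
  define c where "c = (LINT x|P. H x)"
  have c: "\<bar>c\<bar> \<le> 2 * d"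
  proof -
    have "(LINT x|P. F x - H x) = - c"
      using EF P.integrable_Lp[OF p4 F] P.integrable_Lp[OF p4 H] by (simp add: c_def)
    then have "\<bar>c\<bar> \<le> norm_Lp P 4 (\<lambda>x. F x - H x)"
      using P.abs_expectation_le_norm_Lp[OF p4 in_Lp_diff[OF p4(1) F H]] by simp
    with nH show ?thesis by linarith
  qed
  define G where "G x = H x - c" for x
  have G_meas [measurable]: "G \<in> borel_measurable P" unfolding G_def[abs_def] by measurable
  have G: "in_Lp P 4 G" unfolding G_def[abs_def] by (intro in_Lp_diff p4 H P.in_Lp_const)
  have FG: "in_Lp P 4 (\<lambda>x. F x - G x)" by (intro in_Lp_diff p4 F G)
  have nG: "norm_Lp P 4 (\<lambda>x. F x - G x) \<le> 4 * d"
  proof -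
    have "norm_Lp P 4 (\<lambda>x. (F x - H x) + c) \<le> norm_Lp P 4 (\<lambda>x. F x - H x) + norm_Lp P 4 (\<lambda>x. c)"
      by (intro norm_Lp_triangle p4 in_Lp_diff F H P.in_Lp_const)
    then show ?thesis using nH c by (simp add: G_def P.norm_Lp_const algebra_simps)
  qed
  have inflG: "influence 4 G k \<le> influence 4 F k" for k
  proof -
    have "influence 4 G k = influence 4 H k" by (simp add: influence_def G_def)
    also have "\<dots> \<le> influence 4 C k"
      unfolding H_def[abs_def] by (rule influence_lipschitz[OF p4 C]) (auto simp: clip_lipschitz)
    also have "\<dots> \<le> influence 4 F k" unfolding C_def by (rule influence_cnd_le[OF p4 F])
    finally show ?thesis .
  qed
  have "influence_sum_le G \<Theta>"
    unfolding influence_sum_le_def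
  proof (intro allI impI)
    fix J :: "int set" assume "finite J"
    then show "(\<Sum>k\<in>J. influence 4 G k) \<le> \<Theta>"
      using infl sum_mono[of J "influence 4 G" "influence 4 F"] inflG
      unfolding influence_sum_le_def by (meson order.trans)
  qed
  moreover have "influence_sum_le (\<lambda>x. F x - G x) e"
    unfolding influence_sum_le_def
  proof (intro allI impI)
    fix J :: "int set" assume J: "finite J"
    have "(\<Sum>k\<in>J. influence 4 (\<lambda>x. F x - G x) k)
        = (\<Sum>k\<in>J - J0. influence 4 (\<lambda>x. F x - G x) k) + (\<Sum>k\<in>J \<inter> J0. influence 4 (\<lambda>x. F x - G x) k)"
      using sum.Int_Diff[OF J, of "influence 4 (\<lambda>x. F x - G x)" J0] by simp
    also have "\<dots> \<le> (\<Sum>k\<in>J - J0. 2 * influence 4 F k) + (\<Sum>k\<in>J \<inter> J0. 2 * (4 * d))"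
    proof (intro add_mono sum_mono)
      fix k
      show "influence 4 (\<lambda>x. F x - G x) k \<le> 2 * influence 4 F k"
        using influence_diff[OF p4 F G, of k] inflG[of k] by linarith
      show "influence 4 (\<lambda>x. F x - G x) k \<le> 2 * (4 * d)"
        using influence_le_norm[OF p4 FG, of k] nG by linarith
    qed
    also have "\<dots> = 2 * (\<Sum>k\<in>J - J0. influence 4 F k) + real (card (J \<inter> J0)) * (8 * d)"
      by (simp add: sum_distrib_left)
    also have "\<dots> \<le> 2 * (e / 4) + real (card J0) * (8 * d)"
      using J J0(1) d by (intro add_mono mult_left_mono tail mult_right_mono) (auto intro!: card_mono)
    also have "\<dots> \<le> e"
    proof -
      have "real (card J0) * (8 * d) \<le> (real (card J0) + 1) * (8 * d)" using d by simp
      also have "\<dots> = e / 2" by (simp add: d_def field_simps)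
      finally show ?thesis by simp
    qed
    finally show "(\<Sum>k\<in>J. influence 4 (\<lambda>x. F x - G x) k) \<le> e" .
  qed
  moreover have "\<forall>x. \<bar>G x\<bar> \<le> real n + \<bar>c\<bar>"
  proof
    fix x show "\<bar>G x\<bar> \<le> real n + \<bar>c\<bar>" using H_b[of x] by (simp add: G_def)
  qed
  moreover have "dep_on {- int L..int L} G"
  proof -
    have "dep_on K C" using dep_on_cnd[OF dep_on_UNIV, of "- K" F] by (auto simp: C_def elim: dep_on_mono)
    then show ?thesis unfolding G_def[abs_def] H_def K_def[symmetric] by (rule dep_on_comp[where h = "\<lambda>u. clip (real n) u - c"])
  qed
  moreover have "(LINT x|P. G x) = 0"
    using P.integrable_Lp[OF p4 H] by (simp add: G_def c_def P.prob_space)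
  ultimately show ?thesis using G_meas by blast
qed

end

section \<open>Long-run variance and sums over blocks\<close>

lemma cesaro_mean_tendsto:
  fixes u :: "nat \<Rightarrow> real"
  assumes "u \<longlonglongrightarrow> c" shows "(\<lambda>q. (\<Sum>r<q. u r) / real q) \<longlonglongrightarrow> c"
proof (rule LIMSEQ_I)
  fix e :: real assume e: "0 < e"
  obtain N where N: "\<And>r. r \<ge> N \<Longrightarrow> norm (u r - c) < e / 2"
    using LIMSEQ_D[OF assms, of "e / 2"] e by auto
  define C where "C = (\<Sum>r<N. \<bar>u r - c\<bar>)"
  have C: "0 \<le> C" unfolding C_def by (intro sum_nonneg) auto
  define Q where "Q = max 1 (nat \<lceil>2 * C / e\<rceil> + 1)"
  show "\<exists>no. \<forall>n\<ge>no. norm ((\<Sum>r<n. u r) / real n - c) < e"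
  proof (intro exI[of _ Q] allI impI)
    fix q assume q: "Q \<le> q"
    then have q0: "0 < real q" by (simp add: Q_def)
    have "2 * C / e < real q" using q unfolding Q_def by linarith
    then have Cq: "C / real q < e / 2" using e q0 by (simp add: field_simps)
    have "\<bar>\<Sum>r<q. u r - c\<bar> \<le> (\<Sum>r<q. \<bar>u r - c\<bar>)" by (rule sum_abs)
    also have "\<dots> \<le> (\<Sum>r<q. (if r < N then \<bar>u r - c\<bar> else 0) + e / 2)"
      using N e by (intro sum_mono) (auto simp: not_less less_imp_le)
    also have "\<dots> = (\<Sum>r<q. if r < N then \<bar>u r - c\<bar> else 0) + real q * (e / 2)"
      by (simp add: sum.distrib)
    also have "(\<Sum>r<q. if r < N then \<bar>u r - c\<bar> else 0) \<le> C"
    proof -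
      have "(\<Sum>r<q. if r < N then \<bar>u r - c\<bar> else 0) = (\<Sum>r\<in>{r \<in> {..<q}. r < N}. \<bar>u r - c\<bar>)"
        by (rule sum.inter_filter[symmetric]) simp
      also have "\<dots> \<le> C" unfolding C_def by (rule sum_mono2) auto
      finally show ?thesis .
    qed
    finally have *: "\<bar>\<Sum>r<q. u r - c\<bar> \<le> C + real q * (e / 2)" by simp
    have "(\<Sum>r<q. u r) / real q - c = (\<Sum>r<q. u r - c) / real q"
      using q0 by (simp add: sum_subtractf diff_divide_distrib)
    then have "norm ((\<Sum>r<q. u r) / real q - c) \<le> (C + real q * (e / 2)) / real q"
      using * q0 by (simp add: divide_right_mono)
    also have "\<dots> = C / real q + e / 2" using q0 by (simp add: add_divide_distrib)
    also have "\<dots> < e" using Cq by linarith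
    finally show "norm ((\<Sum>r<q. u r) / real q - c) < e" .
  qed
qed

lemma symmetric_partial_sums_tendsto:
  fixes g :: "int \<Rightarrow> real"
  assumes "g summable_on UNIV"
  shows "(\<lambda>r. \<Sum>h\<in>{- int r..int r}. g h) \<longlonglongrightarrow> (\<Sum>\<^sub>\<infinity>h. g h)"
proof -
  have "filterlim (\<lambda>r. {- int r..int r}) (finite_subsets_at_top (UNIV :: int set)) sequentially"
    unfolding filterlim_iff eventually_finite_subsets_at_top
  proof (intro allI impI)
    fix Pr :: "int set \<Rightarrow> bool" assume "\<exists>X. finite X \<and> X \<subseteq> UNIV \<and> (\<forall>Y. finite Y \<and> X \<subseteq> Y \<and> Y \<subseteq> UNIV \<longrightarrow> Pr Y)"
    then obtain X :: "int set" where X: "finite X" "\<And>Y. finite Y \<Longrightarrow> X \<subseteq> Y \<Longrightarrow> Pr Y" by auto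
    define R where "R = Max (insert 0 ((\<lambda>k. nat \<bar>k\<bar>) ` X))"
    show "\<forall>\<^sub>F r in sequentially. Pr {- int r..int r}"
      using eventually_ge_at_top[of R]
    proof eventually_elim
      case (elim r)
      have "X \<subseteq> {- int r..int r}"
      proof
        fix k assume k: "k \<in> X"
        then have "nat \<bar>k\<bar> \<le> R" unfolding R_def using X(1) by (intro Max_ge) auto
        then show "k \<in> {- int r..int r}" using elim by auto
      qed
      then show ?case by (intro X(2)) auto
    qed
  qed
  from filterlim_compose[OF has_sum_infsum[OF assms, unfolded has_sum_def] this] show ?thesis .
qed

text \<open>Enlarging the square by one row and one column adds each lag from \<open>- q\<close> to
  \<open>q\<close> once. The variance of a partial sum, divided by its length, is thereby a Cesaro
  mean of symmetric partial sums of the autocovariances.\<close>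

lemma sum_square_toeplitz:
  fixes g :: "int \<Rightarrow> real"
  shows "(\<Sum>s<q. \<Sum>t<q. g (int s - int t)) = (\<Sum>r<q. \<Sum>h\<in>{- int r..int r}. g h)"
proof (induction q)
  case (Suc q)
  have "(\<Sum>s<Suc q. \<Sum>t<Suc q. g (int s - int t))
      = (\<Sum>s<q. \<Sum>t<q. g (int s - int t)) + ((\<Sum>s<q. g (int s - int q)) + (\<Sum>t<Suc q. g (int q - int t)))"
    by (simp add: sum.distrib)
  also have "(\<Sum>s<q. g (int s - int q)) = (\<Sum>h\<in>{- int q..-1}. g h)"
    by (rule sum.reindex_bij_witness[of _ "\<lambda>h. nat (h + int q)" "\<lambda>s. int s - int q"]) auto
  also have "(\<Sum>t<Suc q. g (int q - int t)) = (\<Sum>h\<in>{0..int q}. g h)"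
    by (rule sum.reindex_bij_witness[of _ "\<lambda>h. nat (int q - h)" "\<lambda>t. int q - int t"]) auto
  also have "(\<Sum>h\<in>{- int q..-1}. g h) + (\<Sum>h\<in>{0..int q}. g h) = (\<Sum>h\<in>{- int q..int q}. g h)"
    by (subst sum.union_disjoint[symmetric]) (auto intro!: sum.cong)
  finally show ?case using Suc by simp
qed simp

lemma sum_blocks:
  fixes g :: "nat \<Rightarrow> nat \<Rightarrow> real"
  assumes b: "0 < b" "q \<le> b"
  shows "(\<Sum>t<n. if t mod b < q \<and> t div b < n div b then g (t div b) t else 0)
       = (\<Sum>i<n div b. \<Sum>r<q. g i (i * b + r))"
proof -
  have lt: "i * b + r < n" if "i < n div b" "r < q" for i r
  proof -
    have "i * b + r < Suc i * b" using that b by simp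
    also have "\<dots> \<le> n div b * b" using that by (intro mult_le_mono1) simp
    also have "\<dots> \<le> n" by simp
    finally show ?thesis .
  qed
  have "(\<Sum>t<n. if t mod b < q \<and> t div b < n div b then g (t div b) t else 0)
      = (\<Sum>t\<in>{t \<in> {..<n}. t mod b < q \<and> t div b < n div b}. g (t div b) t)"
    by (rule sum.inter_filter[symmetric]) simp
  also have "\<dots> = (\<Sum>(i, r)\<in>{..<n div b} \<times> {..<q}. g i (i * b + r))"
    using b lt by (intro sum.reindex_bij_witness[of _ "\<lambda>(i, r). i * b + r" "\<lambda>t. (t div b, t mod b)"]) auto
  also have "\<dots> = (\<Sum>i<n div b. \<Sum>r<q. g i (i * b + r))" by (rule sum.cartesian_product[symmetric])
  finally show ?thesis .
qed

definition block_coeff :: "nat \<Rightarrow> nat \<Rightarrow> nat \<Rightarrow> nat \<Rightarrow> nat \<Rightarrow> real" where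
  "block_coeff n m b i j = (if i = j then 0 else kern n m (int (i * b) - int (j * b)))"

text \<open>Used twice: with \<open>h\<close> the identity for the quadratic form itself, and with
  \<open>h\<close> the square and \<open>y\<close> constantly 1 for the Frobenius norm.
  \<open>h 0 = 0\<close> removes the gaps.\<close>

lemma block_kern_sum:
  fixes y :: "nat \<Rightarrow> real"
  assumes b: "0 < b" "q \<le> b" and h0: "h 0 = (0::real)"
  shows "(\<Sum>s<n. \<Sum>t<n. h (block_kern n m q b s t) * (y s * y t))
      = (\<Sum>i<n div b. \<Sum>j<n div b. h (block_coeff n m b i j) * ((\<Sum>r<q. y (i * b + r)) * (\<Sum>r<q. y (j * b + r))))"
proof -
  let ?good = "\<lambda>t. t mod b < q \<and> t div b < n div b"
  have eq: "h (block_kern n m q b s t) * (y s * y t)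
      = (if ?good s then if ?good t then h (block_coeff n m b (s div b) (t div b)) * (y s * y t) else 0 else 0)" for s t
    by (auto simp: block_kern_def block_coeff_def h0 mult.commute)
  have "(\<Sum>s<n. \<Sum>t<n. h (block_kern n m q b s t) * (y s * y t))
      = (\<Sum>s<n. if ?good s then \<Sum>t<n. if ?good t then h (block_coeff n m b (s div b) (t div b)) * (y s * y t) else 0 else 0)"
    unfolding eq by (intro sum.cong refl) auto
  also have "\<dots> = (\<Sum>s<n. if ?good s then \<Sum>j<n div b. \<Sum>r'<q. h (block_coeff n m b (s div b) j) * (y s * y (j * b + r')) else 0)"
    by (intro sum.cong refl if_cong sum_blocks[OF b])
  also have "\<dots> = (\<Sum>i<n div b. \<Sum>r<q. \<Sum>j<n div b. \<Sum>r'<q. h (block_coeff n m b i j) * (y (i * b + r) * y (j * b + r')))"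
    by (rule sum_blocks[OF b])
  also have "\<dots> = (\<Sum>i<n div b. \<Sum>j<n div b. \<Sum>r<q. \<Sum>r'<q. h (block_coeff n m b i j) * (y (i * b + r) * y (j * b + r')))"
    by (intro sum.cong refl sum.swap)
  finally show ?thesis by (simp only: sum_product) (simp only: sum_distrib_left)
qed

text \<open>The coefficient matrix is the kernel at the block starts minus \<open>kern n m 0\<close>
  times the identity; the two parts are bounded separately by
  \<open>(u - v)\<^sup>2 \<le> 2 * u\<^sup>2 + 2 * v\<^sup>2\<close>.\<close>

lemma block_coeff_operator_norm:
  assumes m: "1 \<le> m" "2 * m < n" and b: "0 < b"
  shows "(\<Sum>i<n div b. (\<Sum>j<n div b. block_coeff n m b i j * z j)\<^sup>2)
       \<le> (2 * (kappa m)\<^sup>2 + 2 * (kern n m 0)\<^sup>2) * (\<Sum>i<n div b. (z i)\<^sup>2)"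
proof -
  let ?N = "n div b"
  define y where "y i = (\<Sum>j<?N. kern n m (int (i * b) - int (j * b)) * z j)" for i
  have lt: "i * b < n" if "i < ?N" for i
  proof -
    have "i * b < Suc i * b" using b by simp
    also have "\<dots> \<le> ?N * b" using that by (intro mult_le_mono1) simp
    also have "\<dots> \<le> n" by simp
    finally show ?thesis .
  qed
  have eq: "(\<Sum>j<?N. block_coeff n m b i j * z j) = y i - kern n m 0 * z i" if "i < ?N" for i
  proof -
    have "y i = kern n m 0 * z i + (\<Sum>j\<in>{..<?N} - {i}. kern n m (int (i * b) - int (j * b)) * z j)"
      unfolding y_def using that by (subst sum.remove[of _ i]) auto
    moreover have "(\<Sum>j<?N. block_coeff n m b i j * z j) = (\<Sum>j\<in>{..<?N} - {i}. kern n m (int (i * b) - int (j * b)) * z j)"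
      using that by (subst sum.remove[of _ i]) (auto simp: block_coeff_def intro!: sum.cong)
    ultimately show ?thesis by simp
  qed
  have "(\<Sum>i<?N. (\<Sum>j<?N. block_coeff n m b i j * z j)\<^sup>2) = (\<Sum>i<?N. (y i - kern n m 0 * z i)\<^sup>2)"
    by (intro sum.cong refl) (simp add: eq)
  also have "\<dots> \<le> (\<Sum>i<?N. 2 * (y i)\<^sup>2 + 2 * (kern n m 0 * z i)\<^sup>2)"
  proof (rule sum_mono)
    fix i
    have "0 \<le> (y i + kern n m 0 * z i)\<^sup>2" by simp
    then show "(y i - kern n m 0 * z i)\<^sup>2 \<le> 2 * (y i)\<^sup>2 + 2 * (kern n m 0 * z i)\<^sup>2"
      by (simp only: power2_sum power2_diff)
  qed
  also have "\<dots> = 2 * (\<Sum>i<?N. (y i)\<^sup>2) + 2 * (kern n m 0)\<^sup>2 * (\<Sum>i<?N. (z i)\<^sup>2)"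
    by (simp add: sum.distrib sum_distrib_left power_mult_distrib mult_ac)
  also have "(\<Sum>i<?N. (y i)\<^sup>2) \<le> (kappa m)\<^sup>2 * (\<Sum>i<?N. (z i)\<^sup>2)"
    unfolding y_def using b lt by (intro kern_operator_norm[OF m]) (auto simp: inj_on_def)
  finally show ?thesis by (simp add: algebra_simps)
qed

context iid_space
begin

lemma variance_partial_sums_tendsto:
  assumes F: "in_Lp P 4 F"
    and summable: "(\<lambda>h. LINT x|P. F (sh h x) * F x) summable_on UNIV"
  shows "(\<lambda>q. (LINT x|P. (\<Sum>r<q. F (sh (int r + 1) x))\<^sup>2) / real q) \<longlonglongrightarrow> (\<Sum>\<^sub>\<infinity>h. LINT x|P. F (sh h x) * F x)"
proof -
  note [measurable] = in_LpD[OF F]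
  define g where "g h = (LINT x|P. F (sh h x) * F x)" for h
  have cov: "(LINT x|P. F (sh (int s + 1) x) * F (sh (int t + 1) x)) = g (int s - int t)" for s t
    using integral_sh[of "\<lambda>x. F (sh (int s - int t) x) * F x" "int t + 1"] by (simp add: g_def sh_sh)
  have int: "integrable P (\<lambda>x. F (sh u x) * F (sh v x))" for u v
    by (rule P.integrable_Lp[OF _ _ norm_Lp_2_mult(1)[OF Lp_sh(1)[OF F] Lp_sh(1)[OF F]]]) auto
  have "(LINT x|P. (\<Sum>r<q. F (sh (int r + 1) x))\<^sup>2) = (\<Sum>s<q. \<Sum>t<q. g (int s - int t))" for q
    using int by (simp add: power2_eq_square sum_product Bochner_Integration.integral_sum Bochner_Integration.integrable_sum cov)
  then have eq: "(LINT x|P. (\<Sum>r<q. F (sh (int r + 1) x))\<^sup>2) = (\<Sum>r<q. \<Sum>h\<in>{- int r..int r}. g h)" for q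
    by (simp add: sum_square_toeplitz)
  show ?thesis
    unfolding eq g_def[symmetric]
    by (intro cesaro_mean_tendsto symmetric_partial_sums_tendsto) (use summable in \<open>simp add: g_def[abs_def]\<close>)
qed

lemma off_diagonal_mean_zero:
  fixes W :: "'i \<Rightarrow> (int \<Rightarrow> 's) \<Rightarrow> real"
  assumes cb: "coupling_bound I W \<Theta>" and dep: "\<And>i. i \<in> I \<Longrightarrow> dep_on (A i) (W i)"
    and disj: "\<And>i j. i \<in> I \<Longrightarrow> j \<in> I \<Longrightarrow> i \<noteq> j \<Longrightarrow> A i \<inter> A j = {}"
    and diag: "\<And>i. i \<in> I \<Longrightarrow> c i i = 0"
  shows "(LINT x|P. (\<Sum>i\<in>I. \<Sum>j\<in>I. c i j * (W i x * W j x))) = 0"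
proof -
  note D = coupling_boundD[OF cb]
  have int: "integrable P (\<lambda>x. W i x * W j x)" if "i \<in> I" "j \<in> I" for i j
    by (rule P.integrable_Lp[OF _ _ norm_Lp_2_mult(1)[OF D(2) D(2)]]) (use that in auto)
  have zero: "c i j * (LINT x|P. W i x * W j x) = 0" if ij: "i \<in> I" "j \<in> I" for i j
  proof (cases "i = j")
    case True then show ?thesis using diag ij by simp
  next
    case False
    have "dep_on (- A i) (W j)" using dep_on_mono[OF dep[OF ij(2)]] disj[OF ij False] by blast
    from integral_indep_scaleR(2)[OF P.integrable_Lp[OF _ _ D(2)] dep P.integrable_Lp[OF _ _ D(2)] this]
    show ?thesis using ij D(3) by simp
  qed
  have "(LINT x|P. (\<Sum>i\<in>I. \<Sum>j\<in>I. c i j * (W i x * W j x))) = (\<Sum>i\<in>I. \<Sum>j\<in>I. c i j * (LINT x|P. W i x * W j x))"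
    using int by (simp add: Bochner_Integration.integral_sum Bochner_Integration.integrable_sum)
  also have "\<dots> = 0" by (intro sum.neutral ballI zero)
  finally show ?thesis .
qed

section \<open>From the process to independent block sums\<close>

lemma char_diff_le:
  assumes S: "in_Lp P 2 S" and T: "in_Lp P 2 T"
  shows "cmod ((CLINT x|P. iexp (l * S x)) - (CLINT x|P. iexp (l * T x))) \<le> \<bar>l\<bar> * norm_Lp P 2 (\<lambda>x. S x - T x)"
proof -
  note [measurable] = in_LpD[OF S] in_LpD[OF T]
  have ie: "integrable P (\<lambda>x. iexp (l * U x))" if [measurable]: "U \<in> borel_measurable P" for U
    using P.integrable_iexp_mult[of "\<lambda>x. l * U x" "\<lambda>x. 1"] by simp
  have D: "in_Lp P 2 (\<lambda>x. \<bar>S x - T x\<bar>)"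
    by (rule in_Lp_mono[OF _ in_Lp_diff[OF _ S T]]) auto
  have iD: "integrable P (\<lambda>x. \<bar>S x - T x\<bar>)" by (rule P.integrable_Lp[OF _ _ D]) auto
  have "(CLINT x|P. iexp (l * S x)) - (CLINT x|P. iexp (l * T x)) = (CLINT x|P. iexp (l * S x) - iexp (l * T x))"
    by (rule Bochner_Integration.integral_diff[OF ie ie, symmetric]) auto
  also have "cmod \<dots> \<le> (LINT x|P. \<bar>l\<bar> * \<bar>S x - T x\<bar>)"
  proof (rule norm_integral_le)
    show "integrable P (\<lambda>x. iexp (l * S x) - iexp (l * T x))" by (intro Bochner_Integration.integrable_diff ie) auto
    show "integrable P (\<lambda>x. \<bar>l\<bar> * \<bar>S x - T x\<bar>)" using iD by simp
    show "cmod (iexp (l * S x) - iexp (l * T x)) \<le> \<bar>l\<bar> * \<bar>S x - T x\<bar>" for x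
      using iexp_diff_le[of "l * S x" "l * T x"] by (simp only: right_diff_distrib[symmetric] abs_mult)
  qed
  also have "\<dots> = \<bar>l\<bar> * (LINT x|P. \<bar>S x - T x\<bar>)" by simp
  also have "(LINT x|P. \<bar>S x - T x\<bar>) \<le> norm_Lp P 2 (\<lambda>x. \<bar>S x - T x\<bar>)"
    using P.abs_expectation_le_norm_Lp[OF _ _ D] by auto
  also have "\<dots> = norm_Lp P 2 (\<lambda>x. S x - T x)" by (simp add: norm_Lp_def)
  finally show ?thesis by (simp add: mult_left_mono)
qed


text \<open>\<open>T\<close> is changed in three steps: \<open>X\<close> to \<open>Y\<close> in one
  factor, then in the other, then the kernel to the block kernel. The first two cost
  \<open>8 * \<Theta> * \<eta>\<close> times the Frobenius norm of the kernel each, the last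
  \<open>8 * \<Theta>\<^sup>2 * sqrt E\<close>. What remains is an off-diagonal form in block sums,
  bounded by \<open>q * B\<close>, with variance \<open>q * w\<close> and coupling bound
  \<open>q * \<Theta>\<close>. Each block coefficient fills \<open>q\<^sup>2\<close> entries, so
  \<open>K = Q / q\<^sup>2\<close> and the powers of \<open>q\<close> cancel in the
  variance.\<close>

lemma quadratic_form_char_approx:
  fixes n m q L :: nat and l B \<Theta> \<eta> :: real
  assumes F: "in_Lp P 4 F" "(LINT x|P. F x) = 0" "influence_sum_le F \<Theta>"
    and G: "G \<in> borel_measurable P" "\<And>x. \<bar>G x\<bar> \<le> B" "dep_on {- int L..int L} G" "(LINT x|P. G x) = 0"
      "influence_sum_le G \<Theta>"
    and FG: "influence_sum_le (\<lambda>x. F x - G x) \<eta>"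
    and m: "1 \<le> m" "2 * m < n" and q: "1 \<le> q"
  defines "X \<equiv> \<lambda>t x. F (sh (int t + 1) x)" and "Y \<equiv> \<lambda>t x. G (sh (int t + 1) x)"
    and "b \<equiv> q + 2 * L"
  defines "T \<equiv> \<lambda>x. \<Sum>s<n. \<Sum>t<n. kern n m (int s - int t) * (X s x * X t x)"
    and "E \<equiv> \<Sum>s<n. \<Sum>t<n. (kern n m (int s - int t) - block_kern n m q b s t)\<^sup>2"
    and "Q \<equiv> \<Sum>s<n. \<Sum>t<n. (block_kern n m q b s t)\<^sup>2"
    and "w \<equiv> (LINT x|P. (\<Sum>r<q. Y r x)\<^sup>2) / real q"
    and "\<rho> \<equiv> sqrt (2 * (kappa m)\<^sup>2 + 2 * (kern n m 0)\<^sup>2)"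
  defines "K \<equiv> Q / (real q)\<^sup>2"
  defines "D \<equiv> 6 * l\<^sup>2 * (real q * B) ^ 3 * (K * (2 * (real q * \<Theta>)\<^sup>2 + 8 * (real q * \<Theta>) ^ 4)) + 16 * \<bar>l\<bar> * (real q * w) * ((real q * \<Theta>)\<^sup>2 * sqrt K)"
  shows "cmod ((CLINT x|P. iexp (l * (T x - (LINT x|P. T x)))) - exp (- (l\<^sup>2 * (2 * w\<^sup>2 * Q) / 2)))
     \<le> \<bar>l\<bar> * (16 * \<Theta> * \<eta> * sqrt (1 / (8 * pi\<^sup>2)) + 8 * \<Theta>\<^sup>2 * sqrt E) + \<bar>l\<bar> * (\<rho> * D)"
    and "in_Lp P 2 T"
proof -
  note [measurable] = in_LpD[OF F(1)] G(1)
  define N where "N = n div b"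
  have n0: "0 < n" using m by simp
  have b: "0 < b" "q \<le> b" using q by (auto simp: b_def)
  have B: "0 \<le> B" using G(2)[of undefined] by linarith
  have G4: "in_Lp P 4 G" by (rule P.in_Lp_bounded[OF G(1,2)])
  have D4: "in_Lp P 4 (\<lambda>x. F x - G x)" by (intro in_Lp_diff F G4) simp
  have ED: "(LINT x|P. F x - G x) = 0"
    using F(2) G(4) P.integrable_Lp[OF _ _ F(1)] P.integrable_Lp[OF _ _ G4] by simp
  have inj: "inj_on (\<lambda>t. int t + 1) {..<n}" by (auto simp: inj_on_def)
  have cX: "coupling_bound {..<n} X \<Theta>"
    unfolding X_def by (rule coupling_bound_stationary[OF F _ inj]) simp
  have cY: "coupling_bound {..<n} Y \<Theta>"
    unfolding Y_def by (rule coupling_bound_stationary[OF G4 G(4,5) _ inj]) simp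
  define R where "R t x = X t x - Y t x" for t x
  have cR: "coupling_bound {..<n} R \<eta>"
    unfolding R_def[abs_def] X_def Y_def
    by (rule coupling_bound_stationary[OF D4 ED FG _ inj]) simp
  note \<Theta>0 = coupling_bound_nonneg[OF cX] and \<eta>0 = coupling_bound_nonneg[OF cR]
  let ?a = "\<lambda>s t. kern n m (int s - int t)"
  let ?A = "\<lambda>s t. block_kern n m q b s t"
  define Tb where "Tb x = (\<Sum>s<n. \<Sum>t<n. ?A s t * (Y s x * Y t x))" for x
  define U1 where "U1 x = (\<Sum>s<n. \<Sum>t<n. ?a s t * (R s x * X t x))" for x
  define U2 where "U2 x = (\<Sum>s<n. \<Sum>t<n. ?a s t * (Y s x * R t x))" for x
  define U3 where "U3 x = (\<Sum>s<n. \<Sum>t<n. (?a s t - ?A s t) * (Y s x * Y t x))" for x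
  have U: "in_Lp P 2 U1" "in_Lp P 2 U2" "in_Lp P 2 U3" "in_Lp P 2 Tb"
    unfolding U1_def[abs_def] U2_def[abs_def] U3_def[abs_def] Tb_def[abs_def]
    by (rule norm_quadratic_form(1)[OF cR cX] norm_quadratic_form(1)[OF cY cR] norm_quadratic_form(1)[OF cY cY])+
  show T2: "in_Lp P 2 T" unfolding T_def by (rule norm_quadratic_form(1)[OF cX cX])
  have iU: "integrable P U1" "integrable P U2" "integrable P U3" "integrable P Tb"
    using U by (auto intro: P.integrable_Lp[of 2])
  have a_norm: "(\<Sum>s<n. \<Sum>t<n. (?a s t)\<^sup>2) = 1 / (8 * pi\<^sup>2)"
    using n_kappa_kern_0[OF m] by (simp add: kern_sum_squares'[OF m])
  have nU1: "norm_Lp P 2 (\<lambda>x. U1 x - (LINT x|P. U1 x)) \<le> 8 * \<eta> * \<Theta> * sqrt (1 / (8 * pi\<^sup>2))"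
    unfolding U1_def a_norm[symmetric] by (rule norm_quadratic_form(2)[OF cR cX])
  have nU2: "norm_Lp P 2 (\<lambda>x. U2 x - (LINT x|P. U2 x)) \<le> 8 * \<Theta> * \<eta> * sqrt (1 / (8 * pi\<^sup>2))"
    unfolding U2_def a_norm[symmetric] by (rule norm_quadratic_form(2)[OF cY cR])
  have nU3: "norm_Lp P 2 (\<lambda>x. U3 x - (LINT x|P. U3 x)) \<le> 8 * \<Theta> * \<Theta> * sqrt E"
    unfolding U3_def E_def by (rule norm_quadratic_form(2)[OF cY cY])
  have T_eq: "T x = U1 x + U2 x + U3 x + Tb x" for x
    unfolding T_def U1_def U2_def U3_def Tb_def sum.distrib[symmetric]
    by (intro sum.cong refl) (simp add: R_def algebra_simps)

  text \<open>The gaps of length \<open>2 * L\<close> make the block sums of \<open>Y\<close> independent.\<close>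

  define W where "W i x = (\<Sum>r<q. Y (i * b + r) x)" for i x
  define A where "A i = {int (i * b) + 1 - int L..int (i * b) + int q + int L}" for i
  have Y_dep: "dep_on {int t + 1 - int L..int t + 1 + int L} (Y t)" for t
    unfolding Y_def by (rule dep_on_sh[OF G(3)]) auto
  have depW: "dep_on (A i) (W i)" for i
    unfolding W_def[abs_def] by (intro dep_on_sum dep_on_mono[OF Y_dep]) (auto simp: A_def)
  have disj': "A i \<inter> A j = {}" if "i < j" for i j
  proof -
    have "Suc i * b \<le> j * b" using that by (intro mult_le_mono1) simp
    then have "int (i * b) + int q + 2 * int L \<le> int (j * b)" unfolding b_def by (simp flip: of_nat_add of_nat_mult)
    then show ?thesis by (auto simp: A_def)
  qed
  have disj: "A i \<inter> A j = {}" if "i \<noteq> j" for i j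
    using that disj'[of i j] disj'[of j i] by (cases "i < j") auto
  have Y4: "in_Lp P 4 (Y t)" for t unfolding Y_def by (rule Lp_sh(1)[OF G4])
  have W_bound: "\<bar>W i x\<bar> \<le> real q * B" for i x
  proof -
    have "\<bar>W i x\<bar> \<le> (\<Sum>r<q. B)"
      unfolding W_def by (rule order.trans[OF sum_abs sum_mono]) (simp add: Y_def G(2))
    then show ?thesis by simp
  qed
  have cY': "coupling_bound T' Y \<Theta>" if "finite T'" for T'
    unfolding Y_def by (rule coupling_bound_stationary[OF G4 G(4,5) that]) (auto simp: inj_on_def)
  have W_infl: "influence 4 (W i) k \<le> (\<Sum>r<q. influence 4 (Y (i * b + r)) k)" for i k
    unfolding W_def[abs_def] by (intro influence_sum Y4) auto
  have cW: "coupling_bound {..<N} W (real q * \<Theta>)"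
    unfolding coupling_bound_def
  proof (intro conjI ballI allI impI)
    show "in_Lp P 4 (W i)" for i unfolding W_def[abs_def] by (intro in_Lp_sum Y4) auto
    show "(LINT x|P. W i x) = 0" for i
    proof -
      have "(LINT x|P. W i x) = (\<Sum>r<q. LINT x|P. Y (i * b + r) x)"
        unfolding W_def by (intro Bochner_Integration.integral_sum P.integrable_Lp[OF _ _ Y4]) auto
      then show ?thesis using G(4) by (simp add: Y_def integral_sh)
    qed
    show "(\<Sum>k\<in>J. influence 4 (W i) k) \<le> real q * \<Theta>" if J: "finite J" for i J
    proof -
      have "(\<Sum>k\<in>J. influence 4 (W i) k) \<le> (\<Sum>k\<in>J. \<Sum>r<q. influence 4 (Y (i * b + r)) k)"
        by (intro sum_mono W_infl)
      also have "\<dots> = (\<Sum>r<q. \<Sum>k\<in>J. influence 4 (Y (i * b + r)) k)" by (rule sum.swap)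
      also have "\<dots> \<le> (\<Sum>r<q. \<Theta>)"
        using coupling_boundD(4)[OF cY'[of "{_}"] _ J] by (intro sum_mono) auto
      finally show ?thesis by simp
    qed
    show "(\<Sum>i<N. influence 4 (W i) k) \<le> real q * \<Theta>" for k
    proof -
      have "(\<Sum>i<N. influence 4 (W i) k) \<le> (\<Sum>i<N. \<Sum>r<q. influence 4 (Y (i * b + r)) k)"
        by (intro sum_mono W_infl)
      also have "\<dots> = (\<Sum>r<q. \<Sum>i<N. influence 4 (Y (i * b + r)) k)" by (rule sum.swap)
      also have "\<dots> \<le> (\<Sum>r<q. \<Theta>)"
      proof (rule sum_mono)
        fix r
        \<comment> \<open>For a fixed offset \<open>r\<close> the times \<open>i * b + r\<close> are
          distinct, so each of the \<open>q\<close> offsets costs one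
          \<open>\<Theta>\<close>.\<close>
        have "(\<Sum>i<N. influence 4 (Y (i * b + r)) k) = (\<Sum>t\<in>(\<lambda>i. i * b + r) ` {..<N}. influence 4 (Y t) k)"
          using b by (subst sum.reindex) (auto simp: inj_on_def)
        also have "\<dots> \<le> \<Theta>" by (rule coupling_boundD(5)[OF cY']) simp
        finally show "(\<Sum>i<N. influence 4 (Y (i * b + r)) k) \<le> \<Theta>" .
      qed
      finally show ?thesis by simp
    qed
  qed simp
  have var: "(LINT x|P. (W i x)\<^sup>2) = real q * w" for i
  proof -
    have "W i x = (\<Sum>r<q. Y r (sh (int (i * b)) x))" for x
      by (simp add: W_def Y_def sh_sh add_ac)
    then have "(LINT x|P. (W i x)\<^sup>2) = (LINT x|P. (\<Sum>r<q. Y r x)\<^sup>2)"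
      using integral_sh[of "\<lambda>x. (\<Sum>r<q. Y r x)\<^sup>2" "int (i * b)"] in_LpD[OF Y4] by simp
    then show ?thesis using q by (simp add: w_def)
  qed
  let ?c = "block_coeff n m b"
  have Tb_eq: "Tb x = (\<Sum>i<N. \<Sum>j<N. ?c i j * (W i x * W j x))" for x
    unfolding Tb_def W_def N_def by (rule block_kern_sum[OF b, where h = "\<lambda>u. u"]) simp
  have Q_eq: "Q = (\<Sum>i<N. \<Sum>j<N. (?c i j)\<^sup>2) * (real q)\<^sup>2"
    using block_kern_sum[OF b, where h = "\<lambda>u. u\<^sup>2" and y = "\<lambda>_. 1" and n = n and m = m]
    by (simp add: Q_def N_def sum_distrib_right power2_eq_square)
  have K_eq: "(\<Sum>i<N. \<Sum>j<N. (?c i j)\<^sup>2) = K" using q by (simp add: K_def Q_eq)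
  have ETb: "(LINT x|P. Tb x) = 0"
    unfolding Tb_eq by (rule off_diagonal_mean_zero[OF cW depW disj]) (auto simp: block_coeff_def)
  have op: "(\<Sum>i<N. (\<Sum>j<N. ?c i j * z j)\<^sup>2) \<le> \<rho>\<^sup>2 * (\<Sum>i<N. (z i)\<^sup>2)" for z
    using block_coeff_operator_norm[OF m b(1), of z] by (simp add: \<rho>_def N_def)
  have \<rho>: "0 < \<rho>"
    unfolding \<rho>_def using kappa_pos[OF m] by (intro real_sqrt_gt_zero add_pos_nonneg) auto
  have w0: "0 \<le> real q * w" unfolding w_def by (auto intro!: mult_nonneg_nonneg divide_nonneg_nonneg integral_nonneg_AE)
  have sym: "?c i j = ?c j i" for i j
    using kern_minus[OF m, of "int (i * b) - int (j * b)"] by (simp add: block_coeff_def)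
  have clt: "cmod ((CLINT x|P. iexp (l * Tb x)) - exp (- (l\<^sup>2 * (2 * w\<^sup>2 * Q) / 2))) \<le> \<bar>l\<bar> * (\<rho> * D)"
  proof -
    have "2 * (real q * w)\<^sup>2 * K = 2 * w\<^sup>2 * Q"
      using q by (simp add: K_def power_mult_distrib)
    then show ?thesis
      using quadratic_form_char_bound[OF cW W_bound depW disj var sym _ op \<rho> w0, of l] q B
      unfolding Tb_eq[symmetric] K_eq by (simp add: D_def block_coeff_def)
  qed
  let ?T = "\<lambda>x. T x - (LINT x|P. T x)"
  have T': "in_Lp P 2 ?T" by (intro in_Lp_diff T2 P.in_Lp_const) simp
  \<comment> \<open>The block form has mean zero, so centering \<open>T\<close> amounts to centering
    the three error forms, which is what their norm bounds are about.\<close>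
  have ET: "(LINT x|P. T x) = (LINT x|P. U1 x) + (LINT x|P. U2 x) + (LINT x|P. U3 x)"
    unfolding T_eq using iU ETb by simp
  define U1' where "U1' x = U1 x - (LINT x|P. U1 x)" for x
  define U2' where "U2' x = U2 x - (LINT x|P. U2 x)" for x
  define U3' where "U3' x = U3 x - (LINT x|P. U3 x)" for x
  have U': "in_Lp P 2 U1'" "in_Lp P 2 U2'" "in_Lp P 2 U3'"
    unfolding U1'_def[abs_def] U2'_def[abs_def] U3'_def[abs_def] by (intro in_Lp_diff U P.in_Lp_const, simp)+
  have "norm_Lp P 2 (\<lambda>x. ?T x - Tb x) = norm_Lp P 2 (\<lambda>x. (U1' x + U2' x) + U3' x)"
  proof -
    have "?T x - Tb x = (U1' x + U2' x) + U3' x" for x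
      unfolding ET U1'_def U2'_def U3'_def using T_eq[of x] by linarith
    then show ?thesis by simp
  qed
  also have "\<dots> \<le> norm_Lp P 2 (\<lambda>x. U1' x + U2' x) + norm_Lp P 2 U3'"
    by (intro norm_Lp_triangle in_Lp_add U') auto
  also have "norm_Lp P 2 (\<lambda>x. U1' x + U2' x) \<le> norm_Lp P 2 U1' + norm_Lp P 2 U2'"
    by (intro norm_Lp_triangle U') auto
  also have "norm_Lp P 2 U1' + norm_Lp P 2 U2' + norm_Lp P 2 U3'
      \<le> 8 * \<eta> * \<Theta> * sqrt (1 / (8 * pi\<^sup>2)) + 8 * \<Theta> * \<eta> * sqrt (1 / (8 * pi\<^sup>2)) + 8 * \<Theta> * \<Theta> * sqrt E"
    using nU1 nU2 nU3 by (simp only: U1'_def[abs_def] U2'_def[abs_def] U3'_def[abs_def] add_mono)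
  also have "\<dots> = 16 * \<Theta> * \<eta> * sqrt (1 / (8 * pi\<^sup>2)) + 8 * \<Theta>\<^sup>2 * sqrt E"
    by (simp add: power2_eq_square)
  finally have diff: "norm_Lp P 2 (\<lambda>x. ?T x - Tb x) \<le> 16 * \<Theta> * \<eta> * sqrt (1 / (8 * pi\<^sup>2)) + 8 * \<Theta>\<^sup>2 * sqrt E"
    by simp
  have "cmod ((CLINT x|P. iexp (l * ?T x)) - (CLINT x|P. iexp (l * Tb x)))
      \<le> \<bar>l\<bar> * (16 * \<Theta> * \<eta> * sqrt (1 / (8 * pi\<^sup>2)) + 8 * \<Theta>\<^sup>2 * sqrt E)"
    by (rule order.trans[OF char_diff_le[OF T' U(4)] mult_left_mono[OF diff]]) simp
  then show "cmod ((CLINT x|P. iexp (l * ?T x)) - exp (- (l\<^sup>2 * (2 * w\<^sup>2 * Q) / 2)))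
     \<le> \<bar>l\<bar> * (16 * \<Theta> * \<eta> * sqrt (1 / (8 * pi\<^sup>2)) + 8 * \<Theta>\<^sup>2 * sqrt E) + \<bar>l\<bar> * (\<rho> * D)"
    using clt by (rule norm_diff_triangle_le)
qed

text \<open>Standard deviations are compared because they obey the triangle inequality. The linear
  form bound with unit coefficients gives \<open>2 * \<eta> * sqrt q\<close>, so after normalisation
  the error does not depend on \<open>q\<close>, which is chosen after
  \<open>\<eta>\<close>.\<close>

lemma block_variance_close:
  assumes F: "in_Lp P 4 F" "(LINT x|P. F x) = 0"
    and G: "in_Lp P 4 G" "(LINT x|P. G x) = 0"
    and FG: "influence_sum_le (\<lambda>x. F x - G x) \<eta>" and q: "1 \<le> q"
  shows "\<bar>sqrt ((LINT x|P. (\<Sum>r<q. G (sh (int r + 1) x))\<^sup>2) / real q)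
      - sqrt ((LINT x|P. (\<Sum>r<q. F (sh (int r + 1) x))\<^sup>2) / real q)\<bar> \<le> 2 * \<eta>"
proof -
  let ?S = "\<lambda>F x. \<Sum>r<q. F (sh (int r + 1) x)"
  have D4: "in_Lp P 4 (\<lambda>x. F x - G x)" by (intro in_Lp_diff F G) simp
  have ED: "(LINT x|P. F x - G x) = 0"
    using F(2) G(2) P.integrable_Lp[OF _ _ F(1)] P.integrable_Lp[OF _ _ G(1)] by simp
  have cR: "coupling_bound {..<q} (\<lambda>t x. F (sh (int t + 1) x) - G (sh (int t + 1) x)) \<eta>"
    by (rule coupling_bound_stationary[OF D4 ED FG]) (auto simp: inj_on_def)
  have S4: "in_Lp P 4 (?S H)" if "in_Lp P 4 H" for H
    using that by (intro in_Lp_sum Lp_sh(1)) auto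
  note S2 = P.in_Lp_2[OF S4]
  have nD: "norm_Lp P 2 (\<lambda>x. ?S F x - ?S G x) \<le> 2 * \<eta> * sqrt (real q)"
  proof -
    have "norm_Lp P 2 (\<lambda>x. ?S F x - ?S G x) \<le> norm_Lp P 4 (\<lambda>x. ?S F x - ?S G x)"
      by (intro P.norm_Lp_2_le in_Lp_diff S4 F G) simp
    also have "\<dots> \<le> 2 * \<eta> * sqrt (real q)"
      using norm_linear_form_le[OF cR, of "\<lambda>_. 1"] by (simp add: sum_subtractf)
    finally show ?thesis .
  qed
  have sq: "sqrt ((LINT x|P. (?S H x)\<^sup>2) / real q) = norm_Lp P 2 (?S H) / sqrt (real q)" for H
    by (simp add: norm_Lp_def real_root_divide sqrt_def)
  have e2: "even (2::nat)" "0 < (2::nat)" by auto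
  have 1: "norm_Lp P 2 (?S F) \<le> norm_Lp P 2 (\<lambda>x. ?S F x - ?S G x) + norm_Lp P 2 (?S G)"
    using norm_Lp_triangle[OF e2 in_Lp_diff[OF e2(1) S2[OF F(1)] S2[OF G(1)]] S2[OF G(1)]] by simp
  have 2: "norm_Lp P 2 (?S G) \<le> norm_Lp P 2 (?S F) + norm_Lp P 2 (\<lambda>x. ?S F x - ?S G x)"
    using norm_Lp_triangle_diff[OF e2 S2[OF F(1)] in_Lp_diff[OF e2(1) S2[OF F(1)] S2[OF G(1)]]] by simp
  have "\<bar>norm_Lp P 2 (?S G) - norm_Lp P 2 (?S F)\<bar> \<le> 2 * \<eta> * sqrt (real q)"
    using 1 2 nD by linarith
  then have "\<bar>norm_Lp P 2 (?S G) - norm_Lp P 2 (?S F)\<bar> / sqrt (real q) \<le> 2 * \<eta>"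
    using q by (simp add: divide_le_eq)
  then show ?thesis unfolding sq by (simp add: diff_divide_distrib[symmetric])
qed

end

section \<open>The limit theorem\<close>

lemma frobenius_norm_diff:
  fixes f g :: "nat \<Rightarrow> nat \<Rightarrow> real"
  shows "\<bar>sqrt (\<Sum>s<n. \<Sum>t<n. (f s t)\<^sup>2) - sqrt (\<Sum>s<n. \<Sum>t<n. (g s t)\<^sup>2)\<bar>
      \<le> sqrt (\<Sum>s<n. \<Sum>t<n. (f s t - g s t)\<^sup>2)"
proof -
  let ?A = "{..<n} \<times> {..<n}"
  have eq: "sqrt (\<Sum>s<n. \<Sum>t<n. (h s t)\<^sup>2) = L2_set (\<lambda>z. h (fst z) (snd z)) ?A" for h :: "nat \<Rightarrow> nat \<Rightarrow> real"
    by (simp add: L2_set_def sum.cartesian_product case_prod_beta')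
  have "L2_set (\<lambda>z. f (fst z) (snd z)) ?A
      \<le> L2_set (\<lambda>z. f (fst z) (snd z) - g (fst z) (snd z)) ?A + L2_set (\<lambda>z. g (fst z) (snd z)) ?A"
    using L2_set_triangle_ineq[of "\<lambda>z. f (fst z) (snd z) - g (fst z) (snd z)" "\<lambda>z. g (fst z) (snd z)" ?A] by simp
  moreover have "L2_set (\<lambda>z. g (fst z) (snd z)) ?A
      \<le> L2_set (\<lambda>z. g (fst z) (snd z) - f (fst z) (snd z)) ?A + L2_set (\<lambda>z. f (fst z) (snd z)) ?A"
    using L2_set_triangle_ineq[of "\<lambda>z. g (fst z) (snd z) - f (fst z) (snd z)" "\<lambda>z. f (fst z) (snd z)" ?A] by simp
  moreover have "L2_set (\<lambda>z. g (fst z) (snd z) - f (fst z) (snd z)) ?A = L2_set (\<lambda>z. f (fst z) (snd z) - g (fst z) (snd z)) ?A"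
    by (simp add: L2_set_def power2_commute)
  ultimately show ?thesis unfolding eq by linarith
qed

text \<open>The second limit is that of the operator norm: \<open>kappa m\<close> is a multiple of
  \<open>1 / sqrt m\<close>, and \<open>kern n m 0\<close> of
  \<open>(m / n) / sqrt m\<close>.\<close>

lemma bandwidth_limits:
  fixes m :: "nat \<Rightarrow> nat"
  assumes m: "filterlim m at_top sequentially" and mn: "(\<lambda>n. real (m n) / real n) \<longlonglongrightarrow> 0"
  shows "\<forall>\<^sub>F n in sequentially. 1 \<le> m n \<and> 2 * m n < n"
    and "(\<lambda>n. sqrt (2 * (kappa (m n))\<^sup>2 + 2 * (kern n (m n) 0)\<^sup>2)) \<longlonglongrightarrow> 0"
proof -
  have ev1: "\<forall>\<^sub>F n in sequentially. 1 \<le> m n" using m by (simp add: filterlim_at_top)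
  have ev2: "\<forall>\<^sub>F n in sequentially. real (m n) / real n < 1 / 2"
    using order_tendstoD(2)[OF mn, of "1 / 2"] by simp
  show ev: "\<forall>\<^sub>F n in sequentially. 1 \<le> m n \<and> 2 * m n < n"
    using ev1 ev2 eventually_gt_at_top[of 0]
  proof eventually_elim
    case (elim n)
    then have "2 * real (m n) < real n" by (simp add: divide_less_eq)
    then show ?case using elim by linarith
  qed
  have sm: "filterlim (\<lambda>n. sqrt (real (m n))) at_top sequentially"
    by (rule filterlim_compose[OF sqrt_at_top filterlim_compose[OF filterlim_real_sequentially m]])
  have inv: "(\<lambda>n. 1 / sqrt (real (m n))) \<longlonglongrightarrow> 0"
    using tendsto_inverse_0_at_top[OF sm] by (simp add: inverse_eq_divide)
  have k: "(\<lambda>n. kappa (m n)) \<longlonglongrightarrow> 0"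
    using tendsto_mult[OF tendsto_const inv, of "1 / (4 * pi)"] by (simp add: kappa_def)
  have "(\<lambda>n. (real (m n) / real n) * (1 / sqrt (real (m n))) * (1 / (2 * pi))) \<longlonglongrightarrow> 0 * 0 * (1 / (2 * pi))"
    by (intro tendsto_intros mn inv)
  then have "(\<lambda>n. kern n (m n) 0) \<longlonglongrightarrow> 0"
    by (simp add: kern_def mult_ac)
  then have "(\<lambda>n. sqrt (2 * (kappa (m n))\<^sup>2 + 2 * (kern n (m n) 0)\<^sup>2)) \<longlonglongrightarrow> sqrt (2 * 0\<^sup>2 + 2 * 0\<^sup>2)"
    by (intro tendsto_intros k)
  then show "(\<lambda>n. sqrt (2 * (kappa (m n))\<^sup>2 + 2 * (kern n (m n) 0)\<^sup>2)) \<longlonglongrightarrow> 0" by simp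
qed

text \<open>In the limit only the proportion \<open>2 * L / (q + 2 * L)\<close> of gap times
  remains, at most \<open>2 * d\<close>; it contributes at most
  \<open>4 * d / (8 * pi\<^sup>2)\<close>, which is below \<open>d\<close>.\<close>

lemma block_kern_error_eventually:
  fixes m :: "nat \<Rightarrow> nat" and q L :: nat
  assumes m: "filterlim m at_top sequentially" and mn: "(\<lambda>n. real (m n) / real n) \<longlonglongrightarrow> 0"
    and q: "1 \<le> q" and d: "0 < d" "real L / real (q + 2 * L) \<le> d"
  shows "\<forall>\<^sub>F n in sequentially.
    (\<Sum>s<n. \<Sum>t<n. (kern n (m n) (int s - int t) - block_kern n (m n) q (q + 2 * L) s t)\<^sup>2) < d"
proof -
  define b where "b = q + 2 * L"
  have b: "0 < b" "q \<le> b" "real (b - q) / real b \<le> 2 * d"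
    using q d by (auto simp: b_def field_simps)
  define u where "u n = 1 / (8 * pi\<^sup>2) * (2 * (real b / real n + real (b - q) / real b)
      + (2 * real q + 1) * ((real q)\<^sup>2 * (2 * pi * (real (m n) / real n))\<^sup>2))
       + real b * (real (m n) / real n) / (4 * pi\<^sup>2)" for n
  have bn: "(\<lambda>n. real b / real n) \<longlonglongrightarrow> 0" by (rule lim_const_over_n)
  have "u \<longlonglongrightarrow> 1 / (8 * pi\<^sup>2) * (2 * (0 + real (b - q) / real b) + (2 * real q + 1) * ((real q)\<^sup>2 * (2 * pi * 0)\<^sup>2))
       + real b * 0 / (4 * pi\<^sup>2)"
    unfolding u_def[abs_def] by (intro tendsto_intros bn mn) auto
  then have lim: "u \<longlonglongrightarrow> 1 / (8 * pi\<^sup>2) * (2 * (real (b - q) / real b))" by simp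
  have "1 / (8 * pi\<^sup>2) * (2 * (real (b - q) / real b)) \<le> 1 / (8 * pi\<^sup>2) * (2 * (2 * d))"
    using b by (intro mult_left_mono) auto
  also have "\<dots> < d"
  proof -
    have "1 < pi\<^sup>2" using pi_gt3 by (simp add: power2_eq_square) (use mult_strict_mono[of 1 pi 1 pi] in linarith)
    then show ?thesis using d(1) by (simp add: field_simps)
  qed
  finally have "\<forall>\<^sub>F n in sequentially. u n < d" by (rule order_tendstoD(2)[OF lim])
  then show ?thesis
    using bandwidth_limits(1)[OF m mn]
  proof eventually_elim
    case (elim n)
    then have mn': "1 \<le> m n" "2 * m n < n" by auto
    have "(\<Sum>s<n. \<Sum>t<n. (kern n (m n) (int s - int t) - block_kern n (m n) q b s t)\<^sup>2) \<le> u n"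
      using block_kern_error[OF mn' b(1,2)] by (simp add: u_def mult_ac)
    then show ?case using elim unfolding b_def by linarith
  qed
qed

context iid_space
begin

text \<open>The order of choices matters: first \<open>\<eta>\<close>, which bounds the
  approximation errors uniformly; then \<open>G\<close> with its \<open>L\<close> and
  \<open>B\<close>; then \<open>q\<close>, large compared with \<open>L\<close> and so that the
  block variance is near its limit; finally \<open>n\<close>, whose growth removes everything that
  depends on \<open>q\<close>, \<open>L\<close> and \<open>B\<close>.\<close>

lemma quadratic_form_char_tendsto:
  fixes m :: "nat \<Rightarrow> nat"
  assumes F: "in_Lp P 4 F" "(LINT x|P. F x) = 0" "influence_sum_le F \<Theta>"
    and summable: "(\<lambda>h. LINT x|P. F (sh h x) * F x) summable_on UNIV"
    and m: "filterlim m at_top sequentially" and mn: "(\<lambda>n. real (m n) / real n) \<longlonglongrightarrow> 0"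
  defines "T \<equiv> \<lambda>n x. \<Sum>s<n. \<Sum>t<n. kern n (m n) (int s - int t) * (F (sh (int s + 1) x) * F (sh (int t + 1) x))"
    and "\<sigma> \<equiv> (\<Sum>\<^sub>\<infinity>h. LINT x|P. F (sh h x) * F x)"
  shows "(\<lambda>n. CLINT x|P. iexp (l * (T n x - (LINT x|P. T n x)))) \<longlonglongrightarrow> exp (- (l\<^sup>2 * (\<sigma> / (2 * pi))\<^sup>2 / 2))"
proof (rule tendstoI)
  fix e :: real assume e: "0 < e"
  define c0 where "c0 = sqrt (1 / (8 * pi\<^sup>2))"
  have c0: "0 \<le> c0" by (simp add: c0_def)
  define vF where "vF q = (LINT x|P. (\<Sum>r<q. F (sh (int r + 1) x))\<^sup>2) / real q" for q
  have vF: "vF \<longlonglongrightarrow> \<sigma>" unfolding vF_def[abs_def] \<sigma>_def by (rule variance_partial_sums_tendsto[OF F(1) summable])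
  have vF0: "0 \<le> vF q" for q unfolding vF_def by (auto intro!: divide_nonneg_nonneg integral_nonneg_AE)
  have \<sigma>0: "0 \<le> \<sigma>" by (rule LIMSEQ_le_const[OF vF]) (use vF0 in auto)
  have \<Theta>0: "0 \<le> \<Theta>"
    using F(3)[unfolded influence_sum_le_def, rule_format, of "{}"] by simp
  define C1 where "C1 = \<bar>l\<bar> * (16 * \<Theta> * c0 + 8 * \<Theta>\<^sup>2)"
  have C1: "0 \<le> C1" using \<Theta>0 c0 by (auto simp: C1_def)
  \<comment> \<open>The Gaussian limit as a function of the standard deviation \<open>sqrt w\<close>
    and the Frobenius norm \<open>sqrt Q\<close>, the two quantities for which closeness is
    available; the exponent is \<open>w\<^sup>2 * Q\<close> in these variables.\<close>
  define H where "H z = exp (- (l\<^sup>2 * (fst z ^ 4 * (snd z)\<^sup>2)))" for z :: "real \<times> real"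
  have H0: "H (sqrt \<sigma>, c0) = exp (- (l\<^sup>2 * (\<sigma> / (2 * pi))\<^sup>2 / 2))"
  proof -
    have "sqrt \<sigma> ^ 4 = (sqrt \<sigma> ^ 2) ^ 2" by simp
    also have "\<dots> = \<sigma>\<^sup>2" using \<sigma>0 by simp
    finally have "sqrt \<sigma> ^ 4 * c0\<^sup>2 = (\<sigma> / (2 * pi))\<^sup>2 / 2"
      by (simp add: c0_def power_divide power_mult_distrib)
    then show ?thesis by (simp add: H_def)
  qed
  have contH: "isCont H (sqrt \<sigma>, c0)" unfolding H_def by (intro continuous_intros)
  have "0 < e / 3" using e by simp
  with contH have "\<exists>d>0. \<forall>z. dist z (sqrt \<sigma>, c0) < d \<longrightarrow> dist (H z) (H (sqrt \<sigma>, c0)) < e / 3"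
    unfolding continuous_at_eps_delta by (elim allE impE)
  then obtain \<delta> where \<delta>: "0 < \<delta>" "\<forall>z. dist z (sqrt \<sigma>, c0) < \<delta> \<longrightarrow> dist (H z) (H (sqrt \<sigma>, c0)) < e / 3"
    by (elim exE conjE)
  \<comment> \<open>The first bound keeps the approximation error \<open>C1 * \<eta>\<close> below
    \<open>e / 3\<close>; the second serves the distance to the limit point of \<open>H\<close>,
    which is at most \<open>3 * \<eta> + \<eta>\<close>.\<close>
  define \<eta> where "\<eta> = min (e / (3 * (C1 + 1))) (\<delta> / 5)"
  have \<eta>: "0 < \<eta>" "4 * \<eta> < \<delta>" using e C1 \<delta>(1) by (auto simp: \<eta>_def min_def field_simps)
  have C1\<eta>: "C1 * \<eta> < e / 3"
  proof -
    have "C1 * \<eta> < (C1 + 1) * \<eta>" using \<eta> by simp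
    also have "\<dots> \<le> (C1 + 1) * (e / (3 * (C1 + 1)))" using C1 by (intro mult_left_mono) (auto simp: \<eta>_def)
    also have "\<dots> = e / 3" using C1 by (simp add: field_simps)
    finally show ?thesis .
  qed
  obtain G L B where G: "G \<in> borel_measurable P" "\<forall>x. \<bar>G x\<bar> \<le> B" "dep_on {- int L..int L} G"
      "(LINT x|P. G x) = 0" "influence_sum_le G \<Theta>" and FG: "influence_sum_le (\<lambda>x. F x - G x) \<eta>"
    using bounded_finite_range_approximation[OF F \<eta>(1)] by (elim exE conjE)
  have Gb: "\<bar>G x\<bar> \<le> B" for x using G(2) by blast
  have B0: "0 \<le> B" using Gb[of undefined] by linarith
  have G4: "in_Lp P 4 G" by (rule P.in_Lp_bounded[OF G(1) Gb])
  have "\<forall>\<^sub>F q in sequentially. dist (sqrt (vF q)) (sqrt \<sigma>) < \<eta>"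
    by (rule tendstoD[OF tendsto_real_sqrt[OF vF] \<eta>(1)])
  moreover have "\<forall>\<^sub>F q in sequentially. real L / \<eta>\<^sup>2 \<le> real q"
    using filterlim_real_sequentially by (simp add: filterlim_at_top)
  ultimately have "\<forall>\<^sub>F q in sequentially. dist (sqrt (vF q)) (sqrt \<sigma>) < \<eta> \<and> real L / \<eta>\<^sup>2 \<le> real q \<and> 1 \<le> q"
    using eventually_ge_at_top[of 1] by eventually_elim simp
  then obtain q where q: "dist (sqrt (vF q)) (sqrt \<sigma>) < \<eta>" "real L / \<eta>\<^sup>2 \<le> real q" "1 \<le> q"
    by (auto simp: eventually_sequentially)
  define w where "w = (LINT x|P. (\<Sum>r<q. G (sh (int r + 1) x))\<^sup>2) / real q"
  have w0: "0 \<le> w" unfolding w_def by (auto intro!: divide_nonneg_nonneg integral_nonneg_AE)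
  have x: "\<bar>sqrt w - sqrt \<sigma>\<bar> \<le> 3 * \<eta>"
    using block_variance_close[OF F(1,2) G4 G(4) FG q(3)] q(1) by (simp add: w_def vF_def dist_real_def)
  have Lb: "real L / real (q + 2 * L) \<le> \<eta>\<^sup>2"
  proof -
    have "real L \<le> \<eta>\<^sup>2 * real q" using q(2) \<eta>(1) by (simp add: divide_le_eq mult.commute)
    also have "\<dots> \<le> \<eta>\<^sup>2 * real (q + 2 * L)" by (intro mult_left_mono) auto
    finally show ?thesis using q(3) by (subst pos_divide_le_eq) auto
  qed
  define E where "E n = (\<Sum>s<n. \<Sum>t<n. (kern n (m n) (int s - int t) - block_kern n (m n) q (q + 2 * L) s t)\<^sup>2)" for n
  define Q where "Q n = (\<Sum>s<n. \<Sum>t<n. (block_kern n (m n) q (q + 2 * L) s t)\<^sup>2)" for n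
  define D where "D K = 6 * l\<^sup>2 * (real q * B) ^ 3 * (K * (2 * (real q * \<Theta>)\<^sup>2 + 8 * (real q * \<Theta>) ^ 4))
      + 16 * \<bar>l\<bar> * (real q * w) * ((real q * \<Theta>)\<^sup>2 * sqrt K)" for K
  define \<rho> where "\<rho> n = sqrt (2 * (kappa (m n))\<^sup>2 + 2 * (kern n (m n) 0)\<^sup>2)" for n
  \<comment> \<open>\<open>D\<close> is increasing, and \<open>sqrt (Q n)\<close> is eventually at
    most \<open>c0 + \<eta>\<close>; so the factor of \<open>\<rho> n\<close> is bounded uniformly
    in \<open>n\<close>.\<close>
  define Dmax where "Dmax = D ((c0 + \<eta>)\<^sup>2 / (real q)\<^sup>2)"
  have "(\<lambda>n. \<bar>l\<bar> * (\<rho> n * Dmax)) \<longlonglongrightarrow> \<bar>l\<bar> * (0 * Dmax)"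
    unfolding \<rho>_def by (intro tendsto_intros bandwidth_limits(2)[OF m mn])
  then have ev\<rho>: "\<forall>\<^sub>F n in sequentially. \<bar>l\<bar> * (\<rho> n * Dmax) < e / 3"
    using order_tendstoD(2)[of _ 0 sequentially "e / 3"] e by simp
  have evE: "\<forall>\<^sub>F n in sequentially. E n < \<eta>\<^sup>2"
    unfolding E_def by (rule block_kern_error_eventually[OF m mn q(3) _ Lb]) (use \<eta> in simp)
  show "\<forall>\<^sub>F n in sequentially. dist (CLINT x|P. iexp (l * (T n x - (LINT x|P. T n x))))
      (exp (- (l\<^sup>2 * (\<sigma> / (2 * pi))\<^sup>2 / 2))) < e"
    using ev\<rho> evE bandwidth_limits(1)[OF m mn]
  proof eventually_elim
    case (elim n)
    then have mn': "1 \<le> m n" "2 * m n < n" by auto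
    have Q0: "0 \<le> Q n" unfolding Q_def by (intro sum_nonneg) auto
    have "sqrt (E n) \<le> sqrt (\<eta>\<^sup>2)" using elim by (intro real_sqrt_le_mono) simp
    then have sE: "sqrt (E n) \<le> \<eta>" using \<eta> by simp
    have "(\<Sum>s<n. \<Sum>t<n. (kern n (m n) (int s - int t))\<^sup>2) = 1 / (8 * pi\<^sup>2)"
      using n_kappa_kern_0[OF mn'] by (simp add: kern_sum_squares'[OF mn'])
    then have y: "\<bar>sqrt (Q n) - c0\<bar> \<le> \<eta>"
      using frobenius_norm_diff[of "\<lambda>s t. kern n (m n) (int s - int t)" n "block_kern n (m n) q (q + 2 * L)"] sE
      unfolding E_def[symmetric] Q_def[symmetric] by (simp add: c0_def)
    have QD: "D (Q n / (real q)\<^sup>2) \<le> Dmax"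
    proof -
      have "sqrt (Q n) \<le> c0 + \<eta>" using y by linarith
      then have "(sqrt (Q n))\<^sup>2 \<le> (c0 + \<eta>)\<^sup>2" using Q0 by (intro power_mono) auto
      then have "Q n / (real q)\<^sup>2 \<le> (c0 + \<eta>)\<^sup>2 / (real q)\<^sup>2" using Q0 by (intro divide_right_mono) auto
      then show ?thesis
        unfolding Dmax_def D_def using B0 w0 \<Theta>0 Q0
        by (intro add_mono mult_left_mono mult_right_mono real_sqrt_le_mono) auto
    qed
    have \<rho>0: "0 \<le> \<rho> n" by (simp add: \<rho>_def)
    have close: "dist (sqrt w, sqrt (Q n)) (sqrt \<sigma>, c0) < \<delta>"
    proof -
      have "dist (sqrt w, sqrt (Q n)) (sqrt \<sigma>, c0) \<le> \<bar>sqrt w - sqrt \<sigma>\<bar> + \<bar>sqrt (Q n) - c0\<bar>"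
        unfolding dist_Pair_Pair dist_real_def by (rule order.trans[OF sqrt_sum_squares_le_sum_abs]) simp
      then show ?thesis using x y \<eta> by linarith
    qed
    have H_eq: "H (sqrt w, sqrt (Q n)) = exp (- (l\<^sup>2 * (2 * w\<^sup>2 * Q n) / 2))"
    proof -
      have "sqrt w ^ 4 = (sqrt w ^ 2) ^ 2" by simp
      also have "\<dots> = w\<^sup>2" using w0 by simp
      finally show ?thesis using Q0 by (simp add: H_def)
    qed
    let ?\<phi> = "CLINT x|P. iexp (l * (T n x - (LINT x|P. T n x)))"
    have "cmod (?\<phi> - exp (- (l\<^sup>2 * (2 * w\<^sup>2 * Q n) / 2)))
        \<le> \<bar>l\<bar> * (16 * \<Theta> * \<eta> * c0 + 8 * \<Theta>\<^sup>2 * sqrt (E n)) + \<bar>l\<bar> * (\<rho> n * D (Q n / (real q)\<^sup>2))"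
      using quadratic_form_char_approx(1)[OF F G(1) Gb G(3-5) FG mn' q(3), of l]
      unfolding T_def E_def Q_def D_def w_def \<rho>_def c0_def .
    also have "\<dots> \<le> \<bar>l\<bar> * (16 * \<Theta> * \<eta> * c0 + 8 * \<Theta>\<^sup>2 * \<eta>) + \<bar>l\<bar> * (\<rho> n * Dmax)"
      by (intro add_mono mult_left_mono order_refl sE QD \<rho>0) auto
    also have "\<bar>l\<bar> * (16 * \<Theta> * \<eta> * c0 + 8 * \<Theta>\<^sup>2 * \<eta>) = C1 * \<eta>" by (simp add: C1_def algebra_simps)
    also have "C1 * \<eta> + \<bar>l\<bar> * (\<rho> n * Dmax) < e / 3 + e / 3" using C1\<eta> elim by linarith
    finally have 1: "cmod (?\<phi> - complex_of_real (H (sqrt w, sqrt (Q n)))) < e / 3 + e / 3"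
      by (simp add: H_eq exp_of_real)
    have 2: "cmod (complex_of_real (H (sqrt w, sqrt (Q n))) - complex_of_real (H (sqrt \<sigma>, c0))) < e / 3"
      using \<delta>(2)[rule_format, OF close] by (simp add: dist_real_def flip: of_real_diff)
    have "cmod (?\<phi> - complex_of_real (H (sqrt \<sigma>, c0))) < e / 3 + e / 3 + e / 3"
      by (rule norm_diff_triangle_less[OF 1 2])
    then show ?case unfolding dist_norm H0 by (simp flip: exp_of_real)
  qed
qed

end

section \<open>Reduction of the theorem to the quadratic form\<close>

lemma cmod_sum_exp_squared:
  fixes x :: "nat \<Rightarrow> real" and w :: real
  shows "(cmod (\<Sum>t\<in>I. of_real (x t) * exp (- \<i> * of_nat t * of_real w)))\<^sup>2
     = (\<Sum>s\<in>I. \<Sum>t\<in>I. cos (of_int (int s - int t) * w) * (x s * x t))"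
proof -
  let ?z = "\<Sum>t\<in>I. of_real (x t) * exp (- \<i> * of_nat t * of_real w)"
  have exp_eq: "exp (- (\<i> * of_nat t * of_real w)) = cis (- (real t * w))" for t
    by (simp add: cis_conv_exp mult.assoc)
  have "Re ?z = (\<Sum>t\<in>I. x t * cos (real t * w))" "Im ?z = - (\<Sum>t\<in>I. x t * sin (real t * w))"
    by (simp_all add: exp_eq sum_negf)
  then have "(cmod ?z)\<^sup>2 = (\<Sum>t\<in>I. x t * cos (real t * w))\<^sup>2 + (\<Sum>t\<in>I. x t * sin (real t * w))\<^sup>2"
    by (simp add: cmod_power2)
  also have "\<dots> = (\<Sum>s\<in>I. \<Sum>t\<in>I. (cos (real s * w) * cos (real t * w) + sin (real s * w) * sin (real t * w)) * (x s * x t))"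
    by (simp add: power2_eq_square sum_product sum.distrib[symmetric] algebra_simps)
  also have "\<dots> = (\<Sum>s\<in>I. \<Sum>t\<in>I. cos (of_int (int s - int t) * w) * (x s * x t))"
    by (intro sum.cong refl) (simp add: cos_diff left_diff_distrib)
  finally show ?thesis .
qed

lemma averaged_periodogram_quadratic_form:
  fixes X :: "int \<Rightarrow> 'a \<Rightarrow> real"
  assumes m: "n \<ge> 1 \<Longrightarrow> m \<ge> 1"
  shows "sqrt (real m) * averaged_periodogram X m n \<omega>
     = (\<Sum>s<n. \<Sum>t<n. kern n m (int s - int t) * (X (int s + 1) \<omega> * X (int t + 1) \<omega>))"
proof (cases "n = 0")
  case True
  then show ?thesis by (simp add: averaged_periodogram_def periodogram_def)
next
  case False
  then have n: "0 < n" and m: "0 < m" using m by auto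
  let ?y = "\<lambda>t. X (int t) \<omega>" and ?w = "fourier_frequency n"
  have I: "{1..n} = Suc ` {..<n}" by (simp add: image_Suc_lessThan)
  have sm: "sqrt (real m) * (1 / real m) = 1 / sqrt (real m)" using m by (simp add: field_simps)
  have per: "periodogram X n w \<omega>
      = 1 / (2 * pi * real n) * (\<Sum>s\<in>{1..n}. \<Sum>t\<in>{1..n}. cos (of_int (int s - int t) * w) * (?y s * ?y t))" for w
  proof -
    have "periodogram X n w \<omega> = (1 / sqrt (2 * pi * real n))\<^sup>2 * (cmod (\<Sum>t=1..n. of_real (?y t) * exp (- \<i> * of_nat t * of_real w)))\<^sup>2"
      unfolding periodogram_def by (simp only: norm_mult norm_divide norm_one norm_of_real power_mult_distrib) simp
    also have "(1 / sqrt (2 * pi * real n))\<^sup>2 = 1 / (2 * pi * real n)" by (simp add: power_divide)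
    finally show ?thesis by (simp only: cmod_sum_exp_squared)
  qed
  have "sqrt (real m) * averaged_periodogram X m n \<omega>
      = 1 / sqrt (real m) * (\<Sum>j=1..m. 1 / (2 * pi * real n) * (\<Sum>s\<in>{1..n}. \<Sum>t\<in>{1..n}. cos (of_int (int s - int t) * ?w j) * (?y s * ?y t)))"
    unfolding averaged_periodogram_def mult.assoc[symmetric] sm per by simp
  also have "\<dots> = (\<Sum>j=1..m. \<Sum>s\<in>{1..n}. \<Sum>t\<in>{1..n}. cos (of_int (int s - int t) * ?w j) * (?y s * ?y t)) / (2 * pi * real n * sqrt (real m))"
    by (simp add: sum_divide_distrib mult_ac)
  also have "(\<Sum>j=1..m. \<Sum>s\<in>{1..n}. \<Sum>t\<in>{1..n}. cos (of_int (int s - int t) * ?w j) * (?y s * ?y t))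
      = (\<Sum>s\<in>{1..n}. \<Sum>t\<in>{1..n}. \<Sum>j=1..m. cos (of_int (int s - int t) * ?w j) * (?y s * ?y t))"
    by (subst sum.swap) (intro sum.cong refl sum.swap)
  also have "\<dots> / (2 * pi * real n * sqrt (real m)) = (\<Sum>s\<in>{1..n}. \<Sum>t\<in>{1..n}. kern n m (int s - int t) * (?y s * ?y t))"
    by (simp only: sum_divide_distrib kern_def fourier_frequency_def sum_distrib_right times_divide_eq_left)
  also have "\<dots> = (\<Sum>s<n. \<Sum>t<n. kern n m (int s - int t) * (X (int s + 1) \<omega> * X (int t + 1) \<omega>))"
    unfolding I by (simp add: sum.reindex add.commute)
  finally show ?thesis .
qed

text \<open>The infinite sum of a non-summable family is the junk value 0, so that \<open>f 0 \<noteq> 0\<close> already contains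
  the summability of the autocovariances.\<close>

lemma spectral_density_0:
  assumes "spectral_density M X 0 \<noteq> 0"
  shows "autocovariance M X summable_on UNIV"
    and "spectral_density M X 0 = (\<Sum>\<^sub>\<infinity>h. autocovariance M X h) / (2 * pi)"
proof -
  have eq: "spectral_density M X 0 = Re (1 / (2 * of_real pi) * (\<Sum>\<^sub>\<infinity>h. complex_of_real (autocovariance M X h)))"
    by (simp add: spectral_density_def)
  have "(\<lambda>h. complex_of_real (autocovariance M X h)) summable_on UNIV"
  proof (rule ccontr)
    assume "\<not> (\<lambda>h. complex_of_real (autocovariance M X h)) summable_on UNIV"
    then show False using assms eq by (simp add: infsum_not_exists)
  qed
  from summable_on_Re[OF this] show sum: "autocovariance M X summable_on UNIV" by simp
  then have "((\<lambda>h. complex_of_real (autocovariance M X h)) has_sum of_real (\<Sum>\<^sub>\<infinity>h. autocovariance M X h)) UNIV"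
    by (simp add: has_sum_of_real_iff)
  then have "(\<Sum>\<^sub>\<infinity>h. complex_of_real (autocovariance M X h)) = of_real (\<Sum>\<^sub>\<infinity>h. autocovariance M X h)"
    by (rule infsumI)
  then show "spectral_density M X 0 = (\<Sum>\<^sub>\<infinity>h. autocovariance M X h) / (2 * pi)"
    unfolding eq by simp
qed

lemma Lp_norm_4: "Lp_norm M 4 F = norm_Lp M 4 F"
proof -
  have "(LINT \<omega>|M. F \<omega> ^ 4) \<ge> 0" by (intro integral_nonneg_AE) (simp add: zero_le_even_power)
  then show ?thesis by (simp add: Lp_norm_def norm_Lp_def root_powr_inverse)
qed

theorem theorem2:
  fixes M :: "'a measure" and S :: "'s measure"
    and \<epsilon> \<epsilon>' :: "int \<Rightarrow> 'a \<Rightarrow> 's"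
    and g :: "(nat \<Rightarrow> 's) \<Rightarrow> real"
    and m :: "nat \<Rightarrow> nat"
  defines "X \<equiv> bernoulli_shift g \<epsilon>"
    and "X0 \<equiv> coupled_shift g \<epsilon> \<epsilon>'"
  defines "f \<equiv> spectral_density M X"
    and "Q \<equiv> (\<lambda>n. averaged_periodogram X (m n) n)"
  assumes "prob_space M"
    and "iid_sequence M S \<epsilon>"
    and "independent_copy M S \<epsilon>' \<epsilon>"
    and "g \<in> borel_measurable (PiM UNIV (\<lambda>_. S))"
    and "(LINT \<omega>|M. X 0 \<omega>) = 0"
    and "integrable M (\<lambda>\<omega>. \<bar>X 0 \<omega>\<bar> ^ 4)"
    and "summable (\<lambda>t. Lp_norm M 4 (\<lambda>\<omega>. X (int t) \<omega> - X0 (int t) \<omega>))"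
    and "f 0 > 0"
    and "\<And>n. n \<ge> 1 \<Longrightarrow> m n \<ge> 1"
    and "filterlim m at_top sequentially"
    and "(\<lambda>n. real (m n)) \<in> o(\<lambda>n. real n)"
  shows "weak_conv_m
           (\<lambda>n. distr M borel
              (\<lambda>\<omega>. sqrt (real (m n)) / f 0 * (Q n \<omega> - (LINT \<omega>'|M. Q n \<omega>'))))
           std_normal_distribution"
proof -
  interpret M: prob_space M by fact
  have indep: "M.indep_vars (\<lambda>_. S) \<epsilon> UNIV" and law: "distr M S (\<epsilon> s) = distr M S (\<epsilon> t)" for s t
    using assms(6) by (auto simp: iid_sequence_def)
  have [measurable]: "\<epsilon> t \<in> measurable M S" for t
    using indep by (simp add: M.indep_vars_def)
  \<comment> \<open>The canonical space is built on the common law of the innovations, so that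
    \<open>P\<close> becomes the law of the whole sequence. Its sigma-algebra is that of
    \<open>S\<close>, which allows the change of target space below.\<close>
  define \<mu> where "\<mu> = distr M S (\<epsilon> 0)"
  have prob_\<mu>: "prob_space \<mu>" unfolding \<mu>_def by (rule M.prob_space_distr) simp
  interpret iid_space \<mu> by (simp add: iid_space_def prob_\<mu>)
  have sets_P: "sets P = sets (PiM UNIV (\<lambda>_::int. S))"
    unfolding P_def by (rule sets_PiM_cong) (simp_all add: \<mu>_def)
  define e where "e \<omega> = (\<lambda>t. \<epsilon> t \<omega>)" for \<omega>
  define e' where "e' \<omega> = (\<lambda>t. \<epsilon>' t \<omega>)" for \<omega>
  have law_e0: "distr M (PiM UNIV (\<lambda>_::int. S)) e = P"
  proof -
    have "distr M (PiM UNIV (\<lambda>_::int. S)) (\<lambda>\<omega>. \<lambda>t\<in>UNIV. \<epsilon> t \<omega>) = PiM UNIV (\<lambda>t. distr M S (\<epsilon> t))"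
      using indep by (subst (asm) M.indep_vars_iff_distr_eq_PiM) auto
    also have "(\<lambda>t. distr M S (\<epsilon> t)) = (\<lambda>_. \<mu>)" unfolding \<mu>_def using law by blast
    finally show ?thesis by (simp add: P_def e_def[abs_def])
  qed
  have law_e: "distr M P e = P"
    unfolding law_e0[symmetric] by (rule distr_cong) (simp_all add: sets_P law_e0)
  have copy: "M.indep_var (PiM UNIV (\<lambda>_. S)) e (PiM UNIV (\<lambda>_. S)) e'"
      "distr M (PiM UNIV (\<lambda>_. S)) e' = distr M (PiM UNIV (\<lambda>_. S)) e"
    using assms(7) by (auto simp: independent_copy_def e_def[abs_def] e'_def[abs_def])
  then have meas0: "e \<in> measurable M (PiM UNIV (\<lambda>_. S))" "e' \<in> measurable M (PiM UNIV (\<lambda>_. S))"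
    and joint0: "distr M (PiM UNIV (\<lambda>_. S) \<Otimes>\<^sub>M PiM UNIV (\<lambda>_. S)) (\<lambda>\<omega>. (e \<omega>, e' \<omega>)) = P \<Otimes>\<^sub>M P"
    by (auto simp: M.indep_var_distribution_eq law_e0)
  have e_meas [measurable]: "e \<in> measurable M P" and e'_meas [measurable]: "e' \<in> measurable M P"
    using meas0 measurable_cong_sets[OF refl sets_P, of M] by auto
  \<comment> \<open>This is the place where independence of the copy enters: the pair of sequences
    has the product law on which influences are defined.\<close>
  have joint: "distr M (P \<Otimes>\<^sub>M P) (\<lambda>\<omega>. (e \<omega>, e' \<omega>)) = P \<Otimes>\<^sub>M P"
    unfolding joint0[symmetric] by (rule distr_cong) (simp_all add: joint0 sets_pair_measure_cong[OF sets_P sets_P])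
  \<comment> \<open>\<open>g\<close> read as a function of the two-sided sequence, so that
    \<open>X t\<close> is \<open>F\<close> after a shift by \<open>t\<close>. Resampling innovation
    0 at time \<open>t\<close> is then resampling coordinate \<open>- t\<close> of \<open>F\<close>,
    and the assumed series is the sum of the influences of \<open>F\<close>.\<close>
  define F where "F x = g (\<lambda>k. x (- int k))" for x
  have F_meas [measurable]: "F \<in> borel_measurable P"
  proof -
    have "(\<lambda>x k. x (- int k)) \<in> measurable P (PiM UNIV (\<lambda>_::nat. S))"
    proof (rule measurable_PiM_single')
      fix k :: nat
      have "measurable P \<mu> = measurable P S" by (rule measurable_cong_sets) (simp_all add: \<mu>_def)
      then show "(\<lambda>x. x (- int k)) \<in> measurable P S" using measurable_P_component[of "- int k"] by simp
    next
      have "space \<mu> = space S" by (simp add: \<mu>_def)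
      then show "(\<lambda>x k. x (- int k)) \<in> space P \<rightarrow> (UNIV :: nat set) \<rightarrow>\<^sub>E space S"
        using measurable_space[OF measurable_P_component] by (auto simp: PiE_iff)
    qed
    from measurable_compose[OF this assms(8)] show ?thesis by (simp add: F_def[abs_def])
  qed
  have X_eq: "X t \<omega> = F (sh t (e \<omega>))" for t \<omega>
    by (simp add: X_def bernoulli_shift_def F_def sh_def e_def add.commute)
  have X0_eq: "X0 t \<omega> = F (sh t (mrg {0} (e' \<omega>) (e \<omega>)))" for t \<omega>
    unfolding X0_def coupled_shift_def bernoulli_shift_def F_def sh_def mrg_def e_def e'_def
    by (intro arg_cong[of _ _ g] ext) auto
  have int_e: "(LINT \<omega>|M. H (e \<omega>)) = (LINT x|P. H x)" if "H \<in> borel_measurable P"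
    for H :: "(int \<Rightarrow> 's) \<Rightarrow> 'b :: {banach, second_countable_topology}"
    using integral_distr[OF e_meas that] by (simp add: law_e)
  have sh0: "sh 0 x = x" for x :: "int \<Rightarrow> 's" by (simp add: sh_def)
  have F4: "in_Lp P 4 F"
    using in_Lp_distr[OF e_meas F_meas, of 4] assms(10) F_meas
    by (simp add: law_e in_Lp_def X_eq sh0 power_even_abs)
  have EF: "(LINT x|P. F x) = 0"
    using assms(9) int_e[OF F_meas] by (simp add: X_eq sh0)
  have infl: "Lp_norm M 4 (\<lambda>\<omega>. X (int t) \<omega> - X0 (int t) \<omega>) = influence 4 F (- int t)" for t
  proof -
    have "Lp_norm M 4 (\<lambda>\<omega>. X (int t) \<omega> - X0 (int t) \<omega>) = influence 4 (\<lambda>x. F (sh (int t) x)) 0"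
      using norm_Lp_distr[of "\<lambda>\<omega>. (e \<omega>, e' \<omega>)" M "P \<Otimes>\<^sub>M P" "\<lambda>z. F (sh (int t) (fst z)) - F (sh (int t) (mrg {0} (snd z) (fst z)))" 4]
      by (simp add: Lp_norm_4 influence_def joint X_eq X0_eq)
    then show ?thesis by (simp add: influence_sh)
  qed
  define \<Theta> where "\<Theta> = (\<Sum>t. influence 4 F (- int t))"
  have sums: "summable (\<lambda>t. influence 4 F (- int t))" using assms(11) by (simp add: infl)
  have isl: "influence_sum_le F \<Theta>"
    unfolding influence_sum_le_def
  proof (intro allI impI)
    fix J :: "int set" assume J: "finite J"
    \<comment> \<open>Causality: coordinates with positive index have no influence, so the series
      over t \<ge> 0 accounts for all of them.\<close>
    have dep: "dep_on {..0} F"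
      unfolding dep_on_def F_def by (auto intro!: arg_cong[of _ _ g])
    have zero: "influence 4 F k = 0" if "\<not> k \<le> 0" for k
      using that by (intro influence_dep_on[OF _ dep]) auto
    have "(\<Sum>k\<in>J. influence 4 F k) = (\<Sum>k\<in>J \<inter> {..0}. influence 4 F k)"
      using J zero by (intro sum.mono_neutral_right) auto
    also have "\<dots> = (\<Sum>t\<in>(\<lambda>k. nat (- k)) ` (J \<inter> {..0}). influence 4 F (- int t))"
      by (subst sum.reindex) (auto simp: inj_on_def)
    also have "\<dots> \<le> \<Theta>" unfolding \<Theta>_def using J by (intro sum_le_suminf sums) auto
    finally show "(\<Sum>k\<in>J. influence 4 F k) \<le> \<Theta>" .
  qed
  have EX: "(LINT \<omega>|M. X t \<omega>) = 0" for t
    using int_e[of "\<lambda>x. F (sh t x)"] EF by (simp add: X_eq integral_sh)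
  have acov: "autocovariance M X h = (LINT x|P. F (sh h x) * F x)" for h
    using int_e[of "\<lambda>x. F (sh h x) * F x"]
    unfolding autocovariance_def covariance_def EX by (simp add: X_eq sh0)
  have f0: "f 0 \<noteq> 0" "0 < f 0" using assms(12) by auto
  have summable: "(\<lambda>h. LINT x|P. F (sh h x) * F x) summable_on UNIV"
    and f0_eq: "f 0 = (\<Sum>\<^sub>\<infinity>h. LINT x|P. F (sh h x) * F x) / (2 * pi)"
    using spectral_density_0[of M X] f0 by (simp_all add: f_def acov[abs_def] acov)
  have mn: "(\<lambda>n. real (m n) / real n) \<longlonglongrightarrow> 0" by (rule smalloD_tendsto[OF assms(15)])
  define T where "T n x = (\<Sum>s<n. \<Sum>t<n. kern n (m n) (int s - int t) * (F (sh (int s + 1) x) * F (sh (int t + 1) x)))" for n x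
  have T_meas [measurable]: "T n \<in> borel_measurable P" for n unfolding T_def[abs_def] by measurable
  have QT: "sqrt (real (m n)) * Q n \<omega> = T n (e \<omega>)" for n \<omega>
    unfolding Q_def T_def using averaged_periodogram_quadratic_form[of n "m n" X \<omega>] assms(13)[of n]
    by (simp add: X_eq)
  have Z_eq: "sqrt (real (m n)) / f 0 * (Q n \<omega> - (LINT \<omega>'|M. Q n \<omega>')) = (T n (e \<omega>) - (LINT x|P. T n x)) / f 0" for n \<omega>
  proof -
    have "(LINT x|P. T n x) = sqrt (real (m n)) * (LINT \<omega>'|M. Q n \<omega>')"
      using int_e[OF T_meas[of n]] by (simp add: QT[symmetric])
    then show ?thesis using QT[of n \<omega>] by (simp add: right_diff_distrib diff_divide_distrib)
  qed
  show ?thesis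
    unfolding Z_eq
  proof (rule levy_continuity)
    show "real_distribution (distr M borel (\<lambda>\<omega>. (T n (e \<omega>) - (LINT x|P. T n x)) / f 0))" for n
      by (rule M.real_distribution_distr) measurable
    show "real_distribution std_normal_distribution" by (rule real_dist_normal_dist)
    fix t :: real
    have char_eq: "char (distr M borel (\<lambda>\<omega>. (T n (e \<omega>) - (LINT x|P. T n x)) / f 0)) t
        = (CLINT x|P. iexp (t / f 0 * (T n x - (LINT x|P. T n x))))" for n
    proof -
      have "char (distr M borel (\<lambda>\<omega>. (T n (e \<omega>) - (LINT x|P. T n x)) / f 0)) t
          = (CLINT \<omega>|M. iexp (t * ((T n (e \<omega>) - (LINT x|P. T n x)) / f 0)))"
        unfolding char_def by (rule integral_distr) measurable
      also have "\<dots> = (CLINT x|P. iexp (t * ((T n x - (LINT x|P. T n x)) / f 0)))"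
        by (rule int_e[of "\<lambda>x. iexp (t * ((T n x - (LINT x|P. T n x)) / f 0))"]) measurable
      finally show ?thesis by simp
    qed
    \<comment> \<open>The limit theorem is applied at the frequency \<open>t / f 0\<close>, where
      the limiting variance \<open>(f 0)\<^sup>2\<close> cancels.\<close>
    have normal: "char std_normal_distribution t = exp (- ((t / f 0)\<^sup>2 * (f 0)\<^sup>2 / 2))"
      using f0(1) by (simp add: char_std_normal_distribution power_divide)
    have "(\<lambda>n. CLINT x|P. iexp (t / f 0 * (T n x - (LINT x|P. T n x)))) \<longlonglongrightarrow> exp (- ((t / f 0)\<^sup>2 * (f 0)\<^sup>2 / 2))"
      using quadratic_form_char_tendsto[OF F4 EF isl summable assms(14) mn, of "t / f 0"]
      unfolding T_def f0_eq .
    then show "(\<lambda>n. char (distr M borel (\<lambda>\<omega>. (T n (e \<omega>) - (LINT x|P. T n x)) / f 0)) t) \<longlonglongrightarrow> char std_normal_distribution t"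
      unfolding char_eq normal .
  qed
qed

end
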